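(* Let $I\subseteq\mathbb{R}$ be an open interval (bounded or unbounded), and let $\gamma\in C^2(\overline{I};\mathbb{R}^2)$ be a unit-speed curve whose curvature $\kappa:=\det(\dot\gamma,\ddot\gamma)$ is bounded and uniformly continuous on $I$. Assume that for all sufficiently small $\varepsilon>0$ the map $\mathcal{L}_\varepsilon:\overline{I}\times[0,1]\to\mathbb{R}^2$, $\mathcal{L}_\varepsilon(s,t):=\gamma(s)+\varepsilon\,t\,n(s)$, is injective, where $n:=(-\dot\gamma^2,\dot\gamma^1)$. For such $\varepsilon$ with $\varepsilon\sup_I|\kappa|<1$, let $\Omega_\varepsilon:=\mathcal{L}_\varepsilon(I\times(0,1))$ and let $-\Delta_{DN}^{\Omega_\varepsilon}$ be the Laplacian in $L^2(\Omega_\varepsilon)$ with Neumann boundary condition on the curve $\gamma_\varepsilon(I):=\mathcal{L}_\varepsilon(I\times\{1\})$ and Dirichlet boundary conditions on the rest of $\partial\Omega_\varepsilon$. Then for every integer $j\ge 1$, $$\lambda_j(-\Delta_{DN}^{\Omega_\varepsilon})=\left(\frac{\pi}{2\varepsilon}\right)^2+\frac{\inf_I\kappa}{\varepsilon}+o(\varepsilon^{-1})\qquad\text{as }\varepsilon\to0.$$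
   Context: Under the stated hypotheses, $\mathcal{L}_\varepsilon$ induces a diffeomorphism from $I\times(0,1)$ onto the open strip $\Omega_\varepsilon$, with Jacobian $\varepsilon(1-\kappa(s)\varepsilon t)$. The operator $-\Delta_{DN}^{\Omega_\varepsilon}$ is the self-adjoint operator in $L^2(\Omega_\varepsilon)$ associated with the quadratic form $\Psi\mapsto\int_{\Omega_\varepsilon}|\nabla\Psi|^2\,dx$ with domain $\{\Psi\in W^{1,2}(\Omega_\varepsilon):\ \Psi=0 \text{ on } \partial\Omega_\varepsilon\setminus\gamma_\varepsilon(I)\}$ (in the sense of traces). In particular Dirichlet conditions are imposed on $\gamma(I)$ and, if $\partial I\neq\emptyset$, on the straight segments $\mathcal{L}_\varepsilon(\{\inf I\}\times(0,1))$ and/or $\mathcal{L}_\varepsilon(\{\sup I\}\times(0,1))$ at the finite endpoints of $I$. For a self-adjoint operator $H$ bounded from below with associated quadratic form $Q$, $\{\lambda_j(H)\}_{j\ge1}$ denotes the non-decreasing sequence of minimax (Rayleigh–Ritz) numbers $$\lambda_j(H)=\inf_{\substack{V\subset D(Q)\\ \dim V=j}}\ \sup_{\psi\in V\setminus\{0\}}\frac{Q[\psi]}{\|\psi\|^2};$$ each is either a discrete eigenvalue below the essential spectrum (repeated according to multiplicity) or the threshold of the essential spectrum of $H$. *)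

theory Defs
  imports "HOL-Analysis.Analysis" "HOL-Library.Landau_Symbols"
begin

section \<open>Function spaces on open subsets of the plane\<close>

text \<open>Functions on \<open>\<Omega>\<close> are represented by total functions; only their values on \<open>\<Omega>\<close>, up to
  Lebesgue null sets, matter. Elements of \<open>L\<^sup>2(\<Omega>)\<close> are complex valued. The norm on \<open>complex^2\<close> is
  the Hermitian Euclidean norm, so the squared norm of a gradient is the sum of the squared moduli
  of the two partial derivatives.\<close>

definition L2_on :: "'a::euclidean_space set \<Rightarrow> ('a \<Rightarrow> 'b::real_normed_vector) \<Rightarrow> bool" where
  "L2_on S f \<longleftrightarrow>
     f \<in> borel_measurable (lebesgue_on S) \<and> integrable (lebesgue_on S) (\<lambda>x. (norm (f x))\<^sup>2)"

definition L2_sq :: "'a::euclidean_space set \<Rightarrow> ('a \<Rightarrow> 'b::real_normed_vector) \<Rightarrow> real" where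
  "L2_sq S f = (\<integral>x. (norm (f x))\<^sup>2 \<partial>(lebesgue_on S))"

definition partial_deriv :: "2 \<Rightarrow> (real^2 \<Rightarrow> 'b::real_normed_vector) \<Rightarrow> real^2 \<Rightarrow> 'b" where
  "partial_deriv i f x = frechet_derivative f (at x) (axis i 1)"

text \<open>\<open>Ck_on k \<Omega> f\<close> is meant for open \<open>\<Omega>\<close>.\<close>

primrec Ck_on :: "nat \<Rightarrow> (real^2) set \<Rightarrow> (real^2 \<Rightarrow> 'b::real_normed_vector) \<Rightarrow> bool" where
  "Ck_on 0 \<Omega> f \<longleftrightarrow> continuous_on \<Omega> f"
| "Ck_on (Suc k) \<Omega> f \<longleftrightarrow>
     (\<forall>x\<in>\<Omega>. f differentiable (at x)) \<and> (\<forall>i. Ck_on k \<Omega> (partial_deriv i f))"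

definition test_functions :: "(real^2) set \<Rightarrow> (real^2 \<Rightarrow> real) set" where
  "test_functions \<Omega> = {\<phi>. (\<forall>k. Ck_on k UNIV \<phi>) \<and>
     compact (closure {x. \<phi> x \<noteq> 0}) \<and> closure {x. \<phi> x \<noteq> 0} \<subseteq> \<Omega>}"

definition is_weak_gradient ::
    "(real^2) set \<Rightarrow> (real^2 \<Rightarrow> complex) \<Rightarrow> (real^2 \<Rightarrow> complex^2) \<Rightarrow> bool" where
  "is_weak_gradient \<Omega> u g \<longleftrightarrow> (\<forall>\<phi>\<in>test_functions \<Omega>. \<forall>i.
     (\<integral>x. partial_deriv i \<phi> x *\<^sub>R u x \<partial>(lebesgue_on \<Omega>)) =
     - (\<integral>x. \<phi> x *\<^sub>R (g x $ i) \<partial>(lebesgue_on \<Omega>)))"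

definition W12 :: "(real^2) set \<Rightarrow> (real^2 \<Rightarrow> complex) set" where
  "W12 \<Omega> = {u. L2_on \<Omega> u \<and> (\<exists>g. L2_on \<Omega> g \<and> is_weak_gradient \<Omega> u g)}"

text \<open>The choice in \<open>weak_gradient\<close> is unique up to null sets for \<open>u\<close> in \<open>W12 \<Omega>\<close>, \<open>\<Omega>\<close> open.\<close>

definition weak_gradient :: "(real^2) set \<Rightarrow> (real^2 \<Rightarrow> complex) \<Rightarrow> (real^2 \<Rightarrow> complex^2)" where
  "weak_gradient \<Omega> u = (SOME g. L2_on \<Omega> g \<and> is_weak_gradient \<Omega> u g)"

definition dirichlet_energy :: "(real^2) set \<Rightarrow> (real^2 \<Rightarrow> complex) \<Rightarrow> real" where
  "dirichlet_energy \<Omega> u = L2_sq \<Omega> (weak_gradient \<Omega> u)"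


section \<open>Traces\<close>

definition unit_speed_arc :: "(real \<Rightarrow> real^2) \<Rightarrow> real \<Rightarrow> real \<Rightarrow> bool" where
  "unit_speed_arc c a b \<longleftrightarrow> a < b \<and> inj_on c {a..b} \<and>
     (\<exists>c'. continuous_on {a..b} c' \<and>
       (\<forall>\<tau>\<in>{a..b}. (c has_vector_derivative c' \<tau>) (at \<tau> within {a..b}) \<and> norm (c' \<tau>) = 1))"

text \<open>The trace operator is the continuous extension, from \<open>W\<^sup>1\<^sup>,\<^sup>2(\<Omega>)\<close> to \<open>L\<^sup>2\<close> of the boundary with
  respect to arc length, of the restriction map on functions continuous up to the boundary.
  Accordingly \<open>u\<close> has trace \<open>g\<close> along a unit-speed arc \<open>c\<close> in \<open>\<partial>\<Omega>\<close> iff some functions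
  \<open>U n \<in> C\<^sup>1(\<Omega>) \<inter> C(closure \<Omega>) \<inter> W\<^sup>1\<^sup>,\<^sup>2(\<Omega>)\<close> converge to \<open>u\<close> in \<open>W\<^sup>1\<^sup>,\<^sup>2(\<Omega>)\<close> while their
  restrictions to \<open>c\<close> converge to \<open>g\<close> in \<open>L\<^sup>2\<close>.\<close>

definition has_trace_along ::
    "(real^2) set \<Rightarrow> (real^2 \<Rightarrow> complex) \<Rightarrow> (real \<Rightarrow> real^2) \<Rightarrow> real \<Rightarrow> real \<Rightarrow> (real \<Rightarrow> complex) \<Rightarrow> bool"
  where
  "has_trace_along \<Omega> u c a b g \<longleftrightarrow> L2_on {a..b} g \<and>
     (\<exists>U :: nat \<Rightarrow> real^2 \<Rightarrow> complex.
        (\<forall>n. U n \<in> W12 \<Omega> \<and> Ck_on 1 \<Omega> (U n) \<and> continuous_on (closure \<Omega>) (U n)) \<and>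
        (\<lambda>n. L2_sq \<Omega> (\<lambda>x. U n x - u x) + dirichlet_energy \<Omega> (\<lambda>x. U n x - u x)) \<longlonglongrightarrow> 0 \<and>
        (\<lambda>n. L2_sq {a..b} (\<lambda>\<tau>. U n (c \<tau>) - g \<tau>)) \<longlonglongrightarrow> 0)"

text \<open>If \<open>\<Gamma>\<close> is, up to a set of zero length, a countable union of \<open>C\<^sup>1\<close> arcs, the trace vanishes
  almost everywhere on \<open>\<Gamma>\<close> iff it vanishes along every \<open>C\<^sup>1\<close> arc contained in \<open>\<Gamma>\<close>.\<close>

definition trace_zero_on :: "(real^2) set \<Rightarrow> (real^2) set \<Rightarrow> (real^2 \<Rightarrow> complex) \<Rightarrow> bool" where
  "trace_zero_on \<Omega> \<Gamma> u \<longleftrightarrow>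
     (\<forall>c a b. unit_speed_arc c a b \<and> c ` {a..b} \<subseteq> \<Gamma> \<longrightarrow> has_trace_along \<Omega> u c a b (\<lambda>_. 0))"


section \<open>The Dirichlet-Neumann form and minimax numbers\<close>

text \<open>Domain of the quadratic form \<open>dirichlet_energy \<Omega>\<close> that defines the Laplacian on \<open>\<Omega>\<close> with
  Neumann condition on \<open>N\<close> and Dirichlet condition on the rest of the boundary.\<close>

definition DN_form_domain :: "(real^2) set \<Rightarrow> (real^2) set \<Rightarrow> (real^2 \<Rightarrow> complex) set" where
  "DN_form_domain \<Omega> N = {u \<in> W12 \<Omega>. trace_zero_on \<Omega> (frontier \<Omega> - N) u}"

text \<open>Dimension is that of the image in \<open>L\<^sup>2\<close>, i.e. modulo equality almost everywhere.\<close>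

definition subspace_of_dim :: "'a measure \<Rightarrow> nat \<Rightarrow> ('a \<Rightarrow> complex) set \<Rightarrow> bool" where
  "subspace_of_dim M j V \<longleftrightarrow> (\<exists>b :: nat \<Rightarrow> 'a \<Rightarrow> complex.
     V = {(\<lambda>x. \<Sum>i<j. c i * b i x) | c. True} \<and>
     (\<forall>c. (AE x in M. (\<Sum>i<j. c i * b i x) = 0) \<longrightarrow> (\<forall>i<j. c i = 0)))"

definition minimax_number ::
    "'a measure \<Rightarrow> ('a \<Rightarrow> complex) set \<Rightarrow> (('a \<Rightarrow> complex) \<Rightarrow> real) \<Rightarrow> nat \<Rightarrow> ereal" where
  "minimax_number M D Q j =
     (INF V\<in>{V. V \<subseteq> D \<and> subspace_of_dim M j V}.
        SUP \<psi>\<in>{\<psi>\<in>V. \<not> (AE x in M. \<psi> x = 0)}.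
          ereal (Q \<psi> / (\<integral>x. (norm (\<psi> x))\<^sup>2 \<partial>M)))"

definition lambda_DN :: "(real^2) set \<Rightarrow> (real^2) set \<Rightarrow> nat \<Rightarrow> ereal" where
  "lambda_DN \<Omega> N j =
     minimax_number (lebesgue_on \<Omega>) (DN_form_domain \<Omega> N) (dirichlet_energy \<Omega>) j"


section \<open>Curved strips\<close>

text \<open>Derivatives at finite endpoints of \<open>S\<close> are one-sided.\<close>

definition C2_curve_on ::
    "real set \<Rightarrow> (real \<Rightarrow> real^2) \<Rightarrow> (real \<Rightarrow> real^2) \<Rightarrow> (real \<Rightarrow> real^2) \<Rightarrow> bool" where
  "C2_curve_on S \<gamma> \<gamma>' \<gamma>'' \<longleftrightarrow>
     (\<forall>s\<in>S. (\<gamma> has_vector_derivative \<gamma>' s) (at s within S)) \<and>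
     (\<forall>s\<in>S. (\<gamma>' has_vector_derivative \<gamma>'' s) (at s within S)) \<and>
     continuous_on S \<gamma>''"

definition curvature :: "(real \<Rightarrow> real^2) \<Rightarrow> (real \<Rightarrow> real^2) \<Rightarrow> real \<Rightarrow> real" where
  "curvature \<gamma>' \<gamma>'' s = det (vector [\<gamma>' s, \<gamma>'' s] :: real^2^2)"

definition normal_vec :: "(real \<Rightarrow> real^2) \<Rightarrow> real \<Rightarrow> real^2" where
  "normal_vec \<gamma>' s = vector [- (\<gamma>' s $ 2), \<gamma>' s $ 1]"

definition strip_map ::
    "(real \<Rightarrow> real^2) \<Rightarrow> (real \<Rightarrow> real^2) \<Rightarrow> real \<Rightarrow> real \<times> real \<Rightarrow> real^2" where
  "strip_map \<gamma> \<gamma>' \<epsilon> = (\<lambda>(s, t). \<gamma> s + (\<epsilon> * t) *\<^sub>R normal_vec \<gamma>' s)"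

end

theory Submission
  imports Defs "HOL-Real_Asymp.Real_Asymp"
begin

text \<open>In strip coordinates \<open>(s, t)\<close> the form splits into a transversal and a longitudinal part.
  Dropping the longitudinal part, each fibre carries the form \<open>\<integral> |w'|\<^sup>2 (1 - k t) dt\<close> with
  \<open>k = \<epsilon> \<kappa>(s)\<close>, whose lowest eigenvalue under \<open>w 0 = 0\<close> is \<open>\<pi>\<^sup>2/4 + k + O(\<epsilon>\<^sup>2)\<close>, uniformly for bounded
  \<open>\<kappa>\<close>; Picone's inequality proves this with an additional boundary term \<open>|w 0|\<^sup>2\<close>, so that it applies to
  the \<open>C\<^sup>1\<close> functions in the definition of the trace. This bounds all minimax numbers from below.
  Conversely, products of \<open>sin (\<pi> t / 2)\<close> with \<open>j\<close> bumps in \<open>s\<close> that have disjoint supports in the region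
  \<open>\<kappa> < inf \<kappa> + \<eta>\<close> have Rayleigh quotients at most
  \<open>(\<pi> / (2 \<epsilon>))\<^sup>2 + (inf \<kappa> + \<eta>) / \<epsilon> + O(1)\<close>.\<close>

section \<open>Smooth functions\<close>

text \<open>The trace is given only through approximating C^1 functions, which need not vanish on
  the curve. The lower bound is therefore proved for such approximants on compact pieces of the
  strip, with a boundary penalty whose coefficient may blow up as \<epsilon> \<rightarrow> 0; at
  fixed \<epsilon> the approximation removes the penalty before \<epsilon> tends to 0. The term k
  comes from first order perturbation: the integral of (pi^2/4) (cos^2 - sin^2) (1 - k t), at the
  angle pi t / 2, is k/2, while the integral of sin^2 is 1/2. With k = \<epsilon> \<kappa>(s),
  division by \<epsilon>^2 gives \<kappa>(s)/\<epsilon>, and the fibre error O(\<epsilon>^2) becomes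
  O(1). The bumps sit on an interval fixed before \<epsilon>, so their longitudinal energy also
  costs O(1); what is not O(1) in the remainder is \<eta>/\<epsilon>, since inf \<kappa> need not be
  attained. Because energies are defined by an arbitrary choice of weak gradient, uniqueness of weak
  gradients must be available; the smooth functions supply the test functions for it.\<close>

primrec smooth_upto :: "nat \<Rightarrow> (real \<Rightarrow> real) \<Rightarrow> bool" where
  "smooth_upto 0 f \<longleftrightarrow> continuous_on UNIV f"
| "smooth_upto (Suc k) f \<longleftrightarrow>
     (\<exists>f'. (\<forall>x. (f has_real_derivative f' x) (at x)) \<and> smooth_upto k f')"

lemma smooth_upto_lincomb:
  assumes "smooth_upto k f" "smooth_upto k g"
  shows "smooth_upto k (\<lambda>x. f x + c * g x)"
  using assms
proof (induction k arbitrary: f g)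
  case 0
  then show ?case by (auto intro!: continuous_intros)
next
  case (Suc k)
  then obtain f' g' where "\<And>x. (f has_real_derivative f' x) (at x)" "smooth_upto k f'"
     "\<And>x. (g has_real_derivative g' x) (at x)" "smooth_upto k g'" by auto
  then show ?case using Suc.IH[of f' g']
    by (auto intro!: exI[of _ "\<lambda>x. f' x + c * g' x"] derivative_eq_intros)
qed

text \<open>The family is closed under differentiation up to linear combinations: differentiating
  exp(-1/x) only produces further powers of 1/x. The case n = 0 is the standard smooth function that
  is flat at 0.\<close>

definition flat :: "nat \<Rightarrow> real \<Rightarrow> real" where
  "flat n x = (if x \<le> 0 then 0 else (1 / x) ^ n * exp (- (1 / x)))"

lemma flat_nonneg: "flat n x \<ge> 0"
  by (auto simp: flat_def)

lemma flat_tendsto_0: "(flat n \<longlongrightarrow> 0) (at_right 0)"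
proof -
  have "((\<lambda>x::real. (inverse x) ^ n / exp (inverse x)) \<longlongrightarrow> 0) (at_right 0)"
    using filterlim_compose[OF tendsto_power_div_exp_0 filterlim_inverse_at_top_right] .
  moreover have "\<forall>\<^sub>F x in at_right 0. (inverse x) ^ n / exp (inverse x) = flat n x"
    unfolding eventually_at_right_field flat_def
    by (intro exI[of _ 1]) (auto simp: exp_minus divide_simps)
  ultimately show ?thesis by (rule Lim_transform_eventually)
qed

lemma flat_deriv: "(flat n has_real_derivative flat (n + 2) x - n * flat (n + 1) x) (at x)"
proof (cases "x = 0")
  case False
  show ?thesis
  proof (cases "x < 0")
    case True
    have "((\<lambda>_::real. 0::real) has_real_derivative 0) (at x)" by simp
    then have "(flat n has_real_derivative 0) (at x)"
      by (rule has_field_derivative_transform_within_open[of _ _ _ "{..<0}"])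
         (use True in \<open>auto simp: flat_def\<close>)
    then show ?thesis using True by (simp add: flat_def)
  next
    case xn: False
    with False have x: "x > 0" by simp
    have "((\<lambda>x. (1 / x) ^ n * exp (- (1 / x))) has_real_derivative
        flat (n + 2) x - n * flat (n + 1) x) (at x)"
    proof (cases n)
      case 0
      then show ?thesis using x
        by (auto intro!: derivative_eq_intros simp: flat_def power2_eq_square field_simps)
    next
      case (Suc k)
      have "((\<lambda>x. 1 / x) has_real_derivative (- ((1 / x)^2))) (at x)"
        using x by (auto intro!: derivative_eq_intros simp: power2_eq_square field_simps)
      from DERIV_mult[OF DERIV_power[OF this, of n] DERIV_exp[THEN DERIV_chain2, OF DERIV_minus[OF this]]]
      show ?thesis
        by (rule DERIV_cong) (use x Suc in \<open>simp add: flat_def algebra_simps power_add power2_eq_square\<close>)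
    qed
    then show ?thesis
      by (rule has_field_derivative_transform_within_open[of _ _ _ "{0<..}"])
         (use x in \<open>auto simp: flat_def\<close>)
  qed
next
  case True
  \<comment> \<open>At the origin the right difference quotient of \<open>flat n\<close> is
    \<open>flat (Suc n)\<close>, whose limit is already known.\<close>
  have 1: "((\<lambda>h. (flat n (0 + h) - flat n 0) / h) \<longlongrightarrow> 0) (at_right 0)"
  proof (rule Lim_transform_eventually[OF flat_tendsto_0[of "Suc n"]])
    show "\<forall>\<^sub>F h in at_right 0. flat (Suc n) h = (flat n (0 + h) - flat n 0) / h"
      unfolding eventually_at_right_field by (intro exI[of _ 1]) (auto simp: flat_def)
  qed
  have 2: "((\<lambda>h. (flat n (0 + h) - flat n 0) / h) \<longlongrightarrow> 0) (at_left 0)"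
  proof (rule Lim_transform_eventually[OF tendsto_const[of 0]])
    show "\<forall>\<^sub>F h in at_left 0. 0 = (flat n (0 + h) - flat n 0) / h"
      unfolding eventually_at_left_field by (intro exI[of _ "-1"]) (auto simp: flat_def)
  qed
  from 1 2 have "((\<lambda>h. (flat n (0 + h) - flat n 0) / h) \<longlongrightarrow> 0) (at 0)"
    by (simp add: filterlim_at_split)
  then show ?thesis using True by (simp add: DERIV_def flat_def)
qed

lemma smooth_upto_flat: "smooth_upto k (flat n)"
proof (induction k arbitrary: n)
  case 0
  show ?case
    by (auto intro!: continuous_at_imp_continuous_on DERIV_isCont flat_deriv)
next
  case (Suc k)
  then show ?case
    using smooth_upto_lincomb[OF Suc.IH[of "n+2"] Suc.IH[of "n+1"], of "- real n"]
    by (auto intro!: exI[of _ "\<lambda>x. flat (n + 2) x - n * flat (n + 1) x"] flat_deriv simp del: One_nat_def add_2_eq_Suc')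
qed

lemma smooth_upto_affine:
  assumes "smooth_upto k f"
  shows "smooth_upto k (\<lambda>x. f (m * x + c))"
  using assms
proof (induction k arbitrary: f)
  case 0
  then show ?case
    by (auto intro!: continuous_intros continuous_on_compose2[of UNIV f])
next
  case (Suc k)
  then obtain f' where f: "\<And>x. (f has_real_derivative f' x) (at x)" "smooth_upto k f'" by auto
  have "((\<lambda>x. f (m * x + c)) has_real_derivative m * f' (m * x + c)) (at x)" for x
  proof -
    have "((\<lambda>x. m * x + c) has_real_derivative m) (at x)"
      by (auto intro!: derivative_eq_intros)
    from DERIV_chain2[OF f(1) this] show ?thesis by (simp add: mult.commute)
  qed
  moreover have "smooth_upto k (\<lambda>x. m * f' (m * x + c))"
  proof -
    have "smooth_upto k (\<lambda>_. 0)" by (induction k) (auto intro!: exI[of _ "\<lambda>_. 0"])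
    from smooth_upto_lincomb[OF this Suc.IH[OF f(2)], of m] show ?thesis by simp
  qed
  ultimately show ?case by (auto intro!: exI[of _ "\<lambda>x. m * f' (m * x + c)"])
qed

section \<open>Calculus of C^k functions of two variables\<close>

lemma partial_deriv_eq:
  assumes "(f has_derivative f') (at x)"
  shows "partial_deriv i f x = f' (axis i 1)"
  using frechet_derivative_at[OF assms] by (simp add: partial_deriv_def)

lemma Ck_on_SucI:
  assumes "\<And>x. (f has_derivative f' x) (at x)" "\<And>i. Ck_on k UNIV (\<lambda>x. f' x (axis i 1))"
  shows "Ck_on (Suc k) UNIV f"
proof -
  have "partial_deriv i f = (\<lambda>x. f' x (axis i 1))" for i
    using partial_deriv_eq[OF assms(1)] by auto
  then show ?thesis using assms by (auto simp: differentiable_def)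
qed

lemma has_derivative_frechet: "f differentiable (at x) \<Longrightarrow> (f has_derivative frechet_derivative f (at x)) (at x)"
  using frechet_derivative_works by blast

text \<open>In the product and exponential rules undifferentiated factors survive; they must be
  downgraded to the class of the induction hypothesis.\<close>

lemma Ck_on_Suc_le: "Ck_on (Suc k) UNIV f \<Longrightarrow> Ck_on k UNIV f"
  by (induction k arbitrary: f)
     (auto intro!: continuous_at_imp_continuous_on differentiable_imp_continuous_within)

lemma Ck_on_add:
  "Ck_on k UNIV f \<Longrightarrow> Ck_on k UNIV g \<Longrightarrow> Ck_on k UNIV (\<lambda>x. f x + g x)"
proof (induction k arbitrary: f g)
  case 0
  then show ?case by (auto intro!: continuous_intros)
next
  case (Suc k)
  show ?case
    by (rule Ck_on_SucI[where f' = "\<lambda>x h. frechet_derivative f (at x) h + frechet_derivative g (at x) h"])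
       (use Suc in \<open>auto intro!: has_derivative_add has_derivative_frechet simp flip: partial_deriv_def\<close>)
qed

lemma Ck_on_mult:
  fixes f g :: "real^2 \<Rightarrow> real"
  shows "Ck_on k UNIV f \<Longrightarrow> Ck_on k UNIV g \<Longrightarrow> Ck_on k UNIV (\<lambda>x. f x * g x)"
proof (induction k arbitrary: f g)
  case 0
  then show ?case by (auto intro!: continuous_intros)
next
  case (Suc k)
  show ?case
  proof (rule Ck_on_SucI)
    show "((\<lambda>x. f x * g x) has_derivative
       (\<lambda>h. f x * frechet_derivative g (at x) h + frechet_derivative f (at x) h * g x)) (at x)" for x
      using Suc.prems by (intro has_derivative_mult has_derivative_frechet) auto
    fix i
    have "Ck_on k UNIV f" "Ck_on k UNIV g" using Suc.prems by (blast intro: Ck_on_Suc_le)+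
    then have "Ck_on k UNIV (\<lambda>x. f x * partial_deriv i g x + partial_deriv i f x * g x)"
      using Suc by (intro Ck_on_add Suc.IH) auto
    then show "Ck_on k UNIV (\<lambda>x. f x * frechet_derivative g (at x) (axis i 1)
        + frechet_derivative f (at x) (axis i 1) * g x)"
      by (simp add: partial_deriv_def)
  qed
qed

lemma Ck_on_const: "Ck_on k UNIV (\<lambda>_. c)"
  by (induction k arbitrary: c) (auto intro!: Ck_on_SucI[where f' = "\<lambda>_ _. 0"] simp del: Ck_on.simps(2))

lemma Ck_on_exp:
  fixes f :: "real^2 \<Rightarrow> real"
  shows "Ck_on k UNIV f \<Longrightarrow> Ck_on k UNIV (\<lambda>x. exp (f x))"
proof (induction k)
  case 0
  then show ?case by (auto intro!: continuous_intros)
next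
  case (Suc k)
  show ?case
  proof (rule Ck_on_SucI)
    show "((\<lambda>x. exp (f x)) has_derivative
       (\<lambda>h. frechet_derivative f (at x) h * exp (f x))) (at x)" for x
      using Suc.prems DERIV_compose_FDERIV[OF DERIV_exp has_derivative_frechet[of f x]] by auto
    fix i
    have "Ck_on k UNIV f" using Suc.prems by (blast intro: Ck_on_Suc_le)
    then have "Ck_on k UNIV (\<lambda>x. partial_deriv i f x * exp (f x))"
      using Suc by (intro Ck_on_mult) auto
    then show "Ck_on k UNIV (\<lambda>x. frechet_derivative f (at x) (axis i 1) * exp (f x))"
      by (simp add: partial_deriv_def)
  qed
qed

lemma Ck_on_coord:
  "smooth_upto k f \<Longrightarrow> Ck_on k UNIV (\<lambda>x. f (x $ i))"
proof (induction k arbitrary: f)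
  case 0
  then show ?case by (auto intro!: continuous_intros continuous_on_compose2[of UNIV f])
next
  case (Suc k)
  then obtain f' where f: "\<And>x. (f has_real_derivative f' x) (at x)" "smooth_upto k f'" by auto
  show ?case
  proof (rule Ck_on_SucI)
    show "((\<lambda>x. f (x $ i)) has_derivative (\<lambda>h. f' (x $ i) * h $ i)) (at x)" for x :: "real^2"
      using DERIV_compose_FDERIV[of f, OF f(1) bounded_linear_imp_has_derivative[OF bounded_linear_vec_nth[of i]], of x]
      by (simp add: mult.commute)
    fix l :: 2
    show "Ck_on k UNIV (\<lambda>x. f' (x $ i) * axis l 1 $ i)"
      by (intro Ck_on_mult Suc.IH f Ck_on_const)
  qed
qed

definition box_bump :: "real^2 \<Rightarrow> real^2 \<Rightarrow> real^2 \<Rightarrow> real" where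
  "box_bump a b x = (flat 0 (x $ 1 - a $ 1) * flat 0 (b $ 1 - x $ 1)) *
     (flat 0 (x $ 2 - a $ 2) * flat 0 (b $ 2 - x $ 2))"

lemma box_bump_nonneg: "box_bump a b x \<ge> 0"
  by (simp add: box_bump_def flat_nonneg)

lemma box_bump_eq_0_iff: "box_bump a b x = 0 \<longleftrightarrow> x \<notin> box a b"
  by (auto simp: box_bump_def flat_def mem_box_cart forall_2)

lemma Ck_on_box_bump: "Ck_on k UNIV (box_bump a b)"
proof -
  have *: "Ck_on k UNIV (\<lambda>x. flat 0 (x $ i - c))" "Ck_on k UNIV (\<lambda>x. flat 0 (c - x $ i))" for i c
    using Ck_on_coord[OF smooth_upto_affine[where m = 1 and c = "-c", OF smooth_upto_flat]]
      Ck_on_coord[OF smooth_upto_affine[where m = "-1" and c = c, OF smooth_upto_flat]] by simp_all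
  have "Ck_on k UNIV (\<lambda>x. box_bump a b x)"
    unfolding box_bump_def by (intro Ck_on_mult *)
  then show ?thesis by simp
qed

text \<open>As n grows, 1 - exp(-n b) increases to the indicator of the open box while staying
  smooth, bounded by 1 and supported in the closed box: a smooth approximation of indicators without
  convolution.\<close>

lemma test_function_box_bump:
  assumes "cbox a b \<subseteq> \<Omega>"
  shows "(\<lambda>x. 1 - exp (- real n * box_bump a b x)) \<in> test_functions \<Omega>"
proof -
  have "Ck_on k UNIV (\<lambda>x. 1 + (-1) * exp (- real n * box_bump a b x))" for k
    by (intro Ck_on_mult Ck_on_const Ck_on_exp Ck_on_box_bump Ck_on_add)
  moreover have "{x. 1 - exp (- real n * box_bump a b x) \<noteq> 0} \<subseteq> cbox a b"
    using box_bump_eq_0_iff[of a b] box_subset_cbox[of a b] by auto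
  then have "closure {x. 1 - exp (- real n * box_bump a b x) \<noteq> 0} \<subseteq> cbox a b"
    by (rule closure_minimal) auto
  moreover from this have "compact (closure {x. 1 - exp (- real n * box_bump a b x) \<noteq> 0})"
    by (meson bounded_cbox bounded_subset closed_closure compact_eq_bounded_closed)
  ultimately show ?thesis using assms by (auto simp: test_functions_def)
qed

section \<open>Uniqueness of weak gradients\<close>

lemma AE_lebesgue_onI:
  assumes "S \<in> sets lebesgue" "negligible {x\<in>S. \<not> P x}"
  shows "AE x in lebesgue_on S. P x"
proof -
  have "AE x in lebesgue. x \<in> S \<longrightarrow> P x"
    using assms(2) by (intro AE_I'[of "{x\<in>S. \<not> P x}"]) (auto simp: negligible_iff_null_sets)
  then show ?thesis using assms(1) by (subst AE_restrict_space_iff) auto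
qed

lemma integral_lebesgue_on_supported:
  fixes f :: "'a::euclidean_space \<Rightarrow> 'b::{banach, second_countable_topology}"
  assumes "S \<in> sets lebesgue" "T \<in> sets lebesgue" "S \<subseteq> T" "\<And>x. x \<in> T - S \<Longrightarrow> f x = 0"
  shows "integral\<^sup>L (lebesgue_on T) f = integral\<^sup>L (lebesgue_on S) f"
proof -
  have "(\<lambda>x. indicator T x *\<^sub>R f x) = (\<lambda>x. indicator S x *\<^sub>R f x)"
    using assms by (auto simp: indicator_def fun_eq_iff)
  then show ?thesis using assms(1,2) by (simp add: integral_restrict_space)
qed

text \<open>Dominated convergence along the approximated indicator; the faces of the box, where the
  limit is 0 instead of 1, form a null set.\<close>

lemma integral_cbox_zero_of_test:
  fixes h :: "real^2 \<Rightarrow> complex"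
  assumes \<Omega>: "open \<Omega>" and sub: "cbox a b \<subseteq> \<Omega>"
    and int: "integrable (lebesgue_on (cbox a b)) h"
    and zero: "\<And>\<phi>. \<phi> \<in> test_functions \<Omega> \<Longrightarrow> (\<integral>x. \<phi> x *\<^sub>R h x \<partial>lebesgue_on \<Omega>) = 0"
  shows "integral\<^sup>L (lebesgue_on (cbox a b)) h = 0"
proof -
  define \<phi> where "\<phi> n x = 1 - exp (- real n * box_bump a b x)" for n x
  have phi: "(\<lambda>x. \<phi> n x) \<in> test_functions \<Omega>" for n
    unfolding \<phi>_def by (rule test_function_box_bump[OF sub])
  have cont: "continuous_on UNIV (\<phi> n)" for n
    using phi[of n] by (auto simp: test_functions_def dest: spec[of _ 0])
  have bd: "\<bar>\<phi> n x\<bar> \<le> 1" for n x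
    using box_bump_nonneg[of a b x] by (auto simp: \<phi>_def)
  have meas: "\<phi> n \<in> borel_measurable (lebesgue_on (cbox a b))" for n
    by (meson cont continuous_imp_measurable_on_sets_lebesgue continuous_on_subset lmeasurable_cbox fmeasurableD subset_UNIV)
  have "(\<lambda>n. \<integral>x. \<phi> n x *\<^sub>R h x \<partial>lebesgue_on (cbox a b)) \<longlonglongrightarrow> integral\<^sup>L (lebesgue_on (cbox a b)) h"
  proof (rule integral_dominated_convergence[where w = "\<lambda>x. norm (h x)"])
    show "integrable (lebesgue_on (cbox a b)) (\<lambda>x. norm (h x))" using int by auto
    show "(\<lambda>x. \<phi> n x *\<^sub>R h x) \<in> borel_measurable (lebesgue_on (cbox a b))" for n
      using int meas by (auto intro!: borel_measurable_scaleR)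
    show "AE x in lebesgue_on (cbox a b). norm (\<phi> n x *\<^sub>R h x) \<le> norm (h x)" for n
      using bd by (auto intro!: mult_left_le_one_le)
    have "negligible (cbox a b - box a b)" by (simp add: negligible_frontier_interval)
    then have "AE x in lebesgue_on (cbox a b). x \<in> box a b"
      by (intro AE_lebesgue_onI) (auto simp: set_diff_eq)
    then show "AE x in lebesgue_on (cbox a b). (\<lambda>n. \<phi> n x *\<^sub>R h x) \<longlonglongrightarrow> h x"
    proof (rule AE_mp, intro AE_I2 impI)
      fix x assume "x \<in> box a b"
      then have "box_bump a b x > 0" using box_bump_eq_0_iff[of a b x] box_bump_nonneg[of a b x] by auto
      then have "(\<lambda>n. exp (- real n * box_bump a b x)) \<longlonglongrightarrow> 0"
        by real_asymp
      then have "(\<lambda>n. \<phi> n x *\<^sub>R h x) \<longlonglongrightarrow> (1 - 0) *\<^sub>R h x"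
        unfolding \<phi>_def by (intro tendsto_intros)
      then show "(\<lambda>n. \<phi> n x *\<^sub>R h x) \<longlonglongrightarrow> h x" by simp
    qed
  qed (use int in auto)
  moreover have "(\<integral>x. \<phi> n x *\<^sub>R h x \<partial>lebesgue_on (cbox a b)) = 0" for n
  proof -
    have "(\<integral>x. \<phi> n x *\<^sub>R h x \<partial>lebesgue_on \<Omega>) = (\<integral>x. \<phi> n x *\<^sub>R h x \<partial>lebesgue_on (cbox a b))"
      using sub \<Omega> box_bump_eq_0_iff[of a b] box_subset_cbox[of a b]
      by (intro integral_lebesgue_on_supported) (auto simp: \<phi>_def)
    then show ?thesis using zero[OF phi[of n]] by simp
  qed
  ultimately show ?thesis by (simp add: LIMSEQ_const_iff)
qed

text \<open>Integrals over all boxes inside \<open>\<Omega>\<close> vanish, so Lebesgue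
  differentiation over shrinking cubes forces \<open>h\<close> to vanish almost everywhere.\<close>

theorem fundamental_lemma:
  fixes h :: "real^2 \<Rightarrow> complex"
  assumes \<Omega>: "open \<Omega>"
    and int: "\<And>a b. cbox a b \<subseteq> \<Omega> \<Longrightarrow> integrable (lebesgue_on (cbox a b)) h"
    and zero: "\<And>\<phi>. \<phi> \<in> test_functions \<Omega> \<Longrightarrow> (\<integral>x. \<phi> x *\<^sub>R h x \<partial>lebesgue_on \<Omega>) = 0"
  shows "AE x in lebesgue_on \<Omega>. h x = 0"
proof -
  have loc: "negligible {x\<in>box a b. h x \<noteq> 0}" if ab: "cbox a b \<subseteq> \<Omega>" for a b
  proof -
    \<comment> \<open>Extension by zero makes the integrand integrable on every cube, as the
      differentiation theorem demands, without changing it near points of the open box.\<close>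
    define f where "f x = (if x \<in> cbox a b then h x else 0)" for x
    have "f integrable_on UNIV"
      using int[OF ab] unfolding f_def
      by (simp add: integrable_on_lebesgue_on integrable_restrict_UNIV)
    then have "f integrable_on cbox c d" for c d
      using integrable_on_subcbox by blast
    from integrable_ccontinuous_explicit[OF this] obtain N where N: "negligible N"
      "\<And>x e. \<lbrakk>x \<notin> N; 0 < e\<rbrakk> \<Longrightarrow>
          \<exists>d>0. \<forall>h. 0 < h \<and> h < d \<longrightarrow>
            norm (integral (cbox x (x + h *\<^sub>R One)) f /\<^sub>R h ^ DIM(real^2) - f x) < e"
      by metis
    have "f x = 0" if xab: "x \<in> box a b" and xN: "x \<notin> N" for x
    proof (rule ccontr)
      assume "f x \<noteq> 0"
      then obtain d where d: "d > 0" "\<And>h. 0 < h \<Longrightarrow> h < d \<Longrightarrow>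
            norm (integral (cbox x (x + h *\<^sub>R One)) f /\<^sub>R h ^ DIM(real^2) - f x) < norm (f x)"
        using N(2)[OF xN, of "norm (f x)"] by auto
      obtain r where r: "r > 0" "ball x r \<subseteq> box a b"
        using xab open_box open_contains_ball_eq by blast
      have nO: "norm (One :: real^2) > 0" by (simp add: One_non_0)
      \<comment> \<open>Half of \<open>d\<close> stays inside the range of the differentiation
        estimate; the second bound keeps the cube with lower corner \<open>x\<close> inside the
        box.\<close>
      define t where "t = min (d/2) (r / (2 * norm (One::real^2)))"
      have t: "t > 0" "t < d" "t * norm (One::real^2) < r"
        using d r nO by (auto simp: t_def min_def divide_simps split: if_splits)
      have sub: "cbox x (x + t *\<^sub>R One) \<subseteq> cbox a b"
      proof -
        have "x + t *\<^sub>R One \<in> ball x r" "x \<in> ball x r"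
          using t r by (auto simp: dist_norm)
        then have "x + t *\<^sub>R One \<in> cbox a b" "x \<in> cbox a b"
          using r box_subset_cbox by blast+
        then show ?thesis by (metis subset_box_imp(1) mem_box(2))
      qed
      have int2: "integrable (lebesgue_on (cbox x (x + t *\<^sub>R One))) h"
        using int sub ab by blast
      have "integral (cbox x (x + t *\<^sub>R One)) f = integral (cbox x (x + t *\<^sub>R One)) h"
        using sub by (intro integral_cong) (auto simp: f_def)
      also have "\<dots> = integral\<^sup>L (lebesgue_on (cbox x (x + t *\<^sub>R One))) h"
        using lebesgue_integral_eq_integral[OF int2] by simp
      also have "\<dots> = 0"
        using sub ab by (intro integral_cbox_zero_of_test[OF \<Omega> _ int2 zero]) auto
      finally show False using d(2)[OF t(1,2)] by simp
    qed
    then have "{x\<in>box a b. h x \<noteq> 0} \<subseteq> N" by (auto simp: f_def box_subset_cbox subsetD[OF box_subset_cbox])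
    then show ?thesis using N(1) negligible_subset by blast
  qed
  \<comment> \<open>An open set is a countable union of such boxes, so the local null sets add up to
    a null set.\<close>
  define F where "F = {box a b |a b. cbox a b \<subseteq> \<Omega>}"
  have "\<Union>F = \<Omega>"
  proof
    show "\<Union>F \<subseteq> \<Omega>" using box_subset_cbox by (fastforce simp: F_def)
    show "\<Omega> \<subseteq> \<Union>F"
    proof
      fix x assume "x \<in> \<Omega>"
      then obtain a b where "cbox a b \<subseteq> \<Omega>" "x \<in> box a b"
        using open_contains_cbox[OF \<Omega>] by metis
      then show "x \<in> \<Union>F" by (auto simp: F_def)
    qed
  qed
  moreover have "\<And>S. S \<in> F \<Longrightarrow> open S" by (auto simp: F_def)
  ultimately obtain D where D: "D \<subseteq> F" "countable D" "\<Union>D = \<Omega>"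
    using Lindelof by metis
  have "{x\<in>\<Omega>. h x \<noteq> 0} = (\<Union>X\<in>D. {x\<in>X. h x \<noteq> 0})" using D(3) by auto
  moreover have "negligible \<dots>"
    using D loc by (intro negligible_countable_Union) (auto simp: F_def)
  ultimately have "negligible {x\<in>\<Omega>. h x \<noteq> 0}" by simp
  then show ?thesis using \<Omega> by (intro AE_lebesgue_onI) auto
qed

section \<open>Integration by parts\<close>

lemma integrable_lborel_compact_support:
  fixes f :: "'a::euclidean_space \<Rightarrow> 'b::euclidean_space"
  assumes "compact K" "continuous_on UNIV f" "\<And>x. x \<notin> K \<Longrightarrow> f x = 0"
  shows "integrable lborel f"
proof -
  have "integrable lborel (\<lambda>x. indicator K x *\<^sub>R f x)"
    by (rule borel_integrable_compact[OF assms(1) continuous_on_subset[OF assms(2)]]) simp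
  also have "(\<lambda>x. indicator K x *\<^sub>R f x) = f"
    using assms(3) by (auto simp: fun_eq_iff indicator_def)
  finally show ?thesis .
qed

lemma integral_lborel_translate:
  fixes f :: "'a::euclidean_space \<Rightarrow> 'b::euclidean_space"
  assumes "f \<in> borel_measurable borel"
  shows "(\<integral>x. f (c + x) \<partial>lborel) = integral\<^sup>L lborel f"
  using integral_distr[of "(+) c" lborel borel f] assms by (simp add: lborel_distr_plus)

lemma bounded_compact_support:
  fixes f :: "'a::euclidean_space \<Rightarrow> 'b::real_normed_vector"
  assumes "compact K" "continuous_on UNIV f" "\<And>x. x \<notin> K \<Longrightarrow> f x = 0"
  obtains M where "M > 0" "\<And>x. norm (f x) \<le> M"
proof -
  have "bounded (f ` K)"
    using assms by (intro compact_imp_bounded compact_continuous_image) (auto intro: continuous_on_subset)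
  then obtain M where "M > 0" "\<And>x. x \<in> K \<Longrightarrow> norm (f x) \<le> M" by (auto simp: bounded_pos)
  then have "norm (f x) \<le> M" for x using assms(3)[of x] by (cases "x \<in> K") auto
  then show ?thesis using \<open>M > 0\<close> that by blast
qed

lemma partial_deriv_zero_outside:
  fixes F :: "real^2 \<Rightarrow> 'b::real_normed_vector"
  assumes "closed K" "\<And>x. x \<notin> K \<Longrightarrow> F x = 0" "x \<notin> K"
  shows "(F has_derivative (\<lambda>_. 0)) (at x)" "partial_deriv i F x = 0"
proof -
  show *: "(F has_derivative (\<lambda>_. 0)) (at x)"
    by (rule has_derivative_transform_within_open[of "\<lambda>_. 0" _ _ _ "- K"]) (use assms in auto)
  show "partial_deriv i F x = 0" using partial_deriv_eq[OF *] by simp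
qed

text \<open>Difference quotients have integral 0 by translation invariance of Lebesgue measure, and
  dominated convergence transfers this to the partial derivative; no iterated integral is
  involved.\<close>

lemma integral_partial_deriv_zero:
  fixes F :: "real^2 \<Rightarrow> complex"
  assumes K: "compact K" and F0: "\<And>x. x \<notin> K \<Longrightarrow> F x = 0"
    and dF: "\<And>x. F differentiable (at x)" and cF: "continuous_on UNIV (partial_deriv i F)"
  shows "(\<integral>x. partial_deriv i F x \<partial>lborel) = 0"
proof -
  define e :: "real^2" where "e = axis i 1"
  have ne: "norm e = 1" by (simp add: e_def)
  have contF: "continuous_on UNIV F"
    using dF by (auto intro!: continuous_at_imp_continuous_on differentiable_imp_continuous_within)
  have mF[measurable]: "F \<in> borel_measurable borel"
    using contF borel_measurable_continuous_onI by blast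
  have intF: "integrable lborel F" by (rule integrable_lborel_compact_support[OF K contF F0])
  have P0: "partial_deriv i F x = 0" if "x \<notin> K" for x
    by (rule partial_deriv_zero_outside(2)[OF compact_imp_closed[OF K]]) (use F0 that in auto)
  have line: "((\<lambda>t. F (x + t *\<^sub>R e)) has_vector_derivative partial_deriv i F (x + t *\<^sub>R e)) (at t within S)" for x t S
  proof -
    have "((\<lambda>t. x + t *\<^sub>R e) has_vector_derivative e) (at t within S)"
      by (auto intro!: derivative_eq_intros)
    moreover have "(F has_derivative frechet_derivative F (at (x + t *\<^sub>R e)))
        (at (x + t *\<^sub>R e) within (\<lambda>t. x + t *\<^sub>R e) ` S)"
      using has_derivative_frechet[OF dF] has_derivative_at_withinI by blast
    ultimately show ?thesis
      using vector_derivative_diff_chain_within[of "\<lambda>t. x + t *\<^sub>R e" e t S F]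
      by (simp add: o_def partial_deriv_def e_def)
  qed
  obtain M where M: "M > 0" "\<And>x. norm (partial_deriv i F x) \<le> M"
    using bounded_compact_support[OF K cF P0] by blast
  obtain R where R: "\<And>x. x \<in> K \<Longrightarrow> norm x \<le> R" using compact_imp_bounded[OF K] by (auto simp: bounded_iff)
  \<comment> \<open>Forward difference quotient in direction \<open>e\<close> with step 1/(n+1); a
    step of at most 1 keeps all supports in one ball.\<close>
  define D where "D n x = real (Suc n) *\<^sub>R (F ((1 / Suc n) *\<^sub>R e + x) - F x)" for n x
  have "(\<lambda>n. \<integral>x. D n x \<partial>lborel) \<longlonglongrightarrow> (\<integral>x. partial_deriv i F x \<partial>lborel)"
  proof (rule integral_dominated_convergence[where w = "\<lambda>x. indicator (cball 0 (R + 1)) x *\<^sub>R (3 * M)"])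
    show "integrable lborel (\<lambda>x::real^2. indicator (cball 0 (R + 1)) x *\<^sub>R (3 * M))"
      by (rule borel_integrable_compact) auto
    show "partial_deriv i F \<in> borel_measurable lborel"
      using cF borel_measurable_continuous_onI by auto
    show "D n \<in> borel_measurable lborel" for n unfolding D_def by measurable
    show "AE x in lborel. (\<lambda>n. D n x) \<longlonglongrightarrow> partial_deriv i F x"
    proof (rule AE_I2)
      fix x
      have "((\<lambda>t. F (x + t *\<^sub>R e)) has_vector_derivative partial_deriv i F x) (at 0)"
        using line[of x 0 UNIV] by simp
      then have "((\<lambda>t. norm (F (x + t *\<^sub>R e) - F x - t *\<^sub>R partial_deriv i F x) / norm t) \<longlongrightarrow> 0) (at 0)"
        by (simp add: has_vector_derivative_def has_derivative_at)
      moreover have "\<forall>\<^sub>F t in at 0. norm (F (x + t *\<^sub>R e) - F x - t *\<^sub>R partial_deriv i F x) / norm t =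
          norm ((F (x + t *\<^sub>R e) - F x) /\<^sub>R t - partial_deriv i F x)"
        unfolding eventually_at_filter
      proof (intro always_eventually allI impI)
        fix t :: real assume t: "t \<noteq> 0"
        have "(F (x + t *\<^sub>R e) - F x) /\<^sub>R t - partial_deriv i F x =
            (F (x + t *\<^sub>R e) - F x - t *\<^sub>R partial_deriv i F x) /\<^sub>R t"
          using t by (simp add: scaleR_diff_right)
        then show "norm (F (x + t *\<^sub>R e) - F x - t *\<^sub>R partial_deriv i F x) / norm t =
          norm ((F (x + t *\<^sub>R e) - F x) /\<^sub>R t - partial_deriv i F x)"
          by (simp add: divide_inverse mult.commute)
      qed
      ultimately have "((\<lambda>t. norm ((F (x + t *\<^sub>R e) - F x) /\<^sub>R t - partial_deriv i F x)) \<longlongrightarrow> 0) (at 0)"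
        by (rule Lim_transform_eventually)
      then have "((\<lambda>t. (F (x + t *\<^sub>R e) - F x) /\<^sub>R t) \<longlongrightarrow> partial_deriv i F x) (at 0)"
        by (rule iffD2[OF Lim_null, OF tendsto_norm_zero_cancel])
      then have "(\<lambda>n. (F (x + (1 / Suc n) *\<^sub>R e) - F x) /\<^sub>R (1 / Suc n)) \<longlonglongrightarrow> partial_deriv i F x"
      proof (rule filterlim_compose)
        show "filterlim (\<lambda>n. 1 / real (Suc n)) (at 0) sequentially" by real_asymp
      qed
      then show "(\<lambda>n. D n x) \<longlonglongrightarrow> partial_deriv i F x"
        by (simp add: D_def add.commute)
    qed
    show "AE x in lborel. norm (D n x) \<le> indicator (cball 0 (R + 1)) x *\<^sub>R (3 * M)" for n
    proof (rule AE_I2)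
      fix x
      let ?f' = "\<lambda>t. partial_deriv i F (x + t *\<^sub>R e)"
      \<comment> \<open>Along the line the derivative deviates from its value at \<open>x\<close> by
        at most 2 M, so the mean value estimate bounds the quotient by 3 M.\<close>
      have "norm (?f' t - ?f' 0) \<le> 2 * M" for t
        using norm_triangle_ineq4[of "?f' t" "?f' 0"] M(2)[of "x + t *\<^sub>R e"] M(2)[of "x + 0 *\<^sub>R e"] by linarith
      then have "norm (F (x + (1 / Suc n) *\<^sub>R e) - F (x + 0 *\<^sub>R e) - (1 / real (Suc n) - 0) *\<^sub>R ?f' 0)
          \<le> norm (1 / real (Suc n) - 0) * (2 * M)"
        by (intro vector_differentiable_bound_linearization[of UNIV _ ?f']) (use line in auto)
      moreover obtain v where v: "v = F (x + (1 / Suc n) *\<^sub>R e) - F (x + 0 *\<^sub>R e) - (1 / real (Suc n) - 0) *\<^sub>R ?f' 0"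
        by blast
      ultimately have "norm v \<le> norm (1 / real (Suc n) - 0) * (2 * M)" by simp
      then have "real (Suc n) * norm v \<le> 2 * M"
        by (simp add: field_simps)
      moreover have "D n x - ?f' 0 = real (Suc n) *\<^sub>R v"
        by (simp add: D_def v add.commute[of x] scaleR_diff_right del: of_nat_Suc)
      ultimately have "norm (D n x - ?f' 0) \<le> 2 * M" by simp
      then have 1: "norm (D n x) \<le> 3 * M"
        using norm_triangle_sub[of "D n x" "?f' 0"] M(2)[of "x + 0 *\<^sub>R e"] by linarith
      have "D n x = 0" if "x \<notin> cball 0 (R + 1)"
      proof -
        have "norm x > R + 1" using that by simp
        moreover have "norm ((1 / real (Suc n)) *\<^sub>R e) \<le> 1" using ne by simp
        ultimately have "norm ((1 / real (Suc n)) *\<^sub>R e + x) > R" "norm x > R"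
          using norm_diff_ineq[of x "(1 / real (Suc n)) *\<^sub>R e"] unfolding add.commute[of x] by linarith+
        then have "F ((1 / real (Suc n)) *\<^sub>R e + x) = 0" "F x = 0" using F0 R by (meson not_less)+
        then show ?thesis by (simp add: D_def)
      qed
      then show "norm (D n x) \<le> indicator (cball 0 (R + 1)) x *\<^sub>R (3 * M)"
        using 1 by (auto simp: indicator_def)
    qed
  qed
  moreover have "(\<integral>x. D n x \<partial>lborel) = 0" for n
  proof -
    have "integrable lborel (\<lambda>x. F ((1 / real (Suc n)) *\<^sub>R e + x))"
      using intF integrable_distr[of "(+) ((1 / real (Suc n)) *\<^sub>R e)" lborel borel F]
      by (simp add: lborel_distr_plus)
    then show ?thesis unfolding D_def using intF integral_lborel_translate[OF mF]
      by simp
  qed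
  ultimately show ?thesis by (simp add: LIMSEQ_const_iff)
qed

lemma Ck_on_1: "Ck_on 1 \<Omega> f \<longleftrightarrow>
  (\<forall>x\<in>\<Omega>. f differentiable (at x)) \<and> (\<forall>i. continuous_on \<Omega> (partial_deriv i f))"
  by simp

lemma Ck_on_1_continuous: "Ck_on 1 \<Omega> f \<Longrightarrow> continuous_on \<Omega> f"
  unfolding Ck_on_1
  by (intro continuous_at_imp_continuous_on) (auto intro: differentiable_imp_continuous_within)

lemma test_functionsD:
  assumes "\<phi> \<in> test_functions \<Omega>"
  obtains K where "compact K" "K \<subseteq> \<Omega>" "\<And>x. x \<notin> K \<Longrightarrow> \<phi> x = 0" "\<And>x i. x \<notin> K \<Longrightarrow> partial_deriv i \<phi> x = 0"
    "continuous_on UNIV \<phi>" "\<And>i. continuous_on UNIV (partial_deriv i \<phi>)" "\<And>x. \<phi> differentiable (at x)"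
proof
  let ?K = "closure {x. \<phi> x \<noteq> 0}"
  have C1: "Ck_on 1 UNIV \<phi>" using assms by (auto simp only: test_functions_def mem_Collect_eq)
  show "compact ?K" "?K \<subseteq> \<Omega>" using assms by (auto simp: test_functions_def)
  show *: "\<phi> x = 0" if "x \<notin> ?K" for x using that closure_subset[of "{x. \<phi> x \<noteq> 0}"] by auto
  show "partial_deriv i \<phi> x = 0" if "x \<notin> ?K" for x i
    by (rule partial_deriv_zero_outside(2)[OF closed_closure * that])
  show "continuous_on UNIV \<phi>" using Ck_on_1_continuous[OF C1] .
  show "continuous_on UNIV (partial_deriv i \<phi>)" "\<phi> differentiable (at x)" for i x
    using C1 unfolding Ck_on_1 by auto
qed

text \<open>Glues \<open>f\<close> on \<open>\<Omega>\<close> with the zero function on the open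
  complement of \<open>K\<close>; the two open sets cover the space.\<close>

lemma continuous_on_UNIV_supported:
  fixes f :: "'a::t2_space \<Rightarrow> 'b::real_normed_vector"
  assumes "open \<Omega>" "compact K" "K \<subseteq> \<Omega>" "continuous_on \<Omega> f" "\<And>x. x \<notin> K \<Longrightarrow> f x = 0"
  shows "continuous_on UNIV f"
proof -
  have "continuous_on (- K) f"
    by (rule continuous_on_eq[of _ "\<lambda>_. 0"]) (use assms in auto)
  then have "continuous_on (\<Omega> \<union> - K) f"
    using assms by (intro continuous_on_open_Un) (auto simp: compact_imp_closed open_Compl)
  moreover have "\<Omega> \<union> - K = UNIV" using assms(3) by auto
  ultimately show ?thesis by simp
qed

definition grad :: "(real^2 \<Rightarrow> complex) \<Rightarrow> real^2 \<Rightarrow> complex^2" where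
  "grad U x = (\<chi> i. partial_deriv i U x)"

text \<open>\<open>U\<close> is controlled only on \<open>\<Omega>\<close>, but its product with a
  test function extends by zero to a C^1 function on the plane; integrating the product rule gives
  the identity.\<close>

theorem is_weak_gradient_grad:
  assumes \<Omega>: "open \<Omega>" and U: "Ck_on 1 \<Omega> U"
  shows "is_weak_gradient \<Omega> U (grad U)"
  unfolding is_weak_gradient_def
proof (intro ballI allI)
  fix \<phi> i assume "\<phi> \<in> test_functions \<Omega>"
  then obtain K where K: "compact K" "K \<subseteq> \<Omega>" "\<And>x. x \<notin> K \<Longrightarrow> \<phi> x = 0" "\<And>x i. x \<notin> K \<Longrightarrow> partial_deriv i \<phi> x = 0"
    "continuous_on UNIV \<phi>" "\<And>i. continuous_on UNIV (partial_deriv i \<phi>)" "\<And>x. \<phi> differentiable (at x)"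
    by (elim test_functionsD) (rule that)
  have Uc: "continuous_on \<Omega> U" "continuous_on \<Omega> (partial_deriv i U)"
     and Ud: "\<And>x. x \<in> \<Omega> \<Longrightarrow> U differentiable (at x)"
    using U Ck_on_1_continuous unfolding Ck_on_1 by auto
  define A B where "A x = partial_deriv i \<phi> x *\<^sub>R U x" and "B x = \<phi> x *\<^sub>R partial_deriv i U x" for x
  have A: "continuous_on UNIV A"
    by (rule continuous_on_UNIV_supported[OF \<Omega> K(1,2)])
       (auto simp: A_def K(4) intro!: continuous_intros Uc continuous_on_subset[OF K(6)])
  have B: "continuous_on UNIV B"
    by (rule continuous_on_UNIV_supported[OF \<Omega> K(1,2)])
       (auto simp: B_def K(3) intro!: continuous_intros Uc continuous_on_subset[OF K(5)])
  have A0: "A x = 0" "B x = 0" if "x \<notin> K" for x using K that by (auto simp: A_def B_def)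
  have der: "(\<lambda>x. \<phi> x *\<^sub>R U x) differentiable (at x)" "partial_deriv i (\<lambda>x. \<phi> x *\<^sub>R U x) x = A x + B x" for x
  proof -
    \<comment> \<open>Every point lies in \<open>\<Omega>\<close>, where the product rule holds, or
      off \<open>K\<close>, where the product vanishes nearby.\<close>
    consider "x \<in> \<Omega>" | "x \<notin> K" using K(2) by blast
    then have "(\<lambda>x. \<phi> x *\<^sub>R U x) differentiable (at x) \<and> partial_deriv i (\<lambda>x. \<phi> x *\<^sub>R U x) x = A x + B x"
    proof cases
      case 1
      have d: "((\<lambda>x. \<phi> x *\<^sub>R U x) has_derivative
          (\<lambda>h. \<phi> x *\<^sub>R frechet_derivative U (at x) h + frechet_derivative \<phi> (at x) h *\<^sub>R U x)) (at x)"
        by (intro has_derivative_scaleR has_derivative_frechet K Ud 1)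
      show ?thesis using partial_deriv_eq[OF d, of i] d
        by (auto simp: A_def B_def partial_deriv_def differentiable_def)
    next
      case 2
      have d: "((\<lambda>x. \<phi> x *\<^sub>R U x) has_derivative (\<lambda>_. 0)) (at x)"
        by (rule partial_deriv_zero_outside(1)[of K]) (use K 2 compact_imp_closed in auto)
      show ?thesis using partial_deriv_eq[OF d, of i] d A0[OF 2] by (auto simp: differentiable_def)
    qed
    then show "(\<lambda>x. \<phi> x *\<^sub>R U x) differentiable (at x)" "partial_deriv i (\<lambda>x. \<phi> x *\<^sub>R U x) x = A x + B x" by auto
  qed
  have "(\<integral>x. partial_deriv i (\<lambda>x. \<phi> x *\<^sub>R U x) x \<partial>lborel) = 0"
  proof (rule integral_partial_deriv_zero[OF K(1)])
    show "continuous_on UNIV (partial_deriv i (\<lambda>x. \<phi> x *\<^sub>R U x))"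
      using continuous_on_add[OF A B] by (simp add: der(2) cong: continuous_on_cong)
  qed (use K der in auto)
  then have "(\<integral>x. A x + B x \<partial>lborel) = 0" by (simp add: der)
  moreover have int: "integrable lborel A" "integrable lborel B"
    using integrable_lborel_compact_support[OF K(1)] A B A0 by blast+
  ultimately have "integral\<^sup>L lborel A = - integral\<^sup>L lborel B" by (simp add: eq_neg_iff_add_eq_0)
  moreover have "integral\<^sup>L lborel f = integral\<^sup>L (lebesgue_on \<Omega>) f"
    if "integrable lborel f" "\<And>x. x \<notin> K \<Longrightarrow> f x = 0" for f :: "real^2 \<Rightarrow> complex"
  proof -
    have "integral\<^sup>L (lebesgue_on UNIV) f = integral\<^sup>L (lebesgue_on \<Omega>) f"
      using \<Omega> that K(2) by (intro integral_lebesgue_on_supported) auto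
    then show ?thesis using that(1) by (simp add: lebesgue_on_UNIV_eq integral_completion)
  qed
  ultimately have "integral\<^sup>L (lebesgue_on \<Omega>) A = - integral\<^sup>L (lebesgue_on \<Omega>) B"
    using int A0 by metis
  then show "(\<integral>x. partial_deriv i \<phi> x *\<^sub>R U x \<partial>lebesgue_on \<Omega>) = - (\<integral>x. \<phi> x *\<^sub>R grad U x $ i \<partial>lebesgue_on \<Omega>)"
    by (simp add: A_def[abs_def] B_def[abs_def] grad_def)
qed

section \<open>Square integrable functions\<close>

text \<open>Weak gradients are square integrable, classical gradients a priori only continuous on
  \<open>\<Omega>\<close>. Local integrability covers both and suffices for pairing with test
  functions.\<close>

definition loc_integrable :: "(real^2) set \<Rightarrow> (real^2 \<Rightarrow> complex) \<Rightarrow> bool" where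
  "loc_integrable \<Omega> f \<longleftrightarrow> (\<forall>K. compact K \<and> K \<subseteq> \<Omega> \<longrightarrow> integrable (lebesgue_on K) f)"

lemma compact_sets_lebesgue: "compact K \<Longrightarrow> K \<in> sets lebesgue"
  by (simp add: lmeasurable_compact fmeasurableD)

lemma integrable_lebesgue_on_mono:
  fixes f :: "'a::euclidean_space \<Rightarrow> 'b::{banach, second_countable_topology}"
  assumes "integrable (lebesgue_on T) f" "S \<in> sets lebesgue" "T \<in> sets lebesgue" "S \<subseteq> T"
  shows "integrable (lebesgue_on S) f"
proof -
  have "integrable lebesgue (\<lambda>x. indicator T x *\<^sub>R f x)"
    using assms by (simp add: integrable_restrict_space)
  from integrable_mult_indicator[OF assms(2) this]
  have "integrable lebesgue (\<lambda>x. indicator S x *\<^sub>R indicator T x *\<^sub>R f x)" by simp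
  also have "(\<lambda>x. indicator S x *\<^sub>R indicator T x *\<^sub>R f x) = (\<lambda>x. indicator S x *\<^sub>R f x)"
    using assms(4) by (auto simp: fun_eq_iff indicator_def)
  finally show ?thesis using assms(2) by (simp add: integrable_restrict_space)
qed

lemma loc_integrable_continuous:
  assumes "continuous_on \<Omega> f"
  shows "loc_integrable \<Omega> f"
  unfolding loc_integrable_def
proof (intro allI impI)
  fix K assume K: "compact K \<and> K \<subseteq> \<Omega>"
  then have "integrable lborel (\<lambda>x. indicator K x *\<^sub>R f x)"
    using borel_integrable_compact[OF _ continuous_on_subset[OF assms]] by blast
  then have "integrable lebesgue (\<lambda>x. indicator K x *\<^sub>R f x)"
    by (subst integrable_completion) auto
  then show "integrable (lebesgue_on K) f"
    using K by (simp add: integrable_restrict_space compact_sets_lebesgue)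
qed

lemma L2_on_component:
  fixes g :: "real^2 \<Rightarrow> complex^2"
  assumes "L2_on \<Omega> g"
  shows "L2_on \<Omega> (\<lambda>x. g x $ i)"
proof -
  have m: "(\<lambda>x. g x $ i) \<in> borel_measurable (lebesgue_on \<Omega>)"
    using assms unfolding L2_on_def
    by (auto intro!: borel_measurable_continuous_on[of "\<lambda>v. v $ i"] continuous_intros)
  have "integrable (lebesgue_on \<Omega>) (\<lambda>x. (cmod (g x $ i))\<^sup>2)"
  proof (rule Bochner_Integration.integrable_bound)
    show "integrable (lebesgue_on \<Omega>) (\<lambda>x. (norm (g x))\<^sup>2)" using assms by (simp add: L2_on_def)
    show "(\<lambda>x. (cmod (g x $ i))\<^sup>2) \<in> borel_measurable (lebesgue_on \<Omega>)" using m by measurable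
    show "AE x in lebesgue_on \<Omega>. norm ((cmod (g x $ i))\<^sup>2) \<le> norm ((norm (g x))\<^sup>2)"
      by (rule AE_I2) (simp add: power_mono Finite_Cartesian_Product.norm_nth_le)
  qed
  then show ?thesis using m by (simp add: L2_on_def)
qed

lemma L2_on_diff:
  fixes f g :: "'a::euclidean_space \<Rightarrow> 'b::euclidean_space"
  assumes "L2_on \<Omega> f" "L2_on \<Omega> g"
  shows "L2_on \<Omega> (\<lambda>x. f x - g x)"
proof -
  have m: "(\<lambda>x. f x - g x) \<in> borel_measurable (lebesgue_on \<Omega>)" using assms unfolding L2_on_def by auto
  have "(norm (f x - g x))\<^sup>2 \<le> 2 * (norm (f x))\<^sup>2 + 2 * (norm (g x))\<^sup>2" for x
  proof -
    have "(norm (f x - g x))\<^sup>2 \<le> (norm (f x) + norm (g x))\<^sup>2"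
      by (intro power_mono norm_triangle_ineq4) auto
    then show ?thesis using sum_squares_bound[of "norm (f x)" "norm (g x)"]
      by (simp add: power2_sum)
  qed
  note le = this
  have "integrable (lebesgue_on \<Omega>) (\<lambda>x. (norm (f x - g x))\<^sup>2)"
  proof (rule Bochner_Integration.integrable_bound)
    show "integrable (lebesgue_on \<Omega>) (\<lambda>x. 2 * (norm (f x))\<^sup>2 + 2 * (norm (g x))\<^sup>2)"
      using assms unfolding L2_on_def by simp
    show "(\<lambda>x. (norm (f x - g x))\<^sup>2) \<in> borel_measurable (lebesgue_on \<Omega>)" using m by measurable
    show "AE x in lebesgue_on \<Omega>. norm ((norm (f x - g x))\<^sup>2) \<le>
        norm (2 * (norm (f x))\<^sup>2 + 2 * (norm (g x))\<^sup>2)"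
      by (rule AE_I2) (simp add: le)
  qed
  then show ?thesis using m by (simp add: L2_on_def)
qed

text \<open>A compact set has finite measure, and \<bar>f\<bar> is at most \<bar>f\<bar>^2 +
  1.\<close>

lemma L2_on_loc_integrable:
  assumes "open \<Omega>" "L2_on \<Omega> f"
  shows "loc_integrable \<Omega> f"
  unfolding loc_integrable_def
proof (intro allI impI)
  fix K assume K: "compact K \<and> K \<subseteq> \<Omega>"
  have Ks: "K \<in> lmeasurable" using K lmeasurable_compact by blast
  have m: "f \<in> borel_measurable (lebesgue_on K)"
    using assms K Ks unfolding L2_on_def by (metis measurable_restrict_mono)
  have "integrable (lebesgue_on K) (\<lambda>x. (norm (f x))\<^sup>2)"
  proof (rule integrable_lebesgue_on_mono)
    show "integrable (lebesgue_on \<Omega>) (\<lambda>x. (norm (f x))\<^sup>2)" using assms(2) by (simp add: L2_on_def)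
    show "\<Omega> \<in> sets lebesgue" using assms(1) by simp
  qed (use K compact_sets_lebesgue in blast)+
  moreover have "integrable (lebesgue_on K) (\<lambda>x. 1 :: real)"
    using finite_measure.integrable_const[OF finite_measure_lebesgue_on[OF Ks]] .
  ultimately have "integrable (lebesgue_on K) (\<lambda>x. (norm (f x))\<^sup>2 + 1)" by auto
  moreover have "norm (f x) \<le> norm ((norm (f x))\<^sup>2 + 1)" for x
    using sum_squares_bound[of "norm (f x)" 1] norm_ge_zero[of "f x"] by (simp del: norm_ge_zero)
  ultimately show "integrable (lebesgue_on K) f"
    using m by (elim Bochner_Integration.integrable_bound) (auto intro!: AE_I2)
qed

lemma integrable_test_mult:
  fixes \<phi> :: "real^2 \<Rightarrow> real"
  assumes "open \<Omega>" "compact K" "K \<subseteq> \<Omega>" "continuous_on UNIV \<phi>" "\<And>x. x \<notin> K \<Longrightarrow> \<phi> x = 0"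
    and f: "loc_integrable \<Omega> f"
  shows "integrable (lebesgue_on \<Omega>) (\<lambda>x. \<phi> x *\<^sub>R f x)"
proof -
  have Ks: "K \<in> sets lebesgue" using assms(2) by (rule compact_sets_lebesgue)
  obtain M where M: "M > 0" "\<And>x. norm (\<phi> x) \<le> M" using bounded_compact_support[OF assms(2,4,5)] by blast
  have fK: "integrable (lebesgue_on K) f" using f assms by (auto simp: loc_integrable_def)
  have mp: "\<phi> \<in> borel_measurable (lebesgue_on K)"
    by (meson assms(4) continuous_imp_measurable_on_sets_lebesgue continuous_on_subset Ks subset_UNIV)
  have "integrable (lebesgue_on K) (\<lambda>x. \<phi> x *\<^sub>R f x)"
    by (rule Bochner_Integration.integrable_bound[of _ "\<lambda>x. M *\<^sub>R f x"])
       (use fK mp M in \<open>auto intro!: mult_right_mono borel_measurable_scaleR\<close>)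
  then have "integrable lebesgue (\<lambda>x. indicator K x *\<^sub>R (\<phi> x *\<^sub>R f x))"
    using Ks by (simp add: integrable_restrict_space)
  also have "(\<lambda>x. indicator K x *\<^sub>R (\<phi> x *\<^sub>R f x)) = (\<lambda>x. indicator \<Omega> x *\<^sub>R (\<phi> x *\<^sub>R f x))"
    using assms(3,5) by (auto simp: fun_eq_iff indicator_def)
  finally show ?thesis using assms(1) by (simp add: integrable_restrict_space)
qed

text \<open>Each component of the difference integrates to zero against all test functions, so the
  fundamental lemma applies componentwise.\<close>

theorem weak_gradient_unique:
  assumes \<Omega>: "open \<Omega>" and "is_weak_gradient \<Omega> u g1" "is_weak_gradient \<Omega> u g2"
    and l: "\<And>i. loc_integrable \<Omega> (\<lambda>x. g1 x $ i)" "\<And>i. loc_integrable \<Omega> (\<lambda>x. g2 x $ i)"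
  shows "AE x in lebesgue_on \<Omega>. g1 x = g2 x"
proof -
  have "AE x in lebesgue_on \<Omega>. g1 x $ i - g2 x $ i = 0" for i
  proof (rule fundamental_lemma[OF \<Omega>])
    show "integrable (lebesgue_on (cbox a b)) (\<lambda>x. g1 x $ i - g2 x $ i)" if "cbox a b \<subseteq> \<Omega>" for a b
      using l[of i] that unfolding loc_integrable_def by auto
    fix \<phi> assume phi: "\<phi> \<in> test_functions \<Omega>"
    then obtain K where K: "compact K" "K \<subseteq> \<Omega>" "\<And>x. x \<notin> K \<Longrightarrow> \<phi> x = 0" "continuous_on UNIV \<phi>"
      by (elim test_functionsD) (rule that)
    have "integrable (lebesgue_on \<Omega>) (\<lambda>x. \<phi> x *\<^sub>R (g1 x $ i))" "integrable (lebesgue_on \<Omega>) (\<lambda>x. \<phi> x *\<^sub>R (g2 x $ i))"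
      using integrable_test_mult[OF \<Omega> K(1,2,4)] K(3) l by auto
    moreover have "(\<integral>x. \<phi> x *\<^sub>R (g1 x $ i) \<partial>lebesgue_on \<Omega>) = (\<integral>x. \<phi> x *\<^sub>R (g2 x $ i) \<partial>lebesgue_on \<Omega>)"
      using assms(2,3)[unfolded is_weak_gradient_def, rule_format, OF phi, of i] by simp
    ultimately show "(\<integral>x. \<phi> x *\<^sub>R (g1 x $ i - g2 x $ i) \<partial>lebesgue_on \<Omega>) = 0"
      by (simp add: scaleR_diff_right)
  qed
  from this[of 1] this[of 2] show ?thesis
    by (rule AE_mp[OF _ AE_mp]) (auto simp: vec_eq_iff forall_2)
qed

lemma is_weak_gradient_diff:
  assumes \<Omega>: "open \<Omega>" and w: "is_weak_gradient \<Omega> u g" "is_weak_gradient \<Omega> v h"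
    and l: "L2_on \<Omega> u" "L2_on \<Omega> v" "L2_on \<Omega> g" "L2_on \<Omega> h"
  shows "is_weak_gradient \<Omega> (\<lambda>x. u x - v x) (\<lambda>x. g x - h x)"
  unfolding is_weak_gradient_def
proof (intro ballI allI)
  fix \<phi> i assume phi: "\<phi> \<in> test_functions \<Omega>"
  then obtain K where K: "compact K" "K \<subseteq> \<Omega>" "\<And>x. x \<notin> K \<Longrightarrow> \<phi> x = 0" "\<And>x i. x \<notin> K \<Longrightarrow> partial_deriv i \<phi> x = 0"
    "continuous_on UNIV \<phi>" "\<And>i. continuous_on UNIV (partial_deriv i \<phi>)" by (elim test_functionsD) (rule that)
  have i: "integrable (lebesgue_on \<Omega>) (\<lambda>x. partial_deriv i \<phi> x *\<^sub>R f x)"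
    "integrable (lebesgue_on \<Omega>) (\<lambda>x. \<phi> x *\<^sub>R f x)" if "loc_integrable \<Omega> f" for f
    using integrable_test_mult[OF \<Omega> K(1,2) K(6) _ that, of i] integrable_test_mult[OF \<Omega> K(1,2,5) _ that]
      K(3,4) by auto
  have "integrable (lebesgue_on \<Omega>) (\<lambda>x. partial_deriv i \<phi> x *\<^sub>R u x)"
    "integrable (lebesgue_on \<Omega>) (\<lambda>x. partial_deriv i \<phi> x *\<^sub>R v x)"
    "integrable (lebesgue_on \<Omega>) (\<lambda>x. \<phi> x *\<^sub>R (g x $ i))"
    "integrable (lebesgue_on \<Omega>) (\<lambda>x. \<phi> x *\<^sub>R (h x $ i))"
    using i(1)[OF L2_on_loc_integrable[OF \<Omega> l(1)]] i(1)[OF L2_on_loc_integrable[OF \<Omega> l(2)]]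
      i(2)[OF L2_on_loc_integrable[OF \<Omega> L2_on_component[OF l(3)]]]
      i(2)[OF L2_on_loc_integrable[OF \<Omega> L2_on_component[OF l(4)]]] by auto
  then show "(\<integral>x. partial_deriv i \<phi> x *\<^sub>R (u x - v x) \<partial>lebesgue_on \<Omega>) =
     - (\<integral>x. \<phi> x *\<^sub>R ((g x - h x) $ i) \<partial>lebesgue_on \<Omega>)"
    using w phi unfolding is_weak_gradient_def by (simp add: scaleR_diff_right)
qed

lemma weak_gradient_spec:
  assumes "L2_on \<Omega> g" "is_weak_gradient \<Omega> u g"
  shows "L2_on \<Omega> (weak_gradient \<Omega> u)" "is_weak_gradient \<Omega> u (weak_gradient \<Omega> u)"
  using someI[of "\<lambda>g. L2_on \<Omega> g \<and> is_weak_gradient \<Omega> u g" g] assms unfolding weak_gradient_def by blast+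

lemma L2_sq_cong_AE:
  assumes "L2_on \<Omega> g" "L2_on \<Omega> h" "AE x in lebesgue_on \<Omega>. g x = h x"
  shows "L2_sq \<Omega> g = L2_sq \<Omega> h"
  unfolding L2_sq_def using assms unfolding L2_on_def
  by (intro integral_cong_AE) (auto elim: eventually_mono)

text \<open>Frees the energy from the Hilbert choice in \<open>weak_gradient\<close>, so that it can
  be computed from classical gradients.\<close>

lemma dirichlet_energy_eq:
  assumes "open \<Omega>" "L2_on \<Omega> g" "is_weak_gradient \<Omega> u g"
  shows "dirichlet_energy \<Omega> u = L2_sq \<Omega> g"
  unfolding dirichlet_energy_def
  by (intro L2_sq_cong_AE weak_gradient_unique[OF assms(1) weak_gradient_spec(2)[OF assms(2,3)] assms(3)]
      weak_gradient_spec(1)[OF assms(2,3)] assms(2) L2_on_loc_integrable[OF assms(1)] L2_on_component)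

text \<open>Membership in \<open>W12\<close> only supplies some square integrable weak gradient; by
  uniqueness the classical gradient agrees with it almost everywhere and inherits the
  integrability.\<close>

lemma C1_grad_L2:
  assumes \<Omega>: "open \<Omega>" and U: "Ck_on 1 \<Omega> U" "U \<in> W12 \<Omega>"
  shows "L2_on \<Omega> (grad U)"
proof -
  obtain g where g: "L2_on \<Omega> g" "is_weak_gradient \<Omega> U g" using U(2) by (auto simp: W12_def)
  have c: "continuous_on \<Omega> (\<lambda>x. grad U x $ i)" for i
    using U(1) unfolding Ck_on_1 by (simp add: grad_def)
  have ae: "AE x in lebesgue_on \<Omega>. g x = grad U x"
    by (rule weak_gradient_unique[OF \<Omega> g(2) is_weak_gradient_grad[OF \<Omega> U(1)]
      L2_on_loc_integrable[OF \<Omega> L2_on_component[OF g(1)]] loc_integrable_continuous[OF c]])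
  have "continuous_on \<Omega> (\<lambda>x. \<chi> i. grad U x $ i)" by (intro continuous_intros c)
  then have "continuous_on \<Omega> (grad U)" by simp
  then have m: "grad U \<in> borel_measurable (lebesgue_on \<Omega>)"
    using \<Omega> by (intro continuous_imp_measurable_on_sets_lebesgue) auto
  have "integrable (lebesgue_on \<Omega>) (\<lambda>x. (norm (grad U x))\<^sup>2)"
    by (rule integrable_cong_AE_imp[of _ "\<lambda>x. (norm (g x))\<^sup>2"])
       (use g m ae in \<open>auto simp: L2_on_def elim: eventually_mono\<close>)
  then show ?thesis using m by (simp add: L2_on_def)
qed

section \<open>Fubini on the plane and change of variables\<close>

text \<open>The change of variables formula with determinants is used on \<open>real^2\<close>,
  Fubini on pairs; \<open>vec2\<close> is the bridge.\<close>

definition vec2 :: "real \<Rightarrow> real \<Rightarrow> real^2" where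
  "vec2 s t = vector [s, t]"

lemma vec2_nth [simp]: "vec2 s t $ 1 = s" "vec2 s t $ 2 = t"
  by (simp_all add: vec2_def)

lemma vec2_eta [simp]: "vec2 (x $ 1) (x $ 2) = x"
  by (simp add: vec_eq_iff forall_2)

definition rect :: "real set \<Rightarrow> real set \<Rightarrow> (real^2) set" where
  "rect A B = {x. x $ 1 \<in> A \<and> x $ 2 \<in> B}"

lemma vec2_mem_rect [simp]: "vec2 s t \<in> rect A B \<longleftrightarrow> s \<in> A \<and> t \<in> B"
  by (simp add: rect_def)

lemma continuous_on_vec2 [continuous_intros]:
  assumes "continuous_on S f" "continuous_on S g"
  shows "continuous_on S (\<lambda>x. vec2 (f x) (g x))"
proof -
  have "vec2 (f x) (g x) = (\<chi> i::2. if i = 1 then f x else g x)" for x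
    by (simp add: vec_eq_iff forall_2)
  moreover have "continuous_on S (\<lambda>x. \<chi> i::2. if i = 1 then f x else g x)"
  proof (intro continuous_on_vec_lambda)
    fix i :: 2
    show "continuous_on S (\<lambda>x. if i = 1 then f x else g x)"
      using assms by (cases "i = 1") simp_all
  qed
  ultimately show ?thesis by simp
qed

lemma open_rect: "open A \<Longrightarrow> open B \<Longrightarrow> open (rect A B)"
proof -
  assume o: "open A" "open B"
  have "rect A B = (\<lambda>x. x $ 1) -` A \<inter> (\<lambda>x. x $ 2) -` B" by (auto simp: rect_def)
  then show ?thesis using o
    by (auto intro!: open_Int open_vimage continuous_intros)
qed

text \<open>Lebesgue measure is determined by its values on boxes, and the product measure gives a
  box the product of its side lengths.\<close>

lemma lborel_distr_vec2: "distr lborel borel (\<lambda>p. vec2 (fst p) (snd p)) = (lborel :: (real^2) measure)"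
proof (rule lborel_eqI[symmetric])
  have m[measurable]: "(\<lambda>p. vec2 (fst p) (snd p)) \<in> borel_measurable borel"
    by (intro borel_measurable_continuous_onI continuous_intros)
  fix l u :: "real^2"
  assume le: "\<And>b. b \<in> Basis \<Longrightarrow> l \<bullet> b \<le> u \<bullet> b"
  have le': "l $ i \<le> u $ i" for i
    using le[of "axis i 1"] by (simp add: cart_eq_inner_axis axis_in_Basis_iff)
  have bp: "box (l $ 1, l $ 2) (u $ 1, u $ 2) = box (l $ 1) (u $ 1) \<times> box (l $ 2) (u $ 2)"
    by (auto simp: mem_box Basis_prod_def ball_Un)
  have "(\<lambda>p. vec2 (fst p) (snd p)) -` box l u = box (l $ 1, l $ 2) (u $ 1, u $ 2)"
    unfolding bp by (auto simp: mem_box_cart forall_2 box_real)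
  then have "emeasure (distr lborel borel (\<lambda>p. vec2 (fst p) (snd p))) (box l u) =
     emeasure lborel (box (l $ 1, l $ 2) (u $ 1, u $ 2))"
    by (subst emeasure_distr) auto
  also have "\<dots> = emeasure (lborel \<Otimes>\<^sub>M lborel) (box (l $ 1) (u $ 1) \<times> box (l $ 2) (u $ 2))"
    by (simp add: lborel_prod bp)
  also have "\<dots> = ennreal (u $ 1 - l $ 1) * ennreal (u $ 2 - l $ 2)"
    by (subst lborel.emeasure_pair_measure_Times) (auto simp: box_real le')
  also have "\<dots> = ennreal (\<Prod>i\<in>UNIV. (u - l) $ i)"
    using le' by (simp add: ennreal_mult UNIV_2)
  also have "(\<Prod>i\<in>UNIV. (u - l) $ i) = prod ((\<bullet>) (u - l)) Basis"
  proof -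
    have B: "(Basis :: (real^2) set) = (\<lambda>i. axis i 1) ` UNIV" by (auto simp: Basis_vec_def)
    have "inj (\<lambda>i::2. axis i (1::real))" by (auto simp: inj_on_def axis_eq_axis)
    then show ?thesis unfolding B by (simp add: prod.reindex cart_eq_inner_axis)
  qed
  finally show "emeasure (distr lborel borel (\<lambda>p. vec2 (fst p) (snd p))) (box l u) =
    ennreal (prod ((\<bullet>) (u - l)) Basis)" .
qed simp

lemma
  fixes f :: "real^2 \<Rightarrow> real"
  assumes f: "f \<in> borel_measurable borel"
  shows integrable_lborel_vec2_iff:
      "integrable lborel f \<longleftrightarrow> integrable (lborel \<Otimes>\<^sub>M lborel) (\<lambda>p. f (vec2 (fst p) (snd p)))"
    and integral_lborel_vec2:
      "integral\<^sup>L lborel f = (\<integral>p. f (vec2 (fst p) (snd p)) \<partial>(lborel \<Otimes>\<^sub>M lborel))"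
proof -
  have m: "(\<lambda>p. vec2 (fst p) (snd p)) \<in> lborel \<rightarrow>\<^sub>M borel"
    by (simp add: borel_measurable_continuous_onI continuous_intros)
  show "integrable lborel f \<longleftrightarrow> integrable (lborel \<Otimes>\<^sub>M lborel) (\<lambda>p. f (vec2 (fst p) (snd p)))"
    by (subst lborel_distr_vec2[symmetric], subst integrable_distr_eq[OF m f]) (simp add: lborel_prod)
  show "integral\<^sup>L lborel f = (\<integral>p. f (vec2 (fst p) (snd p)) \<partial>(lborel \<Otimes>\<^sub>M lborel))"
    by (subst lborel_distr_vec2[symmetric], subst integral_distr[OF m f]) (simp add: lborel_prod)
qed

lemma absolutely_integrable_lebesgue_on:
  fixes f :: "'a::euclidean_space \<Rightarrow> 'b::euclidean_space"
  assumes "S \<in> sets lebesgue"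
  shows "f absolutely_integrable_on S \<longleftrightarrow> integrable (lebesgue_on S) f"
  using assms by (simp add: set_integrable_def integrable_restrict_space)

lemma change_of_variables_plane:
  fixes f :: "real^2 \<Rightarrow> real" and g :: "real^2 \<Rightarrow> real^2"
  assumes S: "S \<in> sets lebesgue" and gS: "g ` S \<in> sets lebesgue"
    and der: "\<And>x. x \<in> S \<Longrightarrow> (g has_derivative g' x) (at x)"
    and inj: "inj_on g S"
    and J: "\<And>x. x \<in> S \<Longrightarrow> \<bar>det (matrix (g' x))\<bar> = J x"
  shows "integrable (lebesgue_on (g ` S)) f \<longleftrightarrow> integrable (lebesgue_on S) (\<lambda>x. J x * f (g x))"
    and "integrable (lebesgue_on (g ` S)) f \<Longrightarrow>
      integral\<^sup>L (lebesgue_on (g ` S)) f = (\<integral>x. J x * f (g x) \<partial>lebesgue_on S)"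
proof -
  have d: "(g has_derivative g' x) (at x within S)" if "x \<in> S" for x
    using der[OF that] by (rule has_derivative_at_withinI)
  \<comment> \<open>The substitution theorem is applied to values in \<open>real^1\<close>;
    \<open>vec\<close> lifts the scalar integrand there.\<close>
  have *: "((\<lambda>x. \<bar>det (matrix (g' x))\<bar> * f (g x)) absolutely_integrable_on S \<and>
      integral S (\<lambda>x. \<bar>det (matrix (g' x))\<bar> * f (g x)) = b) \<longleftrightarrow>
      (f absolutely_integrable_on (g ` S) \<and> integral (g ` S) f = b)" for b
    using has_absolute_integral_change_of_variables[OF S d inj, of "\<lambda>x. vec (f x) :: real^1" "vec b"]
    by (simp add: absolutely_integrable_on_1_iff integral_on_1_eq o_def vec_eq_iff)
  have c: "(\<lambda>x. \<bar>det (matrix (g' x))\<bar> * f (g x)) absolutely_integrable_on S \<longleftrightarrow>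
        (\<lambda>x. J x * f (g x)) absolutely_integrable_on S"
    by (rule set_integrable_cong) (simp_all add: J)
  have e: "integral S (\<lambda>x. \<bar>det (matrix (g' x))\<bar> * f (g x)) = integral S (\<lambda>x. J x * f (g x))"
    by (rule integral_cong) (simp add: J)
  show i: "integrable (lebesgue_on (g ` S)) f \<longleftrightarrow> integrable (lebesgue_on S) (\<lambda>x. J x * f (g x))"
    using *[of "integral (g ` S) f"] *[of "integral S (\<lambda>x. \<bar>det (matrix (g' x))\<bar> * f (g x))"] c
    unfolding absolutely_integrable_lebesgue_on[OF S] absolutely_integrable_lebesgue_on[OF gS] by blast
  assume f: "integrable (lebesgue_on (g ` S)) f"
  have "integral\<^sup>L (lebesgue_on (g ` S)) f = integral (g ` S) f"
    by (rule lebesgue_integral_eq_integral[OF f gS])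
  also have "\<dots> = integral S (\<lambda>x. J x * f (g x))"
    using *[of "integral (g ` S) f"] f e unfolding absolutely_integrable_lebesgue_on[OF gS] by metis
  also have "\<dots> = (\<integral>x. J x * f (g x) \<partial>lebesgue_on S)"
    using i f by (intro lebesgue_integral_eq_integral[symmetric] S) blast
  finally show "integral\<^sup>L (lebesgue_on (g ` S)) f = (\<integral>x. J x * f (g x) \<partial>lebesgue_on S)" .
qed

text \<open>Continuity on the open rectangle makes the function, cut off by the indicator, Borel
  measurable; the completed measure can then be replaced by \<open>lborel\<close>, to which Fubini
  applies.\<close>

lemma
  fixes h :: "real^2 \<Rightarrow> real"
  assumes A: "open A" and B: "open B" and h: "continuous_on (rect A B) h"
  shows integrable_rect_iff: "integrable (lebesgue_on (rect A B)) h \<longleftrightarrow>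
      integrable (lborel \<Otimes>\<^sub>M lborel) (\<lambda>(s, t). indicator A s * (indicator B t * h (vec2 s t)))"
    and integral_rect: "integrable (lebesgue_on (rect A B)) h \<Longrightarrow> integral\<^sup>L (lebesgue_on (rect A B)) h =
      (\<integral>s. (\<integral>t. indicator A s * (indicator B t * h (vec2 s t)) \<partial>lborel) \<partial>lborel)"
proof -
  have R: "open (rect A B)" by (rule open_rect[OF A B])
  define k where "k x = indicator (rect A B) x * h x" for x
  have m: "k \<in> borel_measurable borel"
    using borel_measurable_continuous_on_indicator[of "rect A B" h] R h by (simp add: k_def[abs_def])
  have k: "k (vec2 s t) = indicator A s * (indicator B t * h (vec2 s t))" for s t
    by (simp add: k_def indicator_def)
  have 1: "integrable (lebesgue_on (rect A B)) h \<longleftrightarrow> integrable lborel k"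
    using R m by (simp add: integrable_restrict_space k_def[abs_def] integrable_completion)
  show 2: "integrable (lebesgue_on (rect A B)) h \<longleftrightarrow>
      integrable (lborel \<Otimes>\<^sub>M lborel) (\<lambda>(s, t). indicator A s * (indicator B t * h (vec2 s t)))"
    unfolding 1 integrable_lborel_vec2_iff[OF m] by (simp add: k case_prod_beta')
  assume "integrable (lebesgue_on (rect A B)) h"
  then have i: "integrable (lborel \<Otimes>\<^sub>M lborel) (\<lambda>p. k (vec2 (fst p) (snd p)))"
    unfolding 1 integrable_lborel_vec2_iff[OF m] .
  have "integral\<^sup>L (lebesgue_on (rect A B)) h = integral\<^sup>L lborel k"
    using R m by (simp add: integral_restrict_space k_def[abs_def] integral_completion)
  also have "\<dots> = (\<integral>s. (\<integral>t. k (vec2 s t) \<partial>lborel) \<partial>lborel)"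
    unfolding integral_lborel_vec2[OF m] using lborel_pair.integral_fst'[OF i] by simp
  finally show "integral\<^sup>L (lebesgue_on (rect A B)) h =
      (\<integral>s. (\<integral>t. indicator A s * (indicator B t * h (vec2 s t)) \<partial>lborel) \<partial>lborel)"
    by (simp add: k)
qed

section \<open>Strip coordinates\<close>

locale planar_curve =
  fixes I :: "real set" and \<gamma> \<gamma>' \<gamma>'' :: "real \<Rightarrow> real^2"
  assumes open_I: "open I" and interval_I: "is_interval I" and nonempty_I: "I \<noteq> {}"
    and C2: "C2_curve_on (closure I) \<gamma> \<gamma>' \<gamma>''"
    and unit_speed: "\<And>s. s \<in> closure I \<Longrightarrow> norm (\<gamma>' s) = 1"
begin

abbreviation "\<kappa> \<equiv> curvature \<gamma>' \<gamma>''"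
abbreviation "nu \<equiv> normal_vec \<gamma>'"

lemma in_closure: "s \<in> I \<Longrightarrow> s \<in> closure I"
  using closure_subset by blast

lemma nu_nth [simp]: "nu s $ 1 = - \<gamma>' s $ 2" "nu s $ 2 = \<gamma>' s $ 1"
  by (simp_all add: normal_vec_def)

lemma deriv_at:
  assumes s: "s \<in> I"
  shows "(\<gamma> has_vector_derivative \<gamma>' s) (at s)" "(\<gamma>' has_vector_derivative \<gamma>'' s) (at s)"
proof -
  have *: "at s within closure I = at s"
    by (rule at_within_open_subset[OF s open_I closure_subset])
  show "(\<gamma> has_vector_derivative \<gamma>' s) (at s)" "(\<gamma>' has_vector_derivative \<gamma>'' s) (at s)"
    using C2 in_closure[OF s] unfolding C2_curve_on_def by (auto simp flip: *)
qed

lemma continuous_gamma: "continuous_on (closure I) \<gamma>" "continuous_on (closure I) \<gamma>'"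
  "continuous_on (closure I) \<gamma>''"
  using C2 unfolding C2_curve_on_def
  by (auto simp: continuous_on_eq_continuous_within intro: has_vector_derivative_continuous)

lemma continuous_nu: "continuous_on (closure I) nu"
proof -
  have "nu = (\<lambda>s. vec2 (- \<gamma>' s $ 2) (\<gamma>' s $ 1))" by (auto simp: normal_vec_def vec2_def)
  then show ?thesis using continuous_gamma(2) by (auto intro!: continuous_intros)
qed

lemma unit_sq: "s \<in> closure I \<Longrightarrow> (\<gamma>' s $ 1)\<^sup>2 + (\<gamma>' s $ 2)\<^sup>2 = 1"
  using unit_speed[of s] by (simp add: norm_vec_def L2_set_def sum_2)

lemma curvature_eq: "\<kappa> s = \<gamma>' s $ 1 * \<gamma>'' s $ 2 - \<gamma>' s $ 2 * \<gamma>'' s $ 1"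
  by (simp add: curvature_def det_2)

lemma continuous_curvature: "continuous_on I \<kappa>"
  unfolding curvature_eq[abs_def]
  by (intro continuous_intros continuous_on_subset[OF continuous_gamma(2)]
       continuous_on_subset[OF continuous_gamma(3)] closure_subset)

lemma component_deriv:
  assumes "(f has_vector_derivative f') (at s)"
  shows "((\<lambda>s. f s $ i) has_real_derivative f' $ i) (at s)"
  using bounded_linear.has_vector_derivative[OF bounded_linear_vec_nth assms, of i]
  by (simp add: has_real_derivative_iff_has_vector_derivative)

text \<open>Frenet equation: differentiating \<bar>\<gamma>'\<bar>^2 = 1 shows that
  \<open>\<gamma>''\<close> is orthogonal to \<open>\<gamma>'\<close>, so it is
  \<open>\<kappa>\<close> times the normal.\<close>

lemma second_deriv:
  assumes s: "s \<in> I"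
  shows "\<gamma>'' s $ 1 = - \<kappa> s * \<gamma>' s $ 2" "\<gamma>'' s $ 2 = \<kappa> s * \<gamma>' s $ 1"
proof -
  note d = component_deriv[OF deriv_at(2)[OF s]]
  have "((\<lambda>s. (\<gamma>' s $ 1)\<^sup>2 + (\<gamma>' s $ 2)\<^sup>2) has_real_derivative
     (2 * \<gamma>' s $ 1 * \<gamma>'' s $ 1 + 2 * \<gamma>' s $ 2 * \<gamma>'' s $ 2)) (at s)"
    by (auto intro!: derivative_eq_intros d)
  moreover have "((\<lambda>s. (\<gamma>' s $ 1)\<^sup>2 + (\<gamma>' s $ 2)\<^sup>2) has_real_derivative 0) (at s)"
    by (rule has_field_derivative_transform_within_open[OF DERIV_const open_I s])
       (use unit_sq in_closure in auto)
  ultimately have o: "\<gamma>' s $ 1 * \<gamma>'' s $ 1 + \<gamma>' s $ 2 * \<gamma>'' s $ 2 = 0"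
    using DERIV_unique by fastforce
  have u: "(\<gamma>' s $ 1)\<^sup>2 + (\<gamma>' s $ 2)\<^sup>2 = 1" using unit_sq in_closure s by blast
  show "\<gamma>'' s $ 1 = - \<kappa> s * \<gamma>' s $ 2" "\<gamma>'' s $ 2 = \<kappa> s * \<gamma>' s $ 1"
    unfolding curvature_eq using o u by algebra+
qed

definition L :: "real \<Rightarrow> real^2 \<Rightarrow> real^2" where
  "L \<epsilon> x = strip_map \<gamma> \<gamma>' \<epsilon> (x $ 1, x $ 2)"

lemma L_vec2: "L \<epsilon> (vec2 s t) = strip_map \<gamma> \<gamma>' \<epsilon> (s, t)"
  by (simp add: L_def)

lemma strip_map_image: "strip_map \<gamma> \<gamma>' \<epsilon> ` (A \<times> B) = L \<epsilon> ` rect A B"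
proof (intro set_eqI iffI)
  fix y assume "y \<in> strip_map \<gamma> \<gamma>' \<epsilon> ` (A \<times> B)"
  then obtain s t where "s \<in> A" "t \<in> B" "y = strip_map \<gamma> \<gamma>' \<epsilon> (s, t)" by auto
  then show "y \<in> L \<epsilon> ` rect A B" by (intro image_eqI[of _ _ "vec2 s t"]) (simp_all add: L_vec2)
qed (auto simp: L_def rect_def)

lemma L_inj_on: "inj_on (strip_map \<gamma> \<gamma>' \<epsilon>) (A \<times> B) \<Longrightarrow> inj_on (L \<epsilon>) (rect A B)"
proof (rule inj_onI)
  fix x y assume "inj_on (strip_map \<gamma> \<gamma>' \<epsilon>) (A \<times> B)" "x \<in> rect A B" "y \<in> rect A B" "L \<epsilon> x = L \<epsilon> y"
  then have "(x $ 1, x $ 2) = (y $ 1, y $ 2)"     unfolding L_def by (intro inj_onD[of "strip_map \<gamma> \<gamma>' \<epsilon>" "A \<times> B"]) (auto simp: rect_def)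
  then show "x = y" by (simp add: vec_eq_iff forall_2)
qed

lemma continuous_on_L: "continuous_on (rect (closure I) B) (L \<epsilon>)"
  unfolding L_def strip_map_def split_beta fst_conv snd_conv prod.case
  by (intro continuous_intros continuous_on_compose2[OF continuous_gamma(1)]
      continuous_on_compose2[OF continuous_nu]) (auto simp: rect_def)

text \<open>The derivative of \<open>L \<epsilon>\<close>, written in the orthonormal frame of
  \<open>\<gamma>'\<close> and \<open>nu\<close>. Since the normal has derivative -\<kappa> times
  the tangent, moving in s stretches lengths by 1 - \<epsilon> t \<kappa>, moving in t by
  \<epsilon>.\<close>

definition L' :: "real \<Rightarrow> real^2 \<Rightarrow> real^2 \<Rightarrow> real^2" where
  "L' \<epsilon> x h = (h $ 1 * (1 - \<epsilon> * x $ 2 * \<kappa> (x $ 1))) *\<^sub>R \<gamma>' (x $ 1) + (h $ 2 * \<epsilon>) *\<^sub>R nu (x $ 1)"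

lemma L_has_derivative:
  assumes s: "x $ 1 \<in> I"
  shows "(L \<epsilon> has_derivative L' \<epsilon> x) (at x)"
proof -
  let ?s = "x $ 1" and ?t = "x $ 2"
  have c: "((\<lambda>x. f (x $ 1) $ i) has_derivative (\<lambda>h. h $ 1 * f' $ i)) (at x)"
    if "(f has_vector_derivative f') (at ?s)" for f :: "real \<Rightarrow> real^2" and f' i
    using DERIV_compose_FDERIV[of "\<lambda>s. f s $ i", OF component_deriv[OF that]
       bounded_linear_imp_has_derivative[OF bounded_linear_vec_nth[of 1]]] .
  note d = c[OF deriv_at(1)[OF s]] c[OF deriv_at(2)[OF s]]
  have t: "((\<lambda>x. x $ 2) has_derivative (\<lambda>h. h $ 2)) (at x)"
    by (rule bounded_linear_imp_has_derivative[OF bounded_linear_vec_nth])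
  have 1: "((\<lambda>x. L \<epsilon> x $ 1) has_derivative (\<lambda>h. L' \<epsilon> x h $ 1)) (at x)"
    unfolding L_def strip_map_def split L'_def
    by (auto intro!: derivative_eq_intros d t simp: second_deriv[OF s] algebra_simps)
  have 2: "((\<lambda>x. L \<epsilon> x $ 2) has_derivative (\<lambda>h. L' \<epsilon> x h $ 2)) (at x)"
    unfolding L_def strip_map_def split L'_def
    by (auto intro!: derivative_eq_intros d t simp: second_deriv[OF s] algebra_simps)
  have "((\<lambda>x. L \<epsilon> x $ i) has_derivative (\<lambda>h. L' \<epsilon> x h $ i)) (at x)" for i
    using exhaust_2[of i] 1 2 by auto
  then show ?thesis
    by (subst has_derivative_componentwise_within) (auto simp: Basis_vec_def inner_axis)
qed

lemma det_L':
  assumes s: "x $ 1 \<in> I"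
  shows "det (matrix (L' \<epsilon> x)) = \<epsilon> * (1 - \<epsilon> * x $ 2 * \<kappa> (x $ 1))"
proof -
  have u: "(\<gamma>' (x $ 1) $ 1)\<^sup>2 + (\<gamma>' (x $ 1) $ 2)\<^sup>2 = 1" using unit_sq in_closure s by blast
  define a where "a = 1 - \<epsilon> * x $ 2 * \<kappa> (x $ 1)"
  have "det (matrix (L' \<epsilon> x)) = \<epsilon> * a * ((\<gamma>' (x $ 1) $ 1)\<^sup>2 + (\<gamma>' (x $ 1) $ 2)\<^sup>2)"
    by (simp add: det_2 matrix_def L'_def axis_def a_def[symmetric]) (simp add: power2_eq_square algebra_simps)
  then show ?thesis using u by (simp add: a_def)
qed

end

section \<open>One-dimensional inequalities\<close>

lemma has_integral_Icc_of_lborel: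
  fixes f :: "real \<Rightarrow> real"
  assumes "integrable lborel (\<lambda>t. indicator {a<..<b} t * f t)"
  shows "(f has_integral (\<integral>t. indicator {a<..<b} t * f t \<partial>lborel)) {a..b}"
proof -
  let ?g = "\<lambda>t. indicator {a<..<b} t * f t"
  obtain J where J: "J = (\<integral>t. ?g t \<partial>lborel)" by blast
  have "(?g has_integral J) UNIV"
    using has_integral_integral_lborel[OF assms] by (simp add: J)
  also have "?g = (\<lambda>t. if t \<in> {a<..<b} then f t else 0)" by (auto simp: fun_eq_iff indicator_def)
  finally have "(f has_integral J) {a..b}"
    unfolding has_integral_restrict_UNIV by (simp add: has_integral_Icc_iff_Ioo)
  then show ?thesis by (simp add: J)
qed

lemma integrable_Ioo_continuous:
  fixes f :: "real \<Rightarrow> real"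
  assumes "continuous_on {a..b} f"
  shows "integrable lborel (\<lambda>t. indicator {a<..<b} t * f t)"
proof -
  have "integrable lborel (\<lambda>t. indicator {a..b} t *\<^sub>R f t)"
    by (rule borel_integrable_compact[OF _ assms]) simp
  from integrable_mult_indicator[OF _ this, of "{a<..<b}"]
  have "integrable lborel (\<lambda>t. indicator {a<..<b} t *\<^sub>R indicator {a..b} t *\<^sub>R f t)" by simp
  also have "(\<lambda>t. indicator {a<..<b} t *\<^sub>R indicator {a..b} t *\<^sub>R f t) = (\<lambda>t. indicator {a<..<b} t * f t)"
    by (auto simp: fun_eq_iff indicator_def)
  finally show ?thesis .
qed

text \<open>Picone's argument: \<open>h\<close> plays the role of the logarithmic derivative of a positive supersolution.\<close>

lemma picone_inequality:
  fixes w :: "real \<Rightarrow> 'a::euclidean_space" and g h \<rho> :: "real \<Rightarrow> real"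
  assumes w: "continuous_on {0..1} w"
      "\<And>t. t \<in> {0<..<1} \<Longrightarrow> (w has_vector_derivative w' t) (at t)"
    and g: "continuous_on {0..1} g" "\<And>t. t \<in> {0<..<1} \<Longrightarrow> (g has_real_derivative g' t) (at t)"
    and gh: "\<And>t. t \<in> {0<..<1} \<Longrightarrow> g t = \<rho> t * h t"
    and \<rho>: "\<And>t. t \<in> {0<..<1} \<Longrightarrow> \<rho> t \<ge> 0" "continuous_on {0..1} \<rho>"
    and super: "\<And>t. t \<in> {0<..<1} \<Longrightarrow> g' t + \<rho> t * (h t)\<^sup>2 \<le> - \<Lambda> * \<rho> t"
    and g1: "g 1 \<ge> 0"
    and int: "(\<lambda>t. \<rho> t * (norm (w' t))\<^sup>2) integrable_on {0..1}"
  shows "\<Lambda> * integral {0..1} (\<lambda>t. \<rho> t * (norm (w t))\<^sup>2)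
      \<le> integral {0..1} (\<lambda>t. \<rho> t * (norm (w' t))\<^sup>2) + g 0 * (norm (w 0))\<^sup>2"
proof -
  \<comment> \<open>\<open>R\<close> is the difference of the two integrands in the claim,
    \<open>G'\<close> the derivative of g \<bar>w\<bar>^2. Setting \<open>G'\<close> equal to
    \<open>R\<close> outside the open interval makes the pointwise comparison valid also at the
    endpoints, where \<open>w'\<close> is arbitrary.\<close>
  define R where "R t = \<rho> t * (norm (w' t))\<^sup>2 - \<Lambda> * (\<rho> t * (norm (w t))\<^sup>2)" for t
  define G' where "G' t = (if t \<in> {0<..<1} then g' t * (w t \<bullet> w t) + g t * (2 * (w t \<bullet> w' t)) else R t)" for t
  have iw: "(\<lambda>t. \<rho> t * (norm (w t))\<^sup>2) integrable_on {0..1}"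
    by (intro integrable_continuous_real continuous_intros w \<rho>)
  have "(G' has_integral (g 1 * (w 1 \<bullet> w 1) - g 0 * (w 0 \<bullet> w 0))) {0..1}"
  proof (rule fundamental_theorem_of_calculus_interior)
    show "continuous_on {0..1} (\<lambda>t. g t * (w t \<bullet> w t))" by (intro continuous_intros w g)
    fix t :: real assume t: "t \<in> {0<..<1}"
    have "((\<lambda>t. w t \<bullet> w t) has_real_derivative 2 * (w t \<bullet> w' t)) (at t)"
      using has_derivative_inner[OF w(2)[OF t, unfolded has_vector_derivative_def] w(2)[OF t, unfolded has_vector_derivative_def]]
      unfolding has_field_derivative_def
      by (rule has_derivative_eq_rhs) (auto simp: fun_eq_iff inner_commute algebra_simps)
    from DERIV_mult[OF g(2)[OF t] this]
    show "((\<lambda>t. g t * (w t \<bullet> w t)) has_vector_derivative G' t) (at t)"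
      using t by (simp add: G'_def has_real_derivative_iff_has_vector_derivative[symmetric] mult.commute)
  qed simp
  moreover have "(R has_integral (integral {0..1} (\<lambda>t. \<rho> t * (norm (w' t))\<^sup>2)
      - \<Lambda> * integral {0..1} (\<lambda>t. \<rho> t * (norm (w t))\<^sup>2))) {0..1}"
    unfolding R_def
    by (intro has_integral_diff has_integral_mult_right integrable_integral int iw)
  moreover have "G' t \<le> R t" for t
  proof (cases "t \<in> {0<..<1}")
    case t: True
    \<comment> \<open>What is thrown away is the square \<rho> \<bar>w' - h w\<bar>^2;
      \<open>super\<close> absorbs the remaining multiple of \<bar>w\<bar>^2.\<close>
    have "0 \<le> (norm (w' t - h t *\<^sub>R w t))\<^sup>2" by simp
    also have "\<dots> = (norm (w' t))\<^sup>2 - 2 * h t * (w t \<bullet> w' t) + (h t)\<^sup>2 * (norm (w t))\<^sup>2"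
      by (simp only: power2_norm_eq_inner) (simp add: inner_diff inner_commute power2_eq_square algebra_simps)
    finally have "\<rho> t * (2 * h t * (w t \<bullet> w' t)) \<le> \<rho> t * ((norm (w' t))\<^sup>2 + (h t)\<^sup>2 * (norm (w t))\<^sup>2)"
      using \<rho>(1)[OF t] by (intro mult_left_mono) auto
    moreover have "(g' t + \<rho> t * (h t)\<^sup>2) * (norm (w t))\<^sup>2 \<le> (- \<Lambda> * \<rho> t) * (norm (w t))\<^sup>2"
      by (intro mult_right_mono super t) auto
    ultimately show ?thesis using t
      by (simp add: G'_def R_def gh power2_norm_eq_inner[symmetric] algebra_simps)
  next
    case False
    then show ?thesis unfolding G'_def by (simp only: if_False order.refl)
  qed
  ultimately have "g 1 * (w 1 \<bullet> w 1) - g 0 * (w 0 \<bullet> w 0) \<le> integral {0..1} (\<lambda>t. \<rho> t * (norm (w' t))\<^sup>2)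
      - \<Lambda> * integral {0..1} (\<lambda>t. \<rho> t * (norm (w t))\<^sup>2)"
    by (meson has_integral_le)
  moreover have "g 1 * (w 1 \<bullet> w 1) \<ge> 0" using g1 by simp
  ultimately show ?thesis by (simp add: power2_norm_eq_inner)
qed

lemma abs_sin_diff_le: "\<bar>sin z - z\<bar> \<le> (z::real)\<^sup>2"
proof -
  have "\<bar>sin z - (\<Sum>m<2. sin_coeff m * z ^ m)\<bar> \<le> inverse (fact 2) * \<bar>z\<bar> ^ 2"
    by (rule Maclaurin_sin_bound)
  then have "2 * \<bar>sin z - z\<bar> \<le> z\<^sup>2" by (simp add: numeral_2_eq_2 sin_coeff_def)
  then show ?thesis by (rule order_trans[rotated]) simp
qed

lemma inverse_sin_square:
  assumes "sin x \<noteq> (0::real)"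
  shows "1 / (sin x)\<^sup>2 = 1 + (cot x)\<^sup>2"
proof -
  have "(sin x)\<^sup>2 / (sin x)\<^sup>2 + (cos x)\<^sup>2 / (sin x)\<^sup>2 = 1 / (sin x)\<^sup>2"
    by (simp only: add_divide_distrib[symmetric] sin_cos_squared_add)
  then show ?thesis using assms by (simp add: cot_def power_divide)
qed

lemma one_minus_cos_bounds: "0 \<le> 1 - cos z" "1 - cos (z::real) \<le> z\<^sup>2"
proof -
  have "1 - cos z = 2 * (sin (z / 2))\<^sup>2" using cos_double_sin[of "z / 2"] by simp
  moreover have "(sin (z / 2))\<^sup>2 \<le> (z / 2)\<^sup>2"
    using abs_sin_x_le_abs_x[of "z / 2"] by (metis abs_le_square_iff)
  moreover have "(z / 2)\<^sup>2 = z\<^sup>2 / 4" by (simp add: power_divide)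
  ultimately show "1 - cos z \<le> z\<^sup>2" using zero_le_power2[of z] by linarith
qed simp

text \<open>\<open>w 0\<close> is unconstrained: a violation of the Dirichlet condition is charged
  at the rate \<open>B\<close>. Only the finiteness of \<open>B\<close> matters, because the
  functions to which this is applied approximate one with zero trace.\<close>

definition fibre_lower_ineq :: "real \<Rightarrow> real \<Rightarrow> real \<Rightarrow> bool" where
  "fibre_lower_ineq k \<Lambda> B \<longleftrightarrow> (\<forall>(w :: real \<Rightarrow> complex) w'. continuous_on {0..1} w \<longrightarrow>
     (\<forall>t\<in>{0<..<1}. (w has_vector_derivative w' t) (at t)) \<longrightarrow>
     (\<lambda>t. (1 - k * t) * (norm (w' t))\<^sup>2) integrable_on {0..1} \<longrightarrow>
     \<Lambda> * integral {0..1} (\<lambda>t. (1 - k * t) * (norm (w t))\<^sup>2)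
       \<le> integral {0..1} (\<lambda>t. (1 - k * t) * (norm (w' t))\<^sup>2) + B * (norm (w 0))\<^sup>2)"

text \<open>The supersolution is \<open>(1 - k t)\<^sup>-\<^sup>1\<^sup>/\<^sup>2 sin (\<omega> t + \<delta>)\<close>, where the shift \<open>\<delta> = \<epsilon>\<^sup>2\<close> keeps its logarithmic
  derivative bounded at the Dirichlet end.\<close>

lemma fibre_lower_bound:
  fixes K :: real
  assumes K: "K \<ge> 0"
  obtains C \<epsilon>0 :: real where "C \<ge> 0" "\<epsilon>0 > 0"
    "\<And>\<epsilon> c. \<lbrakk>0 < \<epsilon>; \<epsilon> < \<epsilon>0; \<bar>c\<bar> \<le> K\<rbrakk> \<Longrightarrow>
      fibre_lower_ineq (\<epsilon> * c) (pi\<^sup>2 / 4 + \<epsilon> * c - C * \<epsilon>\<^sup>2) (2 * \<bar>cot (\<epsilon>\<^sup>2)\<bar> + 1)"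
proof -
  define M where "M = K + 1"
  \<comment> \<open>5 M^2 is chosen so that (pi a / 2) \<epsilon>^2, which exceeds 7 (M
    \<epsilon>)^2, beats the second order error in the condition at t = 1. \<open>C\<close> adds the
    resulting loss in \<omega>^2 to that from the term k / (2 \<rho>).\<close>
  define a where "a = 5 * M\<^sup>2"
  define C where "C = pi * a + pi + K\<^sup>2"
  define \<epsilon>0 where "\<epsilon>0 = min (1 / (4 * M)) (1 / a)"
  have M: "M \<ge> 1" using K by (simp add: M_def)
  have a: "a \<ge> 5" using M by (simp add: a_def)
  have "C \<ge> 0" using a by (simp add: C_def)
  moreover have "\<epsilon>0 > 0" using M a by (simp add: \<epsilon>0_def)
  moreover have "fibre_lower_ineq (\<epsilon> * c) (pi\<^sup>2 / 4 + \<epsilon> * c - C * \<epsilon>\<^sup>2) (2 * \<bar>cot (\<epsilon>\<^sup>2)\<bar> + 1)"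
    if \<epsilon>: "0 < \<epsilon>" "\<epsilon> < \<epsilon>0" and c: "\<bar>c\<bar> \<le> K" for \<epsilon> c
    unfolding fibre_lower_ineq_def
  proof (intro allI impI)
    fix w w' :: "real \<Rightarrow> complex"
    assume w: "continuous_on {0..1} w" and wd: "\<forall>t\<in>{0<..<1}. (w has_vector_derivative w' t) (at t)"
      and int: "(\<lambda>t. (1 - \<epsilon> * c * t) * (norm (w' t))\<^sup>2) integrable_on {0..1}"
    define k where "k = \<epsilon> * c"
    define \<delta> where "\<delta> = \<epsilon>\<^sup>2"
    \<comment> \<open>To first order the Neumann condition at t = 1 reads \<omega> tan z = k/2 with
      \<omega> near pi/2, hence z = k/pi; the subtracted multiple of \<epsilon>^2 turns this
      equation into the needed inequality \<open>g 1 \<ge> 0\<close>.\<close>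
    define z where "z = k / pi - a * \<epsilon>\<^sup>2"
    define \<omega> where "\<omega> = pi / 2 + z - \<delta>"
    define \<rho> where "\<rho> t = 1 - k * t" for t
    \<comment> \<open>Logarithmic derivative of the supersolution; the second summand comes from the
      factor (1 - k t)^(-1/2). \<open>g\<close> is \<open>\<rho>\<close> times \<open>h\<close> with
      the fraction cleared.\<close>
    define h where "h t = \<omega> * cot (\<omega> * t + \<delta>) + k / (2 * \<rho> t)" for t
    define g where "g t = \<rho> t * \<omega> * cot (\<omega> * t + \<delta>) + k / 2" for t
    define g' where "g' t = - k * \<omega> * cot (\<omega> * t + \<delta>) - \<rho> t * \<omega>\<^sup>2 / (sin (\<omega> * t + \<delta>))\<^sup>2" for t
    have eM: "M * \<epsilon> \<le> 1 / 4" and ea: "a * \<epsilon> \<le> 1"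
      using \<epsilon> M a by (auto simp: \<epsilon>0_def field_simps)
    have e1: "\<epsilon> \<le> 1 / 4" using eM M \<epsilon> mult_right_mono[of 1 M \<epsilon>] by linarith
    have pi3: "pi > 3" "pi < 4" "pi < 3.2" using pi_gt3 pi_less_4 pi_approx by auto
    have k: "\<bar>k\<bar> \<le> K * \<epsilon>" using c \<epsilon> by (simp add: k_def abs_mult mult.commute mult_left_mono)
    have kM: "\<bar>k\<bar> \<le> M * \<epsilon>" using k \<epsilon> by (simp add: M_def algebra_simps)
    have z: "\<bar>z\<bar> \<le> M * \<epsilon>"
    proof -
      have "\<bar>k / pi\<bar> \<le> \<bar>k\<bar>" using pi3 by (simp add: abs_divide divide_le_eq mult_le_cancel_left1)
      moreover have "\<bar>a * \<epsilon>\<^sup>2\<bar> \<le> \<epsilon>" using ea \<epsilon> a mult_right_mono[OF ea, of \<epsilon>]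
        by (simp add: power2_eq_square abs_mult)
      moreover have "\<bar>z\<bar> \<le> \<bar>k / pi\<bar> + \<bar>a * \<epsilon>\<^sup>2\<bar>" unfolding z_def by (rule abs_triangle_ineq4)
      moreover have "M * \<epsilon> = K * \<epsilon> + \<epsilon>" by (simp add: M_def algebra_simps)
      ultimately show ?thesis using k by linarith
    qed
    have \<delta>: "0 < \<delta>" "\<delta> \<le> \<epsilon>" "\<delta> \<le> M * \<epsilon>"
      using \<epsilon> e1 M by (auto simp: \<delta>_def power2_eq_square)
    have \<omega>: "1 \<le> \<omega>" "\<omega> \<le> 2" using z eM \<delta> e1 pi3 unfolding \<omega>_def by linarith+
    have \<theta>: "0 < \<omega> * t + \<delta>" "\<omega> * t + \<delta> < pi" if "t \<in> {0..1}" for t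
    proof -
      show "0 < \<omega> * t + \<delta>" using that \<omega> \<delta> by (intro add_nonneg_pos) auto
      have "\<omega> * t \<le> \<omega>" using that \<omega> by (simp add: mult_left_le)
      then show "\<omega> * t + \<delta> < pi" using z eM pi3 unfolding \<omega>_def by linarith
    qed
    have sin: "sin (\<omega> * t + \<delta>) > 0" if "t \<in> {0..1}" for t using \<theta>[OF that] by (intro sin_gt_zero)
    have \<rho>: "1 / 2 \<le> \<rho> t" if "t \<in> {0..1}" for t
    proof -
      have "\<bar>k * t\<bar> \<le> \<bar>k\<bar>" using that by (simp add: abs_mult mult_left_le)
      then show ?thesis using kM eM unfolding \<rho>_def by linarith
    qed
    have main: "(pi\<^sup>2 / 4 + k - C * \<epsilon>\<^sup>2) * integral {0..1} (\<lambda>t. \<rho> t * (norm (w t))\<^sup>2)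
      \<le> integral {0..1} (\<lambda>t. \<rho> t * (norm (w' t))\<^sup>2) + g 0 * (norm (w 0))\<^sup>2"
    proof (rule picone_inequality[OF w bspec[OF wd], where g' = g' and h = h])
      show "continuous_on {0..1} g"
        unfolding g_def \<rho>_def cot_def
        by (intro continuous_intros) (use sin in force)
      show "(g has_real_derivative g' t) (at t)" if "t \<in> {0<..<1}" for t
      proof -
        have "((\<lambda>t. \<omega> * t + \<delta>) has_real_derivative \<omega>) (at t)" by (auto intro!: derivative_eq_intros)
        from DERIV_chain2[OF DERIV_cot this] sin[of t] that
        have dc: "((\<lambda>t. cot (\<omega> * t + \<delta>)) has_real_derivative - inverse ((sin (\<omega> * t + \<delta>))\<^sup>2) * \<omega>) (at t)"
          by auto
        show ?thesis unfolding g_def g'_def \<rho>_def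
          by (rule derivative_eq_intros dc refl)+ (simp add: field_simps power2_eq_square)
      qed
      show "g t = \<rho> t * h t" if "t \<in> {0<..<1}" for t
        using \<rho>[of t] that by (simp add: g_def h_def field_simps)
      show "0 \<le> \<rho> t" if "t \<in> {0<..<1}" for t using \<rho>[of t] that by simp
      show "continuous_on {0..1} \<rho>" unfolding \<rho>_def by (intro continuous_intros)
      show "(\<lambda>t. \<rho> t * (cmod (w' t))\<^sup>2) integrable_on {0..1}"
        using int by (simp add: \<rho>_def k_def)
      show "g' t + \<rho> t * (h t)\<^sup>2 \<le> - (pi\<^sup>2 / 4 + k - C * \<epsilon>\<^sup>2) * \<rho> t" if t: "t \<in> {0<..<1}" for t
      proof -
        have r: "1 / 2 \<le> \<rho> t" and s: "sin (\<omega> * t + \<delta>) > 0" using \<rho> sin t by auto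
        define x where "x = cot (\<omega> * t + \<delta>)"
        have sx: "1 / (sin (\<omega> * t + \<delta>))\<^sup>2 = 1 + x\<^sup>2"
          unfolding x_def using s by (intro inverse_sin_square) simp
        have "g' t = - k * \<omega> * x - \<rho> t * \<omega>\<^sup>2 * (1 / (sin (\<omega> * t + \<delta>))\<^sup>2)"
          by (simp add: g'_def x_def)
        then have g'x: "g' t = - k * \<omega> * x - \<rho> t * \<omega>\<^sup>2 * (1 + x\<^sup>2)"
          unfolding sx .
        \<comment> \<open>The mixed terms k \<omega> x cancel thanks to the factor (1 - k t)^(-1/2),
          so only the square of k / (2 \<rho>) is left as an error.\<close>
        have "g' t + \<rho> t * (h t)\<^sup>2 = - \<rho> t * (\<omega>\<^sup>2 - (k / (2 * \<rho> t))\<^sup>2)"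
          unfolding g'x h_def x_def[symmetric] using r
          by (simp add: field_simps power2_eq_square)
        also have "\<dots> \<le> - \<rho> t * (pi\<^sup>2 / 4 + k - C * \<epsilon>\<^sup>2)"
        proof -
          have "\<bar>k / (2 * \<rho> t)\<bar> \<le> \<bar>k\<bar>" using r by (simp add: abs_divide divide_le_eq mult_le_cancel_left1)
          then have "\<bar>k / (2 * \<rho> t)\<bar> \<le> K * \<epsilon>" using k by linarith
          then have "\<bar>k / (2 * \<rho> t)\<bar>\<^sup>2 \<le> (K * \<epsilon>)\<^sup>2" by (intro power_mono) auto
          then have 1: "(k / (2 * \<rho> t))\<^sup>2 \<le> K\<^sup>2 * \<epsilon>\<^sup>2" by (simp only: power2_abs power_mult_distrib)
          have "\<omega>\<^sup>2 = pi\<^sup>2 / 4 + pi * (z - \<delta>) + (z - \<delta>)\<^sup>2"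
            by (simp add: \<omega>_def power2_eq_square field_simps)
          moreover have "pi * (z - \<delta>) = k - (pi * a + pi) * \<epsilon>\<^sup>2"
            using pi3 by (simp add: z_def \<delta>_def field_simps)
          ultimately have "\<omega>\<^sup>2 \<ge> pi\<^sup>2 / 4 + k - (pi * a + pi) * \<epsilon>\<^sup>2" by simp
          with 1 have "pi\<^sup>2 / 4 + k - C * \<epsilon>\<^sup>2 \<le> \<omega>\<^sup>2 - (k / (2 * \<rho> t))\<^sup>2"
            by (simp add: C_def algebra_simps)
          then show ?thesis using r by simp
        qed
        finally show ?thesis by (simp add: algebra_simps)
      qed
      show "0 \<le> g 1"
      proof -
        have cz: "cos z > 0" using z eM pi3 by (intro cos_gt_zero_pi) linarith+
        have "\<omega> * 1 + \<delta> = pi / 2 + z" by (simp add: \<omega>_def)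
        then have "cot (\<omega> * 1 + \<delta>) = - (sin z / cos z)"
          by (simp add: cot_def cos_add sin_add)
        then have ct: "cos z * cot (\<omega> * 1 + \<delta>) = - sin z" using cz by simp
        \<comment> \<open>Multiplying by cos z > 0 removes the cotangent without changing the
          sign.\<close>
        have "g 1 * cos z = (1 - k) * \<omega> * (cos z * cot (\<omega> * 1 + \<delta>)) + k / 2 * cos z"
          by (simp add: g_def \<rho>_def algebra_simps)
        then have g1: "g 1 * cos z = k / 2 * cos z - (1 - k) * \<omega> * sin z"
          unfolding ct by simp
        \<comment> \<open>The first order part is split off; it equals -(pi a / 2) \<epsilon>^2 by
          the choice of z. The four terms of \<open>E\<close> are at most 2, 2, 2 and 1 times (M
          \<epsilon>)^2.\<close>
        define E where "E = - k * \<omega> * sin z + (z - \<delta>) * sin z + pi / 2 * (sin z - z) + k / 2 * (1 - cos z)"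
        have "(1 - k) * \<omega> * sin z - k / 2 * cos z = (pi / 2 * z - k / 2) + E"
          by (simp add: E_def \<omega>_def field_simps)
        moreover have "pi / 2 * z - k / 2 = - (pi * a / 2) * \<epsilon>\<^sup>2"
          using pi3 by (simp add: z_def field_simps)
        moreover have "E \<le> 7 * (M * \<epsilon>)\<^sup>2"
        proof -
          let ?m = "M * \<epsilon>"
          have sz: "\<bar>sin z\<bar> \<le> ?m" using abs_sin_x_le_abs_x[of z] z by linarith
          have z2: "z\<^sup>2 \<le> ?m\<^sup>2" using power_mono[OF z, of 2] by simp
          have "\<bar>k * \<omega> * sin z\<bar> \<le> (?m * 2) * ?m"
            unfolding abs_mult using kM \<omega> sz by (intro mult_mono) auto
          moreover have "\<bar>(z - \<delta>) * sin z\<bar> \<le> (2 * ?m) * ?m"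
            unfolding abs_mult using z \<delta> sz by (intro mult_mono) auto
          moreover have "\<bar>pi / 2 * (sin z - z)\<bar> \<le> 2 * ?m\<^sup>2"
            unfolding abs_mult using abs_sin_diff_le[of z] z2 pi3 by (intro mult_mono) auto
          moreover have "\<bar>k / 2 * (1 - cos z)\<bar> \<le> 1 * ?m\<^sup>2"
            unfolding abs_mult using one_minus_cos_bounds[of z] z2 kM eM by (intro mult_mono) auto
          ultimately show ?thesis unfolding E_def power2_eq_square by linarith
        qed
        moreover have "7 * (M * \<epsilon>)\<^sup>2 \<le> (pi * a / 2) * \<epsilon>\<^sup>2"
        proof -
          have "3 * M\<^sup>2 \<le> pi * M\<^sup>2" using pi3 by (intro mult_right_mono) auto
          moreover have "pi * a / 2 = 5 / 2 * (pi * M\<^sup>2)" by (simp add: a_def)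
          ultimately have "7 * M\<^sup>2 \<le> pi * a / 2" using zero_le_power2[of M] by linarith
          from mult_right_mono[OF this, of "\<epsilon>\<^sup>2"] show ?thesis by (simp add: power_mult_distrib)
        qed
        ultimately have "g 1 * cos z \<ge> 0" using g1 by linarith
        then show ?thesis using cz by (simp add: zero_le_mult_iff)
      qed
    qed
    \<comment> \<open>\<open>g 0\<close> is finite only because of the shift; its growth like
      \<epsilon>^(-2) is harmless in a penalty term.\<close>
    have "g 0 \<le> 2 * \<bar>cot (\<epsilon>\<^sup>2)\<bar> + 1"
    proof -
      have "\<omega> * cot \<delta> \<le> 2 * \<bar>cot \<delta>\<bar>"
        using mult_right_mono[OF \<omega>(2) abs_ge_zero[of "cot \<delta>"]] mult_left_mono[OF abs_ge_self[of "cot \<delta>"], of \<omega>] \<omega> by linarith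
      moreover have "k / 2 \<le> 1" using kM eM by linarith
      ultimately show ?thesis by (simp add: g_def \<rho>_def \<delta>_def)
    qed
    then have "g 0 * (norm (w 0))\<^sup>2 \<le> (2 * \<bar>cot (\<epsilon>\<^sup>2)\<bar> + 1) * (norm (w 0))\<^sup>2"
      by (intro mult_right_mono) auto
    with main show "(pi\<^sup>2 / 4 + \<epsilon> * c - C * \<epsilon>\<^sup>2) * integral {0..1} (\<lambda>t. (1 - \<epsilon> * c * t) * (norm (w t))\<^sup>2)
      \<le> integral {0..1} (\<lambda>t. (1 - \<epsilon> * c * t) * (norm (w' t))\<^sup>2)
        + (2 * \<bar>cot (\<epsilon>\<^sup>2)\<bar> + 1) * (norm (w 0))\<^sup>2"
      by (simp add: \<rho>_def k_def)
  qed
  ultimately show ?thesis using that by blast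
qed

section \<open>The transversal trial function\<close>

text \<open>A \<open>C\<^sup>1\<close> truncation with \<open>0 \<le> cutoff' \<delta> \<le> 1\<close>: it does not increase the energy and lowers the
  square by at most \<open>4 \<delta>\<close>.\<close>

definition cutoff :: "real \<Rightarrow> real \<Rightarrow> real" where
  "cutoff \<delta> x = (if x \<le> \<delta> then 0 else (x - \<delta>)\<^sup>2 / x)"

definition cutoff' :: "real \<Rightarrow> real \<Rightarrow> real" where
  "cutoff' \<delta> x = (if x \<le> \<delta> then 0 else 1 - \<delta>\<^sup>2 / x\<^sup>2)"

lemma cutoff_deriv:
  assumes "\<delta> > 0"
  shows "(cutoff \<delta> has_real_derivative cutoff' \<delta> x) (at x)"
proof -
  have d: "((\<lambda>x. (x - \<delta>)\<^sup>2 / x) has_real_derivative 1 - \<delta>\<^sup>2 / x\<^sup>2) (at x within S)" if "x \<ge> \<delta>" for x S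
    using assms that by (auto intro!: derivative_eq_intros simp: field_simps power2_eq_square)
  consider "x < \<delta>" | "x > \<delta>" | "x = \<delta>" by linarith
  then show ?thesis
  proof cases
    case 1
    have "(cutoff \<delta> has_real_derivative 0) (at x)"
      by (rule has_field_derivative_transform_within_open[where S = "{..<\<delta>}", OF DERIV_const])
         (use 1 in \<open>auto simp: cutoff_def\<close>)
    then show ?thesis using 1 by (simp add: cutoff'_def)
  next
    case 2
    have "(cutoff \<delta> has_real_derivative 1 - \<delta>\<^sup>2 / x\<^sup>2) (at x)"
      by (rule has_field_derivative_transform_within_open[where S = "{\<delta><..}", OF d])
         (use 2 in \<open>auto simp: cutoff_def\<close>)
    then show ?thesis using 2 by (simp add: cutoff'_def)
  next
    case 3
    \<comment> \<open>At the junction both one-sided derivatives are 0, since 1 - \<delta>^2 / x^2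
      vanishes at x = \<delta>.\<close>
    have "(cutoff \<delta> has_real_derivative 0) (at x within {..\<delta>})"
      by (rule has_field_derivative_transform_within[where f = "\<lambda>_. 0" and d = 1]) (use 3 in \<open>auto simp: cutoff_def\<close>)
    moreover have "(cutoff \<delta> has_real_derivative 1 - \<delta>\<^sup>2 / x\<^sup>2) (at x within {\<delta>..})"
      by (rule has_field_derivative_transform_within[where f = "\<lambda>x. (x - \<delta>)\<^sup>2 / x" and d = 1]) (use 3 assms d[of x] in \<open>simp_all add: cutoff_def\<close>)
    moreover have "{..\<delta>} \<union> {\<delta>..} = UNIV" by auto
    ultimately show ?thesis using 3 assms
      using Lim_within_Un[of "\<lambda>y. (cutoff \<delta> y - cutoff \<delta> \<delta>) / (y - \<delta>)" 0 \<delta> "{..\<delta>}" "{\<delta>..}"]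
      by (simp add: cutoff'_def has_field_derivative_iff)
  qed
qed

lemma continuous_cutoff':
  assumes "\<delta> > 0"
  shows "continuous_on UNIV (cutoff' \<delta>)"
proof -
  have "cutoff' \<delta> = (\<lambda>x. 1 - \<delta>\<^sup>2 / (max x \<delta>)\<^sup>2)"
    using assms by (auto simp: cutoff'_def fun_eq_iff max_def)
  moreover have "continuous_on UNIV (\<lambda>x. 1 - \<delta>\<^sup>2 / (max x \<delta>)\<^sup>2)"
    using assms by (intro continuous_intros) (auto simp: max_def)
  ultimately show ?thesis by simp
qed

lemma cutoff'_bounds:
  assumes "\<delta> > 0"
  shows "0 \<le> cutoff' \<delta> x" "cutoff' \<delta> x \<le> 1"
  using assms by (auto simp: cutoff'_def divide_le_eq power_mono)

text \<open>Above 2 \<delta> the cutoff stays above x - 2 \<delta>; below, x^2 is at most x, hence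
  at most 2 \<delta>, and the bound is not positive.\<close>

lemma cutoff_square_ge:
  assumes "\<delta> > 0" "0 \<le> x" "x \<le> 1"
  shows "(cutoff \<delta> x)\<^sup>2 \<ge> x\<^sup>2 - 4 * \<delta>"
proof (cases "x \<le> 2 * \<delta>")
  case True
  have "x\<^sup>2 \<le> x" using assms by (simp add: power2_eq_square mult_left_le)
  then show ?thesis using True assms zero_le_power2[of "cutoff \<delta> x"] by linarith
next
  case False
  have "x - 2 * \<delta> \<le> cutoff \<delta> x"
    using False assms by (simp add: cutoff_def field_simps power2_eq_square)
  then have "(x - 2 * \<delta>)\<^sup>2 \<le> (cutoff \<delta> x)\<^sup>2" using False by (intro power_mono) auto
  moreover have "(x - 2 * \<delta>)\<^sup>2 = x\<^sup>2 - 4 * \<delta> * x + 4 * \<delta>\<^sup>2" by (simp add: power2_eq_square algebra_simps)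
  moreover have "4 * \<delta> * x \<le> 4 * \<delta>" using assms by (simp add: mult_left_le)
  ultimately show ?thesis using zero_le_power2[of \<delta>] by linarith
qed

text \<open>The ground state of the straight fibre, cut off. It vanishes near t = 0 and not only at
  it, which later confines trial functions to a compact set.\<close>

definition chi :: "real \<Rightarrow> real \<Rightarrow> real" where
  "chi \<delta> t = cutoff \<delta> (sin (pi * t / 2))"

definition chi' :: "real \<Rightarrow> real \<Rightarrow> real" where
  "chi' \<delta> t = cutoff' \<delta> (sin (pi * t / 2)) * (pi / 2 * cos (pi * t / 2))"

lemma chi_deriv: "\<delta> > 0 \<Longrightarrow> (chi \<delta> has_real_derivative chi' \<delta> t) (at t)"
  unfolding chi_def chi'_def
  by (rule DERIV_chain2[OF cutoff_deriv]) (auto intro!: derivative_eq_intros)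

lemma continuous_chi: "\<delta> > 0 \<Longrightarrow> continuous_on S (chi \<delta>)"
  using chi_deriv by (auto intro!: continuous_at_imp_continuous_on DERIV_isCont)

lemma continuous_chi': "\<delta> > 0 \<Longrightarrow> continuous_on S (chi' \<delta>)"
  unfolding chi'_def
  by (intro continuous_intros continuous_on_compose2[OF continuous_cutoff']) auto

text \<open>For sin (pi t / 2) the weighted energy exceeds pi^2/4 times the weighted square by
  exactly k/2, and the weighted square differs from 1/2 by at most \<bar>k\<bar>; the quotient is
  thus pi^2/4 + k up to O(k^2). Cutting off at \<epsilon>^2 costs another O(\<epsilon>^2).\<close>

lemma fibre_upper_bound:
  fixes K :: real
  assumes K: "K \<ge> 0"
  obtains C \<epsilon>0 :: real where "C \<ge> 0" "\<epsilon>0 > 0"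
    "\<And>\<epsilon> c. \<lbrakk>0 < \<epsilon>; \<epsilon> < \<epsilon>0; \<bar>c\<bar> \<le> K\<rbrakk> \<Longrightarrow>
      integral {0..1} (\<lambda>t. (1 - \<epsilon> * c * t) * (chi' (\<epsilon>\<^sup>2) t)\<^sup>2)
      \<le> (pi\<^sup>2 / 4 + \<epsilon> * c + C * \<epsilon>\<^sup>2) * integral {0..1} (\<lambda>t. (1 - \<epsilon> * c * t) * (chi (\<epsilon>\<^sup>2) t)\<^sup>2)"
proof -
  \<comment> \<open>The factor 8 compensates \<open>S - 8 * \<delta>\<close>, which is at least 1/8.
    K^2 pays for k^2, and 32 for the loss 8 \<delta> (pi^2/4 + k), whose bracket is at most
    4.\<close>
  define C where "C = 8 * (K\<^sup>2 + 32)"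
  define \<epsilon>0 where "\<epsilon>0 = 1 / (8 * (K + 1))"
  have "C \<ge> 0" "\<epsilon>0 > 0" using K by (simp_all add: C_def \<epsilon>0_def)
  moreover have "integral {0..1} (\<lambda>t. (1 - \<epsilon> * c * t) * (chi' (\<epsilon>\<^sup>2) t)\<^sup>2)
      \<le> (pi\<^sup>2 / 4 + \<epsilon> * c + C * \<epsilon>\<^sup>2) * integral {0..1} (\<lambda>t. (1 - \<epsilon> * c * t) * (chi (\<epsilon>\<^sup>2) t)\<^sup>2)"
    if \<epsilon>: "0 < \<epsilon>" "\<epsilon> < \<epsilon>0" and c: "\<bar>c\<bar> \<le> K" for \<epsilon> c
  proof -
    define k where "k = \<epsilon> * c"
    define \<delta> where "\<delta> = \<epsilon>\<^sup>2"
    define \<rho> where "\<rho> t = 1 - k * t" for t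
    define sn where "sn t = sin (pi * t / 2)" for t
    define cs where "cs t = cos (pi * t / 2)" for t
    have \<delta>: "\<delta> > 0" using \<epsilon> by (simp add: \<delta>_def)
    have eK: "(K + 1) * \<epsilon> \<le> 1 / 8" using \<epsilon> K by (simp add: \<epsilon>0_def field_simps)
    have kK: "\<bar>k\<bar> \<le> K * \<epsilon>" using c \<epsilon> by (simp add: k_def abs_mult mult.commute mult_left_mono)
    have "K * \<epsilon> + \<epsilon> \<le> 1 / 8" using eK by (simp add: algebra_simps)
    moreover have "0 \<le> K * \<epsilon>" using K \<epsilon> by simp
    ultimately have k: "\<bar>k\<bar> \<le> 1 / 8" and e8: "\<epsilon> \<le> 1 / 8" using kK \<epsilon> by linarith+
    have \<delta>8: "\<delta> \<le> 1 / 64" using power_mono[OF e8, of 2] \<epsilon> by (simp add: \<delta>_def power2_eq_square)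
    have \<rho>: "0 \<le> \<rho> t" "\<rho> t \<le> 2" if "t \<in> {0..1}" for t
    proof -
      have "\<bar>k * t\<bar> \<le> \<bar>k\<bar>" using that by (simp add: abs_mult mult_left_le)
      then show "0 \<le> \<rho> t" "\<rho> t \<le> 2" using k unfolding \<rho>_def by linarith+
    qed
    have sn: "0 \<le> sn t" "sn t \<le> 1" if "t \<in> {0..1}" for t
    proof -
      have "pi * t / 2 \<le> pi" using that by (simp add: mult_left_le divide_le_eq)
      then show "0 \<le> sn t" "sn t \<le> 1" using that unfolding sn_def by (auto intro!: sin_ge_zero)
    qed
    have cont: "continuous_on {0..1} \<rho>" "continuous_on {0..1} sn" "continuous_on {0..1} cs"
      unfolding \<rho>_def sn_def cs_def by (intro continuous_intros; simp)+
    have int: "f integrable_on {0..1}" if "continuous_on {0..1} f" for f :: "real \<Rightarrow> real"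
      using that by (rule integrable_continuous_real)
    define S where "S = integral {0..1} (\<lambda>t. \<rho> t * (sn t)\<^sup>2)"
    define D where "D = integral {0..1} (\<lambda>t. \<rho> t * (cs t)\<^sup>2)"
    define X where "X = integral {0..1} (\<lambda>t. \<rho> t * (chi \<delta> t)\<^sup>2)"
    define X' where "X' = integral {0..1} (\<lambda>t. \<rho> t * (chi' \<delta> t)\<^sup>2)"
    have X'_le: "X' \<le> pi\<^sup>2 / 4 * D"
    proof -
      have "X' \<le> integral {0..1} (\<lambda>t. pi\<^sup>2 / 4 * (\<rho> t * (cs t)\<^sup>2))"
        unfolding X'_def
      proof (rule integral_le)
        fix t :: real assume t: "t \<in> {0..1}"
        have "(cutoff' \<delta> (sn t))\<^sup>2 \<le> 1" using cutoff'_bounds[OF \<delta>] by (simp add: power_le_one)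
        then have "(cutoff' \<delta> (sn t))\<^sup>2 * (pi / 2 * cs t)\<^sup>2 \<le> 1 * (pi / 2 * cs t)\<^sup>2" by (intro mult_right_mono) auto
        then have "(chi' \<delta> t)\<^sup>2 \<le> pi\<^sup>2 / 4 * (cs t)\<^sup>2"
          by (simp add: chi'_def sn_def cs_def power_mult_distrib power_divide)
        from mult_left_mono[OF this \<rho>(1)[OF t]]
        show "\<rho> t * (chi' \<delta> t)\<^sup>2 \<le> pi\<^sup>2 / 4 * (\<rho> t * (cs t)\<^sup>2)" by (simp add: algebra_simps)
      qed (intro int continuous_intros cont continuous_chi' \<delta>)+
      then show ?thesis by (simp add: D_def)
    qed
    have X_ge: "X \<ge> S - 8 * \<delta>"
    proof -
      have "integral {0..1} (\<lambda>t. \<rho> t * (sn t)\<^sup>2 - 8 * \<delta>) \<le> X"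
        unfolding X_def
      proof (rule integral_le)
        fix t :: real assume t: "t \<in> {0..1}"
        have "\<rho> t * ((sn t)\<^sup>2 - 4 * \<delta>) \<le> \<rho> t * (chi \<delta> t)\<^sup>2"
          using cutoff_square_ge[OF \<delta> sn[OF t]] by (intro mult_left_mono \<rho> t) (simp add: chi_def sn_def)
        moreover have "\<rho> t * (4 * \<delta>) \<le> 2 * (4 * \<delta>)" using \<rho>[OF t] \<delta> by (intro mult_right_mono) auto
        ultimately show "\<rho> t * (sn t)\<^sup>2 - 8 * \<delta> \<le> \<rho> t * (chi \<delta> t)\<^sup>2" by (simp add: algebra_simps)
      qed (intro int continuous_intros cont continuous_chi \<delta>)+
      moreover have "integral {0..1} (\<lambda>t. \<rho> t * (sn t)\<^sup>2 - 8 * \<delta>) = S - 8 * \<delta>"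
        unfolding S_def by (subst integral_diff) (auto intro!: int continuous_intros cont)
      ultimately show ?thesis by simp
    qed
    have ds: "(sn has_real_derivative pi / 2 * cs t) (at t within A)"
      "(cs has_real_derivative - (pi / 2 * sn t)) (at t within A)" for t A
      unfolding sn_def cs_def by (auto intro!: derivative_eq_intros)
    \<comment> \<open>Integrate the derivative of (pi/2) sin cos (1 - k t); the leftover from the
      weight is compensated by the derivative of (k/2) sin^2. At the endpoints only k/2
      remains.\<close>
    have DS: "pi\<^sup>2 / 4 * D = pi\<^sup>2 / 4 * S + k / 2"
    proof -
      have "((\<lambda>t. pi\<^sup>2 / 4 * (\<rho> t * (cs t)\<^sup>2) - pi\<^sup>2 / 4 * (\<rho> t * (sn t)\<^sup>2)) has_integral
         ((pi / 2 * sn 1 * cs 1 * \<rho> 1 + k / 2 * (sn 1)\<^sup>2) - (pi / 2 * sn 0 * cs 0 * \<rho> 0 + k / 2 * (sn 0)\<^sup>2))) {0..1}"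
      proof (rule fundamental_theorem_of_calculus)
        fix t :: real
        have "((\<lambda>t. pi / 2 * sn t * cs t * \<rho> t + k / 2 * (sn t)\<^sup>2) has_real_derivative
           (pi\<^sup>2 / 4 * (\<rho> t * (cs t)\<^sup>2) - pi\<^sup>2 / 4 * (\<rho> t * (sn t)\<^sup>2))) (at t within {0..1})"
          unfolding \<rho>_def
          by (rule derivative_eq_intros ds refl)+ (simp add: power2_eq_square field_simps)
        then show "((\<lambda>t. pi / 2 * sn t * cs t * \<rho> t + k / 2 * (sn t)\<^sup>2) has_vector_derivative
           (pi\<^sup>2 / 4 * (\<rho> t * (cs t)\<^sup>2) - pi\<^sup>2 / 4 * (\<rho> t * (sn t)\<^sup>2))) (at t within {0..1})"
          by (simp add: has_real_derivative_iff_has_vector_derivative)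
      qed simp
      then have "((\<lambda>t. pi\<^sup>2 / 4 * (\<rho> t * (cs t)\<^sup>2) - pi\<^sup>2 / 4 * (\<rho> t * (sn t)\<^sup>2)) has_integral k / 2) {0..1}"
        by (simp add: sn_def cs_def)
      moreover have "((\<lambda>t. pi\<^sup>2 / 4 * (\<rho> t * (cs t)\<^sup>2) - pi\<^sup>2 / 4 * (\<rho> t * (sn t)\<^sup>2)) has_integral
          (pi\<^sup>2 / 4 * D - pi\<^sup>2 / 4 * S)) {0..1}"
        unfolding D_def S_def
        by (intro has_integral_diff has_integral_mult_right integrable_integral int continuous_intros cont)
      ultimately have "k / 2 = pi\<^sup>2 / 4 * D - pi\<^sup>2 / 4 * S" by (rule has_integral_unique)
      then show ?thesis by linarith
    qed
    have S_half: "\<bar>S - 1 / 2\<bar> \<le> \<bar>k\<bar>"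
    proof -
      have "((\<lambda>t. (sn t)\<^sup>2) has_integral ((1 / 2 * 1 - 1 / pi * (sn 1 * cs 1)) - (1 / 2 * 0 - 1 / pi * (sn 0 * cs 0)))) {0..1}"
      proof (rule fundamental_theorem_of_calculus)
        fix t :: real
        have sc: "(sn t)\<^sup>2 + (cs t)\<^sup>2 = 1" by (simp add: sn_def cs_def)
        have "((\<lambda>t. 1 / 2 * t - 1 / pi * (sn t * cs t)) has_real_derivative 1 / 2 - ((cs t)\<^sup>2 - (sn t)\<^sup>2) / 2) (at t within {0..1})"
          by (rule derivative_eq_intros ds refl)+ (simp add: power2_eq_square field_simps)
        also have "1 / 2 - ((cs t)\<^sup>2 - (sn t)\<^sup>2) / 2 = (sn t)\<^sup>2" using sc by (simp add: field_simps)
        finally show "((\<lambda>t. 1 / 2 * t - 1 / pi * (sn t * cs t)) has_vector_derivative (sn t)\<^sup>2) (at t within {0..1})"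
          unfolding has_real_derivative_iff_has_vector_derivative .
      qed simp
      then have h: "((\<lambda>t. (sn t)\<^sup>2) has_integral 1 / 2) {0..1}"
        by (simp add: sn_def cs_def)
      have "((\<lambda>t. \<rho> t * (sn t)\<^sup>2 - (sn t)\<^sup>2) has_integral (S - 1 / 2)) {0..1}"
        unfolding S_def by (intro has_integral_diff h integrable_integral int continuous_intros cont)
      then have hi: "((\<lambda>t. \<rho> t * (sn t)\<^sup>2 - (sn t)\<^sup>2) has_integral (S - 1 / 2)) (cbox 0 1)" by simp
      have "norm (S - 1 / 2) \<le> \<bar>k\<bar> * measure lborel (cbox 0 (1::real))"
      proof (rule has_integral_bound[OF _ hi])
        fix t :: real assume "t \<in> cbox 0 1"
        then have t: "t \<in> {0..1}" by simp
        have "\<rho> t * (sn t)\<^sup>2 - (sn t)\<^sup>2 = - (k * (t * (sn t)\<^sup>2))"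
          by (simp add: \<rho>_def algebra_simps)
        then have "\<bar>\<rho> t * (sn t)\<^sup>2 - (sn t)\<^sup>2\<bar> = \<bar>k\<bar> * (t * (sn t)\<^sup>2)"
          using t by (simp add: abs_mult)
        also have "\<dots> \<le> \<bar>k\<bar> * (1 * 1)"
          using t sn[OF t] by (intro mult_left_mono mult_mono) (auto simp: power_le_one)
        finally show "norm (\<rho> t * (sn t)\<^sup>2 - (sn t)\<^sup>2) \<le> \<bar>k\<bar>" by simp
      qed simp
      then show ?thesis by simp
    qed
    have co: "pi\<^sup>2 / 4 + k + C * \<epsilon>\<^sup>2 \<ge> 0"
    proof -
      have "pi\<^sup>2 \<ge> 3\<^sup>2" using pi_gt3 by (intro power_mono) auto
      moreover have "C * \<epsilon>\<^sup>2 \<ge> 0" by (simp add: C_def)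
      ultimately show ?thesis using k by (simp add: abs_le_iff)
    qed
    have "X' \<le> pi\<^sup>2 / 4 * S + k / 2" using X'_le DS by simp
    also have "\<dots> \<le> (pi\<^sup>2 / 4 + k + C * \<epsilon>\<^sup>2) * (S - 8 * \<delta>)"
    proof -
      have "k\<^sup>2 \<le> (K * \<epsilon>)\<^sup>2" using power_mono[OF kK, of 2] by simp
      then have k2: "k\<^sup>2 \<le> K\<^sup>2 * \<epsilon>\<^sup>2" by (simp add: power_mult_distrib)
      have "\<bar>k * (S - 1 / 2)\<bar> \<le> \<bar>k\<bar> * \<bar>k\<bar>" unfolding abs_mult by (intro mult_left_mono S_half) auto
      then have 1: "k * S \<ge> k / 2 - k\<^sup>2" by (simp add: power2_eq_square algebra_simps abs_le_iff)
      have "S - 8 * \<delta> \<ge> 1 / 8" using S_half k \<delta>8 by linarith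
      then have "C * \<epsilon>\<^sup>2 * (1 / 8) \<le> C * \<epsilon>\<^sup>2 * (S - 8 * \<delta>)" by (intro mult_left_mono) (auto simp: C_def)
      then have 2: "C * \<epsilon>\<^sup>2 * (S - 8 * \<delta>) \<ge> K\<^sup>2 * \<epsilon>\<^sup>2 + 32 * \<epsilon>\<^sup>2" by (simp add: C_def algebra_simps)
      have "pi\<^sup>2 \<le> (7/2)\<^sup>2" using pi_approx by (intro power_mono) auto
      then have "pi\<^sup>2 / 4 + k \<le> 4" using k by (simp add: power2_eq_square abs_le_iff)
      then have "8 * \<delta> * (pi\<^sup>2 / 4 + k) \<le> 8 * \<delta> * 4" using \<delta> by (intro mult_left_mono) auto
      then have 3: "8 * \<delta> * (pi\<^sup>2 / 4 + k) \<le> 32 * \<epsilon>\<^sup>2" by (simp add: \<delta>_def)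
      have "(P + k + Q) * (S - 8 * \<delta>) = P * S + k * S + Q * (S - 8 * \<delta>) - 8 * \<delta> * (P + k)" for P Q
        by (simp add: algebra_simps)
      from this[of "pi\<^sup>2 / 4" "C * \<epsilon>\<^sup>2"]
      have "(pi\<^sup>2 / 4 + k + C * \<epsilon>\<^sup>2) * (S - 8 * \<delta>) =
         pi\<^sup>2 / 4 * S + k * S + C * \<epsilon>\<^sup>2 * (S - 8 * \<delta>) - 8 * \<delta> * (pi\<^sup>2 / 4 + k)" .
      then show ?thesis using 1 2 3 k2 by linarith
    qed
    also have "\<dots> \<le> (pi\<^sup>2 / 4 + k + C * \<epsilon>\<^sup>2) * X" by (intro mult_left_mono X_ge co)
    finally show ?thesis by (simp add: X_def X'_def \<rho>_def k_def \<delta>_def)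
  qed
  ultimately show ?thesis using that by blast
qed

section \<open>The form in strip coordinates and the lower bound\<close>

locale curved_strip = planar_curve +
  fixes \<epsilon> K :: real
  assumes eps: "0 < \<epsilon>" and K: "\<And>s. s \<in> I \<Longrightarrow> \<bar>\<kappa> s\<bar> \<le> K" and epsK: "\<epsilon> * K \<le> 1 / 2"
    and inj: "inj_on (strip_map \<gamma> \<gamma>' \<epsilon>) (closure I \<times> {0..1})"
begin

definition \<Omega> :: "(real^2) set" where
  "\<Omega> = strip_map \<gamma> \<gamma>' \<epsilon> ` (I \<times> {0<..<1})"

definition \<rho> :: "real \<Rightarrow> real \<Rightarrow> real" where
  "\<rho> s t = 1 - \<epsilon> * \<kappa> s * t"

lemma \<rho>_bounds:
  assumes "s \<in> I" "t \<in> {0..1}"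
  shows "1 / 2 \<le> \<rho> s t" "\<rho> s t \<le> 2"
proof -
  have "\<bar>\<epsilon> * \<kappa> s\<bar> \<le> \<epsilon> * K" using K[OF assms(1)] eps by (simp add: abs_mult)
  then have "\<bar>\<epsilon> * \<kappa> s\<bar> * \<bar>t\<bar> \<le> 1 / 2 * 1" using assms epsK by (intro mult_mono) auto
  then have "\<bar>\<epsilon> * \<kappa> s * t\<bar> \<le> 1 / 2" by (simp add: abs_mult)
  then show "1 / 2 \<le> \<rho> s t" "\<rho> s t \<le> 2" unfolding \<rho>_def by linarith+
qed

lemma L_inj: "inj_on (L \<epsilon>) (rect (closure I) {0..1})"
  by (rule L_inj_on[OF inj])

lemma \<Omega>_eq: "\<Omega> = L \<epsilon> ` rect I {0<..<1}"
  by (simp add: \<Omega>_def strip_map_image)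

lemma rect_mono: "A \<subseteq> A' \<Longrightarrow> B \<subseteq> B' \<Longrightarrow> rect A B \<subseteq> rect A' B'"
  by (auto simp: rect_def)

lemma L_inj_sub: "A \<subseteq> closure I \<Longrightarrow> B \<subseteq> {0..1} \<Longrightarrow> inj_on (L \<epsilon>) (rect A B)"
  by (rule inj_on_subset[OF L_inj rect_mono])

lemma open_L_image:
  assumes "open A" "A \<subseteq> I" "open B" "B \<subseteq> {0..1}"
  shows "open (L \<epsilon> ` rect A B)"
proof (rule invariance_of_domain)
  have "A \<subseteq> closure I" using assms(2) closure_subset by blast
  then show "inj_on (L \<epsilon>) (rect A B)" by (rule L_inj_sub[OF _ assms(4)])
  show "continuous_on (rect A B) (L \<epsilon>)"
    by (rule continuous_on_subset[OF continuous_on_L[of UNIV]])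
      (use \<open>A \<subseteq> closure I\<close> in \<open>auto simp: rect_def\<close>)
qed (use assms open_rect in blast)

lemma open_\<Omega>: "open \<Omega>"
  unfolding \<Omega>_eq by (rule open_L_image) (auto simp: open_I)

lemma L_in_\<Omega>: "s \<in> I \<Longrightarrow> t \<in> {0<..<1} \<Longrightarrow> L \<epsilon> (vec2 s t) \<in> \<Omega>"
  by (auto simp: \<Omega>_eq)

lemma continuous_on_L_line: "s \<in> closure I \<Longrightarrow> continuous_on S (\<lambda>t. L \<epsilon> (vec2 s t))"
  by (rule continuous_on_compose2[OF continuous_on_L[of UNIV]]) (auto intro!: continuous_intros)

lemma L_in_closure_\<Omega>:
  assumes "s \<in> I" "t \<in> {0..1}"
  shows "L \<epsilon> (vec2 s t) \<in> closure \<Omega>"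
proof -
  have "(\<lambda>t. L \<epsilon> (vec2 s t)) ` closure {0<..<1} \<subseteq> closure ((\<lambda>t. L \<epsilon> (vec2 s t)) ` {0<..<1})"
    by (rule continuous_image_closure_subset[OF continuous_on_L_line[of s UNIV]]) (use assms in_closure in auto)
  also have "\<dots> \<subseteq> closure \<Omega>" using assms L_in_\<Omega> by (intro closure_mono) auto
  finally show ?thesis using assms by auto
qed

lemma L_zero: "L \<epsilon> (vec2 s 0) = \<gamma> s"
  by (simp add: L_def strip_map_def)

text \<open>The point is a limit of fibre points as t tends to 0, while injectivity up to t = 0
  keeps it off the image of 0 < t \<le> 1. This makes the zero trace condition usable on the
  curve.\<close>

lemma gamma_in_dirichlet_boundary:
  assumes "s \<in> I"
  shows "\<gamma> s \<in> frontier \<Omega> - strip_map \<gamma> \<gamma>' \<epsilon> ` (I \<times> {1})"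
proof -
  have "\<gamma> s \<in> closure \<Omega>" using L_in_closure_\<Omega>[OF assms, of 0] by (simp add: L_zero)
  moreover have "\<gamma> s \<notin> L \<epsilon> ` rect I {0<..1}"
  proof
    assume "\<gamma> s \<in> L \<epsilon> ` rect I {0<..1}"
    then obtain x where x: "x \<in> rect I {0<..1}" "L \<epsilon> (vec2 s 0) = L \<epsilon> x" by (auto simp: L_zero)
    from x(1) have "x \<in> rect (closure I) {0..1}" using in_closure[of "x $ 1"] by (simp add: rect_def)
    with in_closure[OF assms] have "vec2 s 0 = x" by (intro inj_onD[OF L_inj x(2)]) simp_all
    then show False using x(1) by auto
  qed
  then have "\<gamma> s \<notin> \<Omega>" "\<gamma> s \<notin> strip_map \<gamma> \<gamma>' \<epsilon> ` (I \<times> {1})"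
    unfolding \<Omega>_eq strip_map_image by (auto simp: rect_def)
  ultimately show ?thesis by (auto simp: frontier_def interior_open[OF open_\<Omega>])
qed

text \<open>Compact pieces of the curve are admissible arcs in \<open>trace_zero_on\<close>; the
  curve itself supplies the arc length parameter.\<close>

lemma gamma_arc:
  assumes "a < b" "{a..b} \<subseteq> I"
  shows "unit_speed_arc \<gamma> a b"
  unfolding unit_speed_arc_def
proof (intro conjI exI ballI)
  show "inj_on \<gamma> {a..b}"
  proof (rule inj_onI)
    fix s s' assume s: "s \<in> {a..b}" "s' \<in> {a..b}" "\<gamma> s = \<gamma> s'"
    then have "L \<epsilon> (vec2 s 0) = L \<epsilon> (vec2 s' 0)" by (simp add: L_zero)
    moreover have "s \<in> closure I" "s' \<in> closure I" using s assms(2) closure_subset by blast+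
    ultimately have "vec2 s 0 = vec2 s' 0"
      by - (rule inj_onD[OF L_inj], simp_all)
    then show "s = s'" by (metis vec2_nth(1))
  qed
  show "continuous_on {a..b} \<gamma>'"
    using continuous_on_subset[OF continuous_gamma(2)] assms in_closure by blast
  fix s assume s: "s \<in> {a..b}"
  show "(\<gamma> has_vector_derivative \<gamma>' s) (at s within {a..b})"
    using deriv_at(1) s assms has_vector_derivative_at_within by blast
  show "norm (\<gamma>' s) = 1" using unit_speed in_closure s assms by blast
qed (rule assms)

lemma continuous_on_\<rho>: "continuous_on (rect I B) (\<lambda>x. \<rho> (x $ 1) (x $ 2))"
  unfolding \<rho>_def
  by (intro continuous_intros continuous_on_compose2[OF continuous_curvature]) (auto simp: rect_def)

text \<open>Change of variables to the rectangle, followed by Fubini. \<open>A\<close> is a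
  subinterval with compact closure in the lower bound, and \<open>I\<close> itself in the upper
  bound.\<close>

lemma
  fixes f :: "real^2 \<Rightarrow> real"
  assumes A: "open A" "A \<subseteq> I" and f: "continuous_on (L \<epsilon> ` rect A {0<..<1}) f"
    and int: "integrable (lebesgue_on (L \<epsilon> ` rect A {0<..<1})) f"
  shows strip_integrable: "integrable (lborel \<Otimes>\<^sub>M lborel)
      (\<lambda>(s, t). indicator A s * (indicator {0<..<1} t * (\<epsilon> * \<rho> s t * f (L \<epsilon> (vec2 s t)))))"
    and strip_integral: "integral\<^sup>L (lebesgue_on (L \<epsilon> ` rect A {0<..<1})) f =
      (\<integral>s. (\<integral>t. indicator A s * (indicator {0<..<1} t * (\<epsilon> * \<rho> s t * f (L \<epsilon> (vec2 s t)))) \<partial>lborel) \<partial>lborel)"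
proof -
  let ?R = "rect A {0<..<1}"
  define h where "h x = \<epsilon> * \<rho> (x $ 1) (x $ 2) * f (L \<epsilon> x)" for x
  have oR: "open ?R" using A by (intro open_rect) auto
  have oL: "open (L \<epsilon> ` ?R)" using A by (intro open_L_image) auto
  have Acl: "A \<subseteq> closure I" using A closure_subset by blast
  have J: "\<bar>det (matrix (L' \<epsilon> x))\<bar> = \<epsilon> * \<rho> (x $ 1) (x $ 2)" if "x \<in> ?R" for x
  proof -
    have s: "x $ 1 \<in> I" "x $ 2 \<in> {0..1}" using that A by (auto simp: rect_def)
    then have "\<epsilon> * \<rho> (x $ 1) (x $ 2) \<ge> 0" using \<rho>_bounds[OF s] eps by simp
    then show ?thesis using det_L'[OF s(1), of \<epsilon>] by (simp add: \<rho>_def algebra_simps)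
  qed
  have sets: "?R \<in> sets lebesgue" "L \<epsilon> ` ?R \<in> sets lebesgue" using oR oL by auto
  have sub: "x $ 1 \<in> I" if "x \<in> ?R" for x using that A by (auto simp: rect_def)
  have B01: "{0<..<1::real} \<subseteq> {0..1}" by auto
  note cv = change_of_variables_plane[OF sets L_has_derivative[OF sub] L_inj_sub[OF Acl B01] J]
  have R: "integrable (lebesgue_on ?R) h"
    using cv(1)[of f] int unfolding h_def[abs_def] by blast
  have "continuous_on ?R (L \<epsilon>)"
    using Acl by (intro continuous_on_subset[OF continuous_on_L[of UNIV]]) (auto simp: rect_def)
  then have hc: "continuous_on ?R h"
    unfolding h_def using A
    by (intro continuous_intros continuous_on_compose2[OF f] continuous_on_subset[OF continuous_on_\<rho>[of UNIV]])
       (auto simp: rect_def)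
  show "integrable (lborel \<Otimes>\<^sub>M lborel)
      (\<lambda>(s, t). indicator A s * (indicator {0<..<1} t * (\<epsilon> * \<rho> s t * f (L \<epsilon> (vec2 s t)))))"
    using integrable_rect_iff[OF A(1) open_greaterThanLessThan hc] R by (simp add: h_def)
  have "integral\<^sup>L (lebesgue_on (L \<epsilon> ` ?R)) f = integral\<^sup>L (lebesgue_on ?R) h"
    using cv(2)[OF _ _ int] unfolding h_def[abs_def] by blast
  also have "\<dots> = (\<integral>s. (\<integral>t. indicator A s * (indicator {0<..<1} t * (\<epsilon> * \<rho> s t * f (L \<epsilon> (vec2 s t)))) \<partial>lborel) \<partial>lborel)"
    using integral_rect[OF A(1) open_greaterThanLessThan hc R] by (simp add: h_def)
  finally show "integral\<^sup>L (lebesgue_on (L \<epsilon> ` ?R)) f =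
      (\<integral>s. (\<integral>t. indicator A s * (indicator {0<..<1} t * (\<epsilon> * \<rho> s t * f (L \<epsilon> (vec2 s t)))) \<partial>lborel) \<partial>lborel)" .
qed

text \<open>The derivative of \<open>U\<close> along a fibre with respect to t: \<epsilon> times the
  derivative in direction of the unit normal.\<close>

definition normal_dv :: "(real^2 \<Rightarrow> complex) \<Rightarrow> real \<Rightarrow> real \<Rightarrow> complex" where
  "normal_dv U s t = \<epsilon> *\<^sub>R ((- \<gamma>' s $ 2) *\<^sub>R partial_deriv 1 U (L \<epsilon> (vec2 s t)) +
     (\<gamma>' s $ 1) *\<^sub>R partial_deriv 2 U (L \<epsilon> (vec2 s t)))"

lemma continuous_on_normal_dv:
  assumes "Ck_on 1 \<Omega> U" "s \<in> I"
  shows "continuous_on {0<..<1} (normal_dv U s)"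
proof -
  have "continuous_on {0<..<1} (\<lambda>t. partial_deriv i U (L \<epsilon> (vec2 s t)))" for i
    using assms(1) unfolding Ck_on_1
    by (intro continuous_on_compose2[OF _ continuous_on_L_line[OF in_closure[OF assms(2)]], of \<Omega>])
       (use L_in_\<Omega> assms in auto)
  then show ?thesis unfolding normal_dv_def by (intro continuous_intros)
qed

text \<open>The fibre moves with velocity \<epsilon> times a unit vector, so Cauchy-Schwarz against
  the gradient discards the tangential part.\<close>

lemma
  assumes U: "U differentiable (at (L \<epsilon> (vec2 s t)))" and s: "s \<in> I"
  shows normal_derivative: "((\<lambda>t. U (L \<epsilon> (vec2 s t))) has_vector_derivative normal_dv U s t) (at t)"
    and norm_normal_dv_le: "norm (normal_dv U s t) \<le> \<epsilon> * norm (grad U (L \<epsilon> (vec2 s t)))"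
proof -
  let ?x = "L \<epsilon> (vec2 s t)"
  define D where "D = frechet_derivative U (at ?x)"
  have D: "(U has_derivative D) (at ?x)" unfolding D_def by (rule has_derivative_frechet[OF U])
  have lin: "linear D" using has_derivative_linear[OF D] .
  have e: "L \<epsilon> (vec2 s t) = \<gamma> s + (\<epsilon> * t) *\<^sub>R nu s" for t by (simp add: L_def strip_map_def)
  have "((\<lambda>t. L \<epsilon> (vec2 s t)) has_vector_derivative \<epsilon> *\<^sub>R nu s) (at t)"
    unfolding e by (auto intro!: derivative_eq_intros)
  from vector_derivative_diff_chain_within[OF this, of U D] D
  have d: "((\<lambda>t. U (L \<epsilon> (vec2 s t))) has_vector_derivative D (\<epsilon> *\<^sub>R nu s)) (at t)"
    using has_derivative_at_withinI by (auto simp: o_def)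
  define p where "p i = partial_deriv i U ?x" for i
  have nu: "nu s = (- \<gamma>' s $ 2) *\<^sub>R axis 1 1 + (\<gamma>' s $ 1) *\<^sub>R axis 2 1"
    by (simp add: vec_eq_iff forall_2 axis_def)
  have Dnu: "D (nu s) = (- \<gamma>' s $ 2) *\<^sub>R p 1 + (\<gamma>' s $ 1) *\<^sub>R p 2"
    unfolding nu p_def partial_deriv_def D_def[symmetric] by (simp only: linear_add[OF lin] linear_scale[OF lin])
  then have "norm (D (nu s)) \<le> \<bar>\<gamma>' s $ 2\<bar> * norm (p 1) + \<bar>\<gamma>' s $ 1\<bar> * norm (p 2)"
    using norm_triangle_ineq[of "(- \<gamma>' s $ 2) *\<^sub>R p 1" "(\<gamma>' s $ 1) *\<^sub>R p 2"] by simp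
  also have "\<dots> \<le> norm (vec2 (\<gamma>' s $ 2) (\<gamma>' s $ 1)) * norm (vec2 (norm (p 1)) (norm (p 2)))"
    using Cauchy_Schwarz_ineq2[of "vec2 \<bar>\<gamma>' s $ 2\<bar> \<bar>\<gamma>' s $ 1\<bar>" "vec2 (norm (p 1)) (norm (p 2))"]
    by (simp add: inner_vec_def sum_2 norm_vec_def L2_set_def)
  also have "norm (vec2 (\<gamma>' s $ 2) (\<gamma>' s $ 1)) = 1"
    using unit_sq[OF in_closure[OF s]] by (simp add: norm_vec_def L2_set_def sum_2 add.commute)
  also have "norm (vec2 (norm (p 1)) (norm (p 2))) = norm (grad U ?x)"
    by (simp add: norm_vec_def L2_set_def sum_2 grad_def p_def)
  finally have "norm (D (nu s)) \<le> norm (grad U ?x)" by simp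
  then have "norm (D (\<epsilon> *\<^sub>R nu s)) \<le> \<epsilon> * norm (grad U ?x)"
    using eps by (simp add: linear_scale[OF lin])
  moreover have "D (\<epsilon> *\<^sub>R nu s) = normal_dv U s t"
    by (simp add: linear_scale[OF lin] Dnu normal_dv_def p_def)
  ultimately show "((\<lambda>t. U (L \<epsilon> (vec2 s t))) has_vector_derivative normal_dv U s t) (at t)"
    "norm (normal_dv U s t) \<le> \<epsilon> * norm (grad U (L \<epsilon> (vec2 s t)))" using d by simp_all
qed

text \<open>Fubini reduces both sides to fibres, where the fibre inequality holds with
  \<open>\<kappa> s\<close>, bounded below by \<open>m\<close>. The factor \<epsilon>^(-2) between
  \<open>pi\<^sup>2 / 4\<close> and the final constant comes from rescaling the fibre to length
  \<epsilon>.\<close>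

lemma strip_lower_bound_C1:
  fixes U :: "real^2 \<Rightarrow> complex"
  assumes U: "Ck_on 1 \<Omega> U" "continuous_on (closure \<Omega>) U" "U \<in> W12 \<Omega>"
    and ab: "a < b" "{a..b} \<subseteq> I"
    and fibre: "\<And>c. \<bar>c\<bar> \<le> K \<Longrightarrow> fibre_lower_ineq (\<epsilon> * c) (pi\<^sup>2 / 4 + \<epsilon> * c - C * \<epsilon>\<^sup>2) B"
    and m: "\<And>s. s \<in> I \<Longrightarrow> m \<le> \<kappa> s"
  defines "\<Omega>' \<equiv> L \<epsilon> ` rect {a<..<b} {0<..<1}"
  shows "((pi / (2 * \<epsilon>))\<^sup>2 + m / \<epsilon> - C) * L2_sq \<Omega>' U
    \<le> L2_sq \<Omega>' (grad U) + B / \<epsilon> * L2_sq {a..b} (\<lambda>s. U (\<gamma> s))"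
proof -
  let ?A = "{a<..<b}"
  define \<Lambda> where "\<Lambda> = pi\<^sup>2 / 4 + \<epsilon> * m - C * \<epsilon>\<^sup>2"
  have A: "open ?A" "?A \<subseteq> I" using ab by auto
  have sub: "\<Omega>' \<subseteq> \<Omega>" unfolding \<Omega>'_def \<Omega>_eq using A(2) by (intro image_mono rect_mono) auto
  have o: "open \<Omega>'" unfolding \<Omega>'_def by (rule open_L_image[OF A]) auto
  have L2: "L2_on \<Omega> U" "L2_on \<Omega> (grad U)" using U C1_grad_L2[OF open_\<Omega>] by (auto simp: W12_def)
  have cU: "continuous_on \<Omega> U" by (rule Ck_on_1_continuous[OF U(1)])
  have "continuous_on \<Omega> (\<lambda>x. \<chi> i. grad U x $ i)"
    using U(1) unfolding Ck_on_1 grad_def by (intro continuous_intros) auto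
  then have cG: "continuous_on \<Omega> (grad U)" by simp
  have iU: "integrable (lebesgue_on \<Omega>') (\<lambda>x. (norm (U x))\<^sup>2)"
    and iG: "integrable (lebesgue_on \<Omega>') (\<lambda>x. (norm (grad U x))\<^sup>2)"
    using L2 sub o open_\<Omega> unfolding L2_on_def by (auto intro: integrable_lebesgue_on_mono)
  have cU': "continuous_on \<Omega>' (\<lambda>x. (norm (U x))\<^sup>2)" and cG': "continuous_on \<Omega>' (\<lambda>x. (norm (grad U x))\<^sup>2)"
    by (intro continuous_intros continuous_on_subset[OF cU sub] continuous_on_subset[OF cG sub])+
  note FU = strip_integrable[OF A cU'[unfolded \<Omega>'_def] iU[unfolded \<Omega>'_def]]
    and FG = strip_integrable[OF A cG'[unfolded \<Omega>'_def] iG[unfolded \<Omega>'_def]]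
  define p where "p s = (\<integral>t. indicator ?A s * (indicator {0<..<1} t * (\<epsilon> * \<rho> s t * (norm (U (L \<epsilon> (vec2 s t))))\<^sup>2)) \<partial>lborel)" for s
  define q where "q s = (\<integral>t. indicator ?A s * (indicator {0<..<1} t * (\<epsilon> * \<rho> s t * (norm (grad U (L \<epsilon> (vec2 s t))))\<^sup>2)) \<partial>lborel)" for s
  define r where "r s = indicator ?A s * (norm (U (\<gamma> s)))\<^sup>2" for s
  have ip: "integrable lborel p" and iq: "integrable lborel q"
    using lborel_pair.integrable_fst'[OF FU] lborel_pair.integrable_fst'[OF FG] by (simp_all add: p_def[abs_def] q_def[abs_def])
  have P: "L2_sq \<Omega>' U = integral\<^sup>L lborel p" and Q: "L2_sq \<Omega>' (grad U) = integral\<^sup>L lborel q"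
    unfolding L2_sq_def \<Omega>'_def p_def q_def
    using strip_integral[OF A cU'[unfolded \<Omega>'_def] iU[unfolded \<Omega>'_def]]
      strip_integral[OF A cG'[unfolded \<Omega>'_def] iG[unfolded \<Omega>'_def]] by simp_all
  have cg: "continuous_on {a..b} (\<lambda>s. (norm (U (\<gamma> s)))\<^sup>2)"
  proof (intro continuous_intros continuous_on_compose2[OF U(2)])
    show "continuous_on {a..b} \<gamma>"
      using continuous_on_subset[OF continuous_gamma(1)] ab closure_subset by blast
    show "\<gamma> ` {a..b} \<subseteq> closure \<Omega>"
      using L_in_closure_\<Omega>[of _ 0] ab by (auto simp: L_zero)
  qed
  have ir: "integrable lborel r" unfolding r_def by (rule integrable_Ioo_continuous[OF cg])
  have R: "L2_sq {a..b} (\<lambda>s. U (\<gamma> s)) = integral\<^sup>L lborel r"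
  proof -
    have "((\<lambda>s. (norm (U (\<gamma> s)))\<^sup>2) has_integral integral\<^sup>L lborel r) {a..b}"
      unfolding r_def by (rule has_integral_Icc_of_lborel[OF integrable_Ioo_continuous[OF cg]])
    moreover have "L2_sq {a..b} (\<lambda>s. U (\<gamma> s)) = integral {a..b} (\<lambda>s. (norm (U (\<gamma> s)))\<^sup>2)"
      unfolding L2_sq_def by (rule lebesgue_integral_eq_integral[OF continuous_imp_integrable_real[OF cg]]) simp
    ultimately show ?thesis by (simp add: integral_unique)
  qed
  \<comment> \<open>Fubini gives finite energy only on almost every fibre, and the fibre inequality
    presupposes it.\<close>
  have ae: "AE s in lborel. \<Lambda> * p s \<le> \<epsilon>\<^sup>2 * q s + \<epsilon> * B * r s"
    using lborel_pair.AE_integrable_fst'[OF FG]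
  proof (rule AE_mp, intro AE_I2 impI)
    fix s assume "integrable lborel (\<lambda>t. case (s, t) of (s, t) \<Rightarrow>
       indicator ?A s * (indicator {0<..<1} t * (\<epsilon> * \<rho> s t * (norm (grad U (L \<epsilon> (vec2 s t))))\<^sup>2)))"
    then have int: "integrable lborel (\<lambda>t. indicator ?A s * (indicator {0<..<1} t * (\<epsilon> * \<rho> s t * (norm (grad U (L \<epsilon> (vec2 s t))))\<^sup>2)))" by simp
    show "\<Lambda> * p s \<le> \<epsilon>\<^sup>2 * q s + \<epsilon> * B * r s"
    proof (cases "s \<in> ?A")
      case False
      then show ?thesis by (simp add: p_def q_def r_def)
    next
      case sA: True
      then have s: "s \<in> I" using A by auto
      define w where "w t = U (L \<epsilon> (vec2 s t))" for t
      define G where "G t = (norm (grad U (L \<epsilon> (vec2 s t))))\<^sup>2" for t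
      define w' where "w' = normal_dv U s"
      have w': "(w has_vector_derivative w' t) (at t)" "norm (w' t) \<le> \<epsilon> * norm (grad U (L \<epsilon> (vec2 s t)))"
        if "t \<in> {0<..<1}" for t
        using normal_derivative[of U s t] norm_normal_dv_le[of U s t] U(1) L_in_\<Omega>[OF s that] s
        unfolding w_def w'_def Ck_on_1 by auto
      have cw: "continuous_on {0..1} w"
        unfolding w_def
        by (rule continuous_on_compose2[OF U(2) continuous_on_L_line[OF in_closure[OF s]]])
           (use L_in_closure_\<Omega>[OF s] in auto)
      have c\<rho>: "continuous_on T (\<rho> s)" for T unfolding \<rho>_def by (intro continuous_intros)
      have intp: "integrable lborel (\<lambda>t. indicator {0<..<1} t * (\<epsilon> * \<rho> s t * (norm (w t))\<^sup>2))"
        by (intro integrable_Ioo_continuous continuous_intros cw c\<rho>)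
      have intq: "integrable lborel (\<lambda>t. indicator {0<..<1} t * (\<epsilon> * \<rho> s t * G t))"
        using int sA by (simp add: G_def)
      have hp: "((\<lambda>t. \<epsilon> * \<rho> s t * (norm (w t))\<^sup>2) has_integral p s) {0..1}"
        using has_integral_Icc_of_lborel[OF intp] sA by (simp add: p_def w_def)
      have hq: "((\<lambda>t. \<epsilon> * \<rho> s t * G t) has_integral q s) {0..1}"
        using has_integral_Icc_of_lborel[OF intq] sA by (simp add: q_def G_def)
      have p: "integral {0..1} (\<lambda>t. \<rho> s t * (norm (w t))\<^sup>2) = p s / \<epsilon>"
        using has_integral_mult_right[OF hp, of "1 / \<epsilon>"] eps by (intro integral_unique) (simp add: algebra_simps)
      have hq': "((\<lambda>t. \<rho> s t * (\<epsilon>\<^sup>2 * G t)) has_integral \<epsilon> * q s) {0..1}"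
        using has_integral_mult_right[OF hq, of "\<epsilon>"] by (simp add: power2_eq_square algebra_simps)
      have le: "\<rho> s t * (norm (w' t))\<^sup>2 \<le> \<rho> s t * (\<epsilon>\<^sup>2 * G t)" if "t \<in> {0<..<1}" for t
      proof -
        have "(norm (w' t))\<^sup>2 \<le> (\<epsilon> * norm (grad U (L \<epsilon> (vec2 s t))))\<^sup>2" by (intro power_mono w' that) auto
        then show ?thesis using \<rho>_bounds(1)[OF s, of t] that
          by (intro mult_left_mono) (auto simp: G_def power_mult_distrib)
      qed
      \<comment> \<open>\<open>w'\<close> is continuous on the open interval but may be unbounded at
        its ends; domination by the fibre energy supplies integrability.\<close>
      have "(\<lambda>t. \<rho> s t * (norm (w' t))\<^sup>2) absolutely_integrable_on {0<..<1}"
      proof (rule measurable_bounded_by_integrable_imp_absolutely_integrable)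
        show "(\<lambda>t. \<rho> s t * (norm (w' t))\<^sup>2) \<in> borel_measurable (lebesgue_on {0<..<1})"
          unfolding w'_def
          by (intro continuous_imp_measurable_on_sets_lebesgue continuous_intros c\<rho> continuous_on_normal_dv U(1) s) simp
        show "(\<lambda>t. \<rho> s t * (\<epsilon>\<^sup>2 * G t)) integrable_on {0<..<1}"
          using hq' by (metis has_integral_Icc_iff_Ioo has_integral_integrable)
        show "norm (\<rho> s t * (norm (w' t))\<^sup>2) \<le> \<rho> s t * (\<epsilon>\<^sup>2 * G t)" if "t \<in> {0<..<1}" for t
          using le[OF that] \<rho>_bounds(1)[OF s, of t] that by simp
      qed simp
      then have iw: "(\<lambda>t. \<rho> s t * (norm (w' t))\<^sup>2) integrable_on {0..1}"
        by (simp add: integrable_on_Icc_iff_Ioo set_lebesgue_integral_eq_integral(1))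
      have "(pi\<^sup>2 / 4 + \<epsilon> * \<kappa> s - C * \<epsilon>\<^sup>2) * (p s / \<epsilon>)
        \<le> integral {0..1} (\<lambda>t. \<rho> s t * (norm (w' t))\<^sup>2) + B * (norm (w 0))\<^sup>2"
        using fibre[OF K[OF s], unfolded fibre_lower_ineq_def, rule_format, folded \<rho>_def, OF cw w'(1) iw]
        unfolding p by simp
      also have "integral {0..1} (\<lambda>t. \<rho> s t * (norm (w' t))\<^sup>2) \<le> \<epsilon> * q s"
      proof -
        have "integral {0<..<1} (\<lambda>t. \<rho> s t * (norm (w' t))\<^sup>2) \<le> integral {0<..<1} (\<lambda>t. \<rho> s t * (\<epsilon>\<^sup>2 * G t))"
          using iw hq' le by (intro integral_le) (auto simp: integrable_on_Icc_iff_Ioo[symmetric])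
        then show ?thesis using integral_unique[OF hq'] by (simp add: integral_open_interval_real)
      qed
      also have "(norm (w 0))\<^sup>2 = r s" using sA by (simp add: w_def L_zero r_def)
      finally have 1: "(pi\<^sup>2 / 4 + \<epsilon> * \<kappa> s - C * \<epsilon>\<^sup>2) * (p s / \<epsilon>) \<le> \<epsilon> * q s + B * r s" by simp
      \<comment> \<open>Nonnegativity of \<open>p s\<close> is what permits replacing
        \<open>\<kappa> s\<close> by \<open>m\<close>.\<close>
      have "p s \<ge> 0"
        using \<rho>_bounds(1)[OF s] eps by (intro has_integral_nonneg[OF hp]) (auto intro!: mult_nonneg_nonneg order_trans[OF _ \<rho>_bounds(1)[OF s]])
      then have "\<Lambda> * (p s / \<epsilon>) \<le> (pi\<^sup>2 / 4 + \<epsilon> * \<kappa> s - C * \<epsilon>\<^sup>2) * (p s / \<epsilon>)"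
        using m[OF s] eps by (intro mult_right_mono) (auto simp: \<Lambda>_def)
      with 1 have "\<Lambda> * (p s / \<epsilon>) \<le> \<epsilon> * q s + B * r s" by linarith
      from mult_left_mono[OF this, of \<epsilon>] eps show ?thesis
        by (simp add: power2_eq_square algebra_simps)
    qed
  qed
  have "\<Lambda> * L2_sq \<Omega>' U \<le> \<epsilon>\<^sup>2 * L2_sq \<Omega>' (grad U) + \<epsilon> * B * L2_sq {a..b} (\<lambda>s. U (\<gamma> s))"
  proof -
    have "(\<integral>s. \<Lambda> * p s \<partial>lborel) \<le> (\<integral>s. \<epsilon>\<^sup>2 * q s + \<epsilon> * B * r s \<partial>lborel)"
      using ae ip iq ir by (intro integral_mono_AE) auto
    then show ?thesis using ip iq ir by (simp add: P Q R)
  qed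
  then have "(\<Lambda> * L2_sq \<Omega>' U) / \<epsilon>\<^sup>2 \<le> (\<epsilon>\<^sup>2 * L2_sq \<Omega>' (grad U) + \<epsilon> * B * L2_sq {a..b} (\<lambda>s. U (\<gamma> s))) / \<epsilon>\<^sup>2"
    by (intro divide_right_mono) auto
  also have "\<dots> = L2_sq \<Omega>' (grad U) + B / \<epsilon> * L2_sq {a..b} (\<lambda>s. U (\<gamma> s))"
    using eps by (simp add: field_simps power2_eq_square)
  also have "(\<Lambda> * L2_sq \<Omega>' U) / \<epsilon>\<^sup>2 = ((pi / (2 * \<epsilon>))\<^sup>2 + m / \<epsilon> - C) * L2_sq \<Omega>' U"
  proof -
    have "\<Lambda> / \<epsilon>\<^sup>2 = (pi / (2 * \<epsilon>))\<^sup>2 + m / \<epsilon> - C"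
      using eps by (simp add: \<Lambda>_def field_simps power2_eq_square)
    then show ?thesis by (metis times_divide_eq_left)
  qed
  finally show ?thesis .
qed

end

section \<open>From C^1 functions to the form domain\<close>

lemma L2_on_subset:
  fixes f :: "'a::euclidean_space \<Rightarrow> 'b::euclidean_space"
  assumes "L2_on T f" "S \<in> sets lebesgue" "T \<in> sets lebesgue" "S \<subseteq> T"
  shows "L2_on S f"
proof -
  have "f \<in> borel_measurable (lebesgue_on S)"
    using assms(1,4) measurable_restrict_mono unfolding L2_on_def by blast
  moreover have "integrable (lebesgue_on S) (\<lambda>x. (norm (f x))\<^sup>2)"
    by (rule integrable_lebesgue_on_mono[OF _ assms(2-4)]) (use assms(1) in \<open>simp add: L2_on_def\<close>)
  ultimately show ?thesis by (simp add: L2_on_def)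
qed

lemma L2_sq_eq_indicator:
  assumes "S \<in> sets lebesgue" "T \<in> sets lebesgue" "S \<subseteq> T"
  shows "L2_sq S f = (\<integral>x. indicator S x * (norm (f x))\<^sup>2 \<partial>lebesgue_on T)"
proof -
  have "(\<integral>x. indicator S x * (norm (f x))\<^sup>2 \<partial>lebesgue_on T) = (\<integral>x. indicator S x * (norm (f x))\<^sup>2 \<partial>lebesgue_on S)"
    using assms by (intro integral_lebesgue_on_supported) auto
  also have "\<dots> = L2_sq S f"
    unfolding L2_sq_def by (intro Bochner_Integration.integral_cong) auto
  finally show ?thesis by simp
qed

lemma L2_sq_mono:
  fixes f :: "'a::euclidean_space \<Rightarrow> 'b::euclidean_space"
  assumes "L2_on T f" "S \<in> sets lebesgue" "T \<in> sets lebesgue" "S \<subseteq> T"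
  shows "L2_sq S f \<le> L2_sq T f"
  unfolding L2_sq_eq_indicator[OF assms(2-4)] unfolding L2_sq_def
proof (rule integral_mono)
  show i: "integrable (lebesgue_on T) (\<lambda>x. (norm (f x))\<^sup>2)" using assms(1) by (simp add: L2_on_def)
  have "S \<in> sets (lebesgue_on T)" using assms by (simp add: sets_restrict_space_iff)
  from integrable_mult_indicator[OF this i]
  show "integrable (lebesgue_on T) (\<lambda>x. indicator S x * (norm (f x))\<^sup>2)" by simp
qed (auto simp: indicator_def)

lemma L2_sq_nonneg: "L2_sq S f \<ge> 0"
  by (simp add: L2_sq_def)

text \<open>Weighted Young inequality; the defect is (\<tau> p - q)^2 / \<tau>. It does the work of
  continuity of the norm: the factor of \<open>g\<close> is close to 1, and the large factor
  multiplies a term that tends to 0 along approximations.\<close>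

lemma L2_sq_le_add:
  fixes f g :: "'a::euclidean_space \<Rightarrow> 'b::euclidean_space"
  assumes f: "L2_on S f" and g: "L2_on S g" and \<tau>: "\<tau> > 0"
  shows "L2_sq S f \<le> (1 + \<tau>) * L2_sq S g + (1 + 1 / \<tau>) * L2_sq S (\<lambda>x. f x - g x)"
proof -
  have fg: "L2_on S (\<lambda>x. f x - g x)" by (rule L2_on_diff[OF f g])
  have "L2_sq S f \<le> (\<integral>x. (1 + \<tau>) * (norm (g x))\<^sup>2 + (1 + 1 / \<tau>) * (norm (f x - g x))\<^sup>2 \<partial>lebesgue_on S)"
    unfolding L2_sq_def
  proof (rule integral_mono)
    show "integrable (lebesgue_on S) (\<lambda>x. (norm (f x))\<^sup>2)" using f by (simp add: L2_on_def)
    show "integrable (lebesgue_on S) (\<lambda>x. (1 + \<tau>) * (norm (g x))\<^sup>2 + (1 + 1 / \<tau>) * (norm (f x - g x))\<^sup>2)"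
      using g fg by (auto simp: L2_on_def)
    fix x
    define p q where "p = norm (g x)" and "q = norm (f x - g x)"
    have "norm (f x) \<le> p + q" using norm_triangle_ineq[of "g x" "f x - g x"] by (simp add: p_def q_def)
    then have "(norm (f x))\<^sup>2 \<le> (p + q)\<^sup>2" by (intro power_mono) auto
    also have "(p + q)\<^sup>2 \<le> (1 + \<tau>) * p\<^sup>2 + (1 + 1 / \<tau>) * q\<^sup>2"
    proof -
      have "(1 + \<tau>) * p\<^sup>2 + (1 + 1 / \<tau>) * q\<^sup>2 - (p + q)\<^sup>2 = (\<tau> * p - q)\<^sup>2 / \<tau>"
        using \<tau> by (simp add: field_simps power2_eq_square)
      moreover have "(\<tau> * p - q)\<^sup>2 / \<tau> \<ge> 0" using \<tau> by simp
      ultimately show ?thesis by linarith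
    qed
    finally show "(norm (f x))\<^sup>2 \<le> (1 + \<tau>) * (norm (g x))\<^sup>2 + (1 + 1 / \<tau>) * (norm (f x - g x))\<^sup>2"
      by (simp add: p_def q_def)
  qed
  also have "\<dots> = (1 + \<tau>) * L2_sq S g + (1 + 1 / \<tau>) * L2_sq S (\<lambda>x. f x - g x)"
    using g fg by (simp add: L2_on_def L2_sq_def)
  finally show ?thesis .
qed

lemma L2_sq_minus_commute:
  fixes f g :: "'a::euclidean_space \<Rightarrow> 'b::real_normed_vector"
  shows "L2_sq S (\<lambda>x. f x - g x) = L2_sq S (\<lambda>x. g x - f x)"
  by (simp add: L2_sq_def norm_minus_commute)

text \<open>The hulls of the first n rationals of the interval treat bounded and unbounded intervals
  uniformly.\<close>

lemma open_interval_exhaustion: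
  fixes I :: "real set"
  assumes "open I" "is_interval I" "I \<noteq> {}"
  obtains a b :: "nat \<Rightarrow> real" where "\<And>n. a n < b n" "\<And>n. {a n..b n} \<subseteq> I"
    "\<And>s. s \<in> I \<Longrightarrow> \<forall>\<^sub>F n in sequentially. s \<in> {a n<..<b n}"
proof -
  have nb: "\<exists>q q'. q \<in> I \<and> q' \<in> I \<and> q < s \<and> s < q' \<and> q \<in> \<rat> \<and> q' \<in> \<rat>" if s: "s \<in> I" for s
  proof -
    obtain e where e: "e > 0" "ball s e \<subseteq> I" using assms(1) s open_contains_ball by blast
    obtain q where "q \<in> \<rat>" "s - e < q" "q < s" using Rats_dense_in_real[of "s - e" s] e by auto
    moreover obtain q' where "q' \<in> \<rat>" "s < q'" "q' < s + e" using Rats_dense_in_real[of s "s + e"] e by auto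
    ultimately show ?thesis using e(2) by (intro exI[of _ q] exI[of _ q']) (auto simp: dist_real_def)
  qed
  obtain r :: "nat \<Rightarrow> real" where r: "range r = \<rat>"
    using countable_rat range_from_nat_into by (metis Rats_0 empty_iff)
  obtain s0 where "s0 \<in> I" using assms(3) by blast
  from nb[OF this] obtain q q' where q: "q \<in> I" "q' \<in> I" "q < q'" by (metis less_trans)
  \<comment> \<open>The two fixed points make every hull nondegenerate, even when none of the first
    n rationals lies in \<open>I\<close>.\<close>
  define F where "F n = {q, q'} \<union> (r ` {..n} \<inter> I)" for n
  have F: "finite (F n)" "F n \<noteq> {}" "F n \<subseteq> I" for n using q by (auto simp: F_def)
  show ?thesis
  proof (rule that[of "\<lambda>n. Min (F n)" "\<lambda>n. Max (F n)"])
    show "Min (F n) < Max (F n)" for n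
    proof -
      have "Min (F n) \<le> q" by (rule Min_le[OF F(1)]) (simp add: F_def)
      moreover have "q' \<le> Max (F n)" by (rule Max_ge[OF F(1)]) (simp add: F_def)
      ultimately
      show ?thesis using q by linarith
    qed
    show "{Min (F n)..Max (F n)} \<subseteq> I" for n
    proof
      fix x assume "x \<in> {Min (F n)..Max (F n)}"
      moreover have "Min (F n) \<in> I" "Max (F n) \<in> I" using F[of n] by (auto simp: subset_eq)
      ultimately show "x \<in> I" using mem_is_interval_1_I[OF assms(2), of "Min (F n)" "Max (F n)" x] by auto
    qed
    fix s assume "s \<in> I"
    from nb[OF this] obtain p p' where p: "p \<in> I" "p' \<in> I" "p < s" "s < p'" "p \<in> \<rat>" "p' \<in> \<rat>" by blast
    then obtain i i' where i: "p = r i" "p' = r i'" using r by (metis imageE)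
    have "s \<in> {Min (F n)<..<Max (F n)}" if "n \<ge> max i i'" for n
    proof -
      have "p \<in> F n" "p' \<in> F n" using p i that by (auto simp: F_def)
      then have "Min (F n) \<le> p" "p' \<le> Max (F n)" using F by auto
      then show ?thesis using p by auto
    qed
    then show "\<forall>\<^sub>F n in sequentially. s \<in> {Min (F n)<..<Max (F n)}"
      by (rule eventually_sequentiallyI)
  qed
qed

context curved_strip
begin

definition N :: "(real^2) set" where
  "N = strip_map \<gamma> \<gamma>' \<epsilon> ` (I \<times> {1})"

text \<open>Order of limits at fixed \<epsilon>: for fixed \<tau> the approximants remove the
  boundary term and the approximation errors, after which \<tau> tends to 0. The boundary term
  vanishes however large \<open>B\<close> is.\<close>

lemma strip_lower_bound_local:
  assumes u: "u \<in> DN_form_domain \<Omega> N" and ab: "a < b" "{a..b} \<subseteq> I"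
    and \<Lambda>: "\<Lambda> \<ge> 0"
    and C1: "\<And>U. \<lbrakk>Ck_on 1 \<Omega> U; continuous_on (closure \<Omega>) U; U \<in> W12 \<Omega>\<rbrakk> \<Longrightarrow>
      \<Lambda> * L2_sq (L \<epsilon> ` rect {a<..<b} {0<..<1}) U
      \<le> L2_sq (L \<epsilon> ` rect {a<..<b} {0<..<1}) (grad U) + B * L2_sq {a..b} (\<lambda>s. U (\<gamma> s))"
  shows "\<Lambda> * L2_sq (L \<epsilon> ` rect {a<..<b} {0<..<1}) u \<le> dirichlet_energy \<Omega> u"
proof -
  define \<Omega>' where "\<Omega>' = L \<epsilon> ` rect {a<..<b} {0<..<1}"
  have A: "open {a<..<b}" "{a<..<b} \<subseteq> I" using ab by auto
  have sub: "\<Omega>' \<subseteq> \<Omega>" unfolding \<Omega>'_def \<Omega>_eq using A(2) by (intro image_mono rect_mono) auto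
  have "open \<Omega>'" unfolding \<Omega>'_def by (rule open_L_image[OF A]) auto
  then have sets: "\<Omega>' \<in> sets lebesgue" "\<Omega> \<in> sets lebesgue" using open_\<Omega> by auto
  have uW: "u \<in> W12 \<Omega>" and tz: "trace_zero_on \<Omega> (frontier \<Omega> - N) u"
    using u by (auto simp: DN_form_domain_def)
  have "\<gamma> ` {a..b} \<subseteq> frontier \<Omega> - N"
    using gamma_in_dirichlet_boundary ab by (auto simp: N_def)
  then have "has_trace_along \<Omega> u \<gamma> a b (\<lambda>_. 0)"
    using tz gamma_arc[OF ab] unfolding trace_zero_on_def by blast
  then obtain U where U: "\<And>n. U n \<in> W12 \<Omega>" "\<And>n. Ck_on 1 \<Omega> (U n)" "\<And>n. continuous_on (closure \<Omega>) (U n)"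
    and lim: "(\<lambda>n. L2_sq \<Omega> (\<lambda>x. U n x - u x) + dirichlet_energy \<Omega> (\<lambda>x. U n x - u x)) \<longlonglongrightarrow> 0"
    and limt: "(\<lambda>n. L2_sq {a..b} (\<lambda>\<tau>. U n (\<gamma> \<tau>))) \<longlonglongrightarrow> 0"
    unfolding has_trace_along_def by auto
  obtain G0 where G0: "L2_on \<Omega> G0" "is_weak_gradient \<Omega> u G0" and uL: "L2_on \<Omega> u"
    using uW by (auto simp: W12_def)
  define G where "G = weak_gradient \<Omega> u"
  have G: "L2_on \<Omega> G" "is_weak_gradient \<Omega> u G" unfolding G_def by (rule weak_gradient_spec[OF G0])+
  have UL: "L2_on \<Omega> (U n)" for n using U(1) by (auto simp: W12_def)
  have gL: "L2_on \<Omega> (grad (U n))" for n by (rule C1_grad_L2[OF open_\<Omega> U(2,1)])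
  define e where "e n = L2_sq \<Omega> (\<lambda>x. U n x - u x)" for n
  define f where "f n = L2_sq \<Omega> (\<lambda>x. grad (U n) x - G x)" for n
  define t where "t n = L2_sq {a..b} (\<lambda>\<tau>. U n (\<gamma> \<tau>))" for n
  \<comment> \<open>The energy of the difference is computed from its explicit weak gradient, so
    convergence of energies means convergence of gradients in L^2.\<close>
  have "dirichlet_energy \<Omega> (\<lambda>x. U n x - u x) = f n" for n
    unfolding f_def
    by (intro dirichlet_energy_eq open_\<Omega> L2_on_diff gL G is_weak_gradient_diff UL uL is_weak_gradient_grad U(2))
  then have ef: "(\<lambda>n. e n + f n) \<longlonglongrightarrow> 0" using lim by (simp add: e_def)
  have e0: "e n \<ge> 0" and f0: "f n \<ge> 0" for n by (simp_all add: e_def f_def L2_sq_nonneg)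
  have le: "e \<longlonglongrightarrow> 0"
    by (rule tendsto_sandwich[OF _ _ tendsto_const ef]) (use e0 f0 in auto)
  have lf: "f \<longlonglongrightarrow> 0"
    by (rule tendsto_sandwich[OF _ _ tendsto_const ef]) (use e0 f0 in auto)
  have lt: "t \<longlonglongrightarrow> 0" using limt by (simp add: t_def[abs_def])
  define E where "E = L2_sq \<Omega> G"
  have step: "\<Lambda> * L2_sq \<Omega>' u \<le> (1 + \<tau>) * ((1 + \<tau>) * E)" if \<tau>: "\<tau> > 0" for \<tau>
  proof -
    have "\<Lambda> * L2_sq \<Omega>' u \<le> (1 + \<tau>) * (((1 + \<tau>) * E + (1 + 1 / \<tau>) * f n) + B * t n) + (1 + 1 / \<tau>) * (\<Lambda> * e n)" for n
    proof -
      have "L2_sq \<Omega>' u \<le> (1 + \<tau>) * L2_sq \<Omega>' (U n) + (1 + 1 / \<tau>) * L2_sq \<Omega>' (\<lambda>x. u x - U n x)"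
        by (intro L2_sq_le_add \<tau> L2_on_subset[OF uL sets sub] L2_on_subset[OF UL sets sub])
      moreover have "L2_sq \<Omega>' (\<lambda>x. u x - U n x) \<le> e n"
        unfolding e_def L2_sq_minus_commute[of _ u] by (intro L2_sq_mono L2_on_diff UL uL sets sub)
      then have "(1 + 1 / \<tau>) * L2_sq \<Omega>' (\<lambda>x. u x - U n x) \<le> (1 + 1 / \<tau>) * e n"
        using \<tau> by (intro mult_left_mono) auto
      ultimately have "L2_sq \<Omega>' u \<le> (1 + \<tau>) * L2_sq \<Omega>' (U n) + (1 + 1 / \<tau>) * e n" by linarith
      from mult_left_mono[OF this \<Lambda>]
      have 1: "\<Lambda> * L2_sq \<Omega>' u \<le> (1 + \<tau>) * (\<Lambda> * L2_sq \<Omega>' (U n)) + (1 + 1 / \<tau>) * (\<Lambda> * e n)"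
        by (simp add: algebra_simps)
      have 2: "\<Lambda> * L2_sq \<Omega>' (U n) \<le> L2_sq \<Omega>' (grad (U n)) + B * t n"
        using C1[OF U(2,3,1)] by (simp add: \<Omega>'_def t_def)
      have "L2_sq \<Omega>' (grad (U n)) \<le> L2_sq \<Omega> (grad (U n))" by (intro L2_sq_mono gL sets sub)
      also have "\<dots> \<le> (1 + \<tau>) * E + (1 + 1 / \<tau>) * f n"
        unfolding E_def f_def by (intro L2_sq_le_add \<tau> gL G)
      finally have "\<Lambda> * L2_sq \<Omega>' (U n) \<le> ((1 + \<tau>) * E + (1 + 1 / \<tau>) * f n) + B * t n" using 2 by linarith
      from mult_left_mono[OF this, of "1 + \<tau>"] \<tau> 1 show ?thesis by linarith
    qed
    moreover have "(\<lambda>n. (1 + \<tau>) * (((1 + \<tau>) * E + (1 + 1 / \<tau>) * f n) + B * t n) + (1 + 1 / \<tau>) * (\<Lambda> * e n))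
      \<longlonglongrightarrow> (1 + \<tau>) * (((1 + \<tau>) * E + (1 + 1 / \<tau>) * 0) + B * 0) + (1 + 1 / \<tau>) * (\<Lambda> * 0)"
      by (intro tendsto_intros le lf lt)
    ultimately show ?thesis using LIMSEQ_le_const by fastforce
  qed
  have "((\<lambda>\<tau>. (1 + \<tau>) * ((1 + \<tau>) * E)) \<longlongrightarrow> (1 + 0) * ((1 + 0) * E)) (at_right 0)"
    by (intro tendsto_intros)
  moreover have "\<forall>\<^sub>F \<tau> in at_right 0. \<Lambda> * L2_sq \<Omega>' u \<le> (1 + \<tau>) * ((1 + \<tau>) * E)"
    using step by (auto simp: eventually_at_right_field intro!: exI[of _ 1])
  ultimately have "\<Lambda> * L2_sq \<Omega>' u \<le> (1 + 0) * ((1 + 0) * E)"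
    by (intro tendsto_lowerbound) auto
  then show ?thesis by (simp add: E_def G_def dirichlet_energy_def \<Omega>'_def)
qed

text \<open>Traces are tested on compact arcs only, so the whole strip is reached by dominated
  convergence along an exhausting sequence of subintervals.\<close>

lemma strip_lower_bound:
  assumes u: "u \<in> DN_form_domain \<Omega> N"
    and loc: "\<And>a b. a < b \<Longrightarrow> {a..b} \<subseteq> I \<Longrightarrow>
      \<Lambda> * L2_sq (L \<epsilon> ` rect {a<..<b} {0<..<1}) u \<le> dirichlet_energy \<Omega> u"
  shows "\<Lambda> * L2_sq \<Omega> u \<le> dirichlet_energy \<Omega> u"
proof -
  obtain a b where ab: "\<And>n. a n < b n" "\<And>n. {a n..b n} \<subseteq> I"
    "\<And>s. s \<in> I \<Longrightarrow> \<forall>\<^sub>F n in sequentially. s \<in> {a n<..<b n}"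
    using open_interval_exhaustion[OF open_I interval_I nonempty_I] by blast
  define W where "W n = L \<epsilon> ` rect {a n<..<b n} {0<..<1}" for n
  have A: "{a n<..<b n} \<subseteq> I" for n using ab(2)[of n] by auto
  have sub: "W n \<subseteq> \<Omega>" for n unfolding W_def \<Omega>_eq using A by (intro image_mono rect_mono) auto
  have "open (W n)" for n unfolding W_def by (rule open_L_image[OF _ A]) auto
  then have sets: "W n \<in> sets lebesgue" "\<Omega> \<in> sets lebesgue" for n using open_\<Omega> by auto
  have iu: "integrable (lebesgue_on \<Omega>) (\<lambda>x. (norm (u x))\<^sup>2)"
    using u by (auto simp: DN_form_domain_def W12_def L2_on_def)
  have Ws: "W n \<in> sets (lebesgue_on \<Omega>)" for n using sets sub by (simp add: sets_restrict_space_iff)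
  have "(\<lambda>n. L2_sq (W n) u) \<longlonglongrightarrow> L2_sq \<Omega> u"
    unfolding L2_sq_eq_indicator[OF sets sub] unfolding L2_sq_def
  proof (rule integral_dominated_convergence[OF _ _ iu])
    show "(\<lambda>x. indicator (W n) x * (norm (u x))\<^sup>2) \<in> borel_measurable (lebesgue_on \<Omega>)" for n
      using integrable_mult_indicator[OF Ws iu] by auto
    show "AE x in lebesgue_on \<Omega>. (\<lambda>n. indicator (W n) x * (norm (u x))\<^sup>2) \<longlonglongrightarrow> (norm (u x))\<^sup>2"
    proof (rule AE_I2)
      fix x assume "x \<in> space (lebesgue_on \<Omega>)"
      then obtain y where y: "y \<in> rect I {0<..<1}" "x = L \<epsilon> y" by (auto simp: \<Omega>_eq)
      then have "\<forall>\<^sub>F n in sequentially. y $ 1 \<in> {a n<..<b n}" by (intro ab) (auto simp: rect_def)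
      then have "\<forall>\<^sub>F n in sequentially. (norm (u x))\<^sup>2 = indicator (W n) x * (norm (u x))\<^sup>2"
      proof (rule eventually_mono)
        fix n assume "y $ 1 \<in> {a n<..<b n}"
        then have "x \<in> W n" using y by (auto simp: W_def rect_def)
        then show "(norm (u x))\<^sup>2 = indicator (W n) x * (norm (u x))\<^sup>2" by simp
      qed
      then show "(\<lambda>n. indicator (W n) x * (norm (u x))\<^sup>2) \<longlonglongrightarrow> (norm (u x))\<^sup>2"
        by (rule Lim_transform_eventually[OF tendsto_const])
    qed
  qed (use iu in \<open>auto simp: indicator_def\<close>)
  then have "(\<lambda>n. \<Lambda> * L2_sq (W n) u) \<longlonglongrightarrow> \<Lambda> * L2_sq \<Omega> u" by (intro tendsto_intros)
  moreover have "\<Lambda> * L2_sq (W n) u \<le> dirichlet_energy \<Omega> u" for n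
    unfolding W_def by (rule loc[OF ab(1,2)])
  ultimately show ?thesis using LIMSEQ_le_const2 by blast
qed

end

section \<open>Rayleigh quotients and minimax numbers\<close>

lemma L2_sq_pos:
  fixes u :: "'a::euclidean_space \<Rightarrow> 'b::euclidean_space"
  assumes "L2_on S u" "\<not> (AE x in lebesgue_on S. u x = 0)"
  shows "L2_sq S u > 0"
proof -
  have "L2_sq S u \<noteq> 0"
  proof
    assume "L2_sq S u = 0"
    then have "AE x in lebesgue_on S. (norm (u x))\<^sup>2 = 0"
      using assms(1) unfolding L2_sq_def L2_on_def
      by (subst (asm) integral_nonneg_eq_0_iff_AE) auto
    then show False using assms(2) by simp
  qed
  then show ?thesis using L2_sq_nonneg[of S u] by linarith
qed

text \<open>A supremum over the empty set would be minus infinity, so every competing subspace must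
  be shown to contain a vector that is not null; this is where \<open>j \<ge> 1\<close>
  enters.\<close>

lemma minimax_number_ge:
  assumes j: "j \<ge> 1" and Q: "\<And>\<psi>. \<psi> \<in> D \<Longrightarrow> \<not> (AE x in M. \<psi> x = 0) \<Longrightarrow> \<Lambda> \<le> Q \<psi> / (\<integral>x. (norm (\<psi> x))\<^sup>2 \<partial>M)"
  shows "ereal \<Lambda> \<le> minimax_number M D Q j"
  unfolding minimax_number_def
proof (rule INF_greatest, clarify)
  fix V assume V: "V \<subseteq> D" "subspace_of_dim M j V"
  then obtain b :: "nat \<Rightarrow> 'a \<Rightarrow> complex" where b: "V = {(\<lambda>x. \<Sum>i<j. c i * b i x) | c. True}"
    "\<And>c. (AE x in M. (\<Sum>i<j. c i * b i x) = 0) \<Longrightarrow> (\<forall>i<j. c i = 0)"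
    unfolding subspace_of_dim_def by blast
  \<comment> \<open>These coefficients select the basis vector \<open>b 0\<close>.\<close>
  let ?c = "\<lambda>i::nat. if i = 0 then 1 else 0 :: complex"
  let ?\<psi> = "\<lambda>x. \<Sum>i<j. ?c i * b i x"
  have \<psi>: "?\<psi> \<in> V" unfolding b(1) by (intro CollectI exI[of _ ?c]) simp
  have nz: "\<not> (AE x in M. ?\<psi> x = 0)"
  proof
    assume "AE x in M. ?\<psi> x = 0"
    from b(2)[OF this, rule_format, of 0] j show False by simp
  qed
  show "ereal \<Lambda> \<le> (SUP \<psi>\<in>{\<psi> \<in> V. \<not> (AE x in M. \<psi> x = 0)}. ereal (Q \<psi> / (\<integral>x. (norm (\<psi> x))\<^sup>2 \<partial>M)))"
  proof (rule SUP_upper2)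
    show "?\<psi> \<in> {\<psi> \<in> V. \<not> (AE x in M. \<psi> x = 0)}" using \<psi> nz by blast
    show "ereal \<Lambda> \<le> ereal (Q ?\<psi> / (\<integral>x. (norm (?\<psi> x))\<^sup>2 \<partial>M))"
      unfolding ereal_less_eq by (rule Q[OF subsetD[OF V(1) \<psi>] nz])
  qed
qed

lemma minimax_number_le:
  assumes V: "V \<subseteq> D" "subspace_of_dim M j V"
    and Q: "\<And>\<psi>. \<psi> \<in> V \<Longrightarrow> \<not> (AE x in M. \<psi> x = 0) \<Longrightarrow> Q \<psi> / (\<integral>x. (norm (\<psi> x))\<^sup>2 \<partial>M) \<le> \<Lambda>"
  shows "minimax_number M D Q j \<le> ereal \<Lambda>"
  unfolding minimax_number_def
  by (rule INF_lower2[of V]) (use V Q in \<open>auto intro!: SUP_least\<close>)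

section \<open>Trial functions\<close>

text \<open>At most one summand is nonzero, so no cross terms arise.\<close>

lemma norm_sum_disjoint_sq:
  fixes x :: "nat \<Rightarrow> 'a::real_normed_vector"
  assumes "\<And>i k. i < j \<Longrightarrow> k < j \<Longrightarrow> i \<noteq> k \<Longrightarrow> x i = 0 \<or> x k = 0"
  shows "(norm (\<Sum>i<j. x i))\<^sup>2 = (\<Sum>i<j. (norm (x i))\<^sup>2)"
proof (cases "\<exists>k<j. x k \<noteq> 0")
  case True
  then obtain k where k: "k < j" "x k \<noteq> 0" by blast
  have z: "x i = 0" if "i \<in> {..<j} - {k}" for i using assms[of i k] k that by auto
  have "(\<Sum>i<j. x i) = x k" using k z by (subst sum.remove[of _ k]) auto
  moreover have "(\<Sum>i<j. (norm (x i))\<^sup>2) = (norm (x k))\<^sup>2" using k z by (subst sum.remove[of _ k]) auto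
  ultimately show ?thesis by simp
qed auto

definition bump :: "real \<Rightarrow> real \<Rightarrow> real \<Rightarrow> real" where
  "bump p q s = flat 0 (s - p) * flat 0 (q - s)"

definition bump' :: "real \<Rightarrow> real \<Rightarrow> real \<Rightarrow> real" where
  "bump' p q s = flat 2 (s - p) * flat 0 (q - s) - flat 0 (s - p) * flat 2 (q - s)"

lemma bump_deriv: "(bump p q has_real_derivative bump' p q s) (at s)"
proof -
  have d: "(flat 0 has_real_derivative flat 2 x) (at x)" for x
    using flat_deriv[of 0 x] by (simp add: numeral_2_eq_2)
  have 1: "((\<lambda>s. flat 0 (s - p)) has_real_derivative flat 2 (s - p) * 1) (at s)"
    by (rule DERIV_chain2[OF d]) (auto intro!: derivative_eq_intros)
  have 2: "((\<lambda>s. flat 0 (q - s)) has_real_derivative flat 2 (q - s) * (- 1)) (at s)"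
    by (rule DERIV_chain2[OF d]) (auto intro!: derivative_eq_intros)
  show ?thesis unfolding bump_def bump'_def
    by (rule DERIV_cong[OF DERIV_mult[OF 1 2]]) simp
qed

lemma continuous_bump: "continuous_on S (bump p q)"
  using bump_deriv by (auto intro!: continuous_at_imp_continuous_on DERIV_isCont)

lemma continuous_bump': "continuous_on S (bump' p q)"
proof -
  have f: "continuous_on UNIV (flat n)" for n using smooth_upto_flat[of 0] by simp
  have "continuous_on S (\<lambda>s. flat n (s - p))" "continuous_on S (\<lambda>s. flat n (q - s))" for n
    by (rule continuous_on_compose2[OF f]; intro continuous_intros subset_UNIV)+
  then show ?thesis unfolding bump'_def by (intro continuous_intros)
qed

lemma bump_outside: "s \<notin> {p<..<q} \<Longrightarrow> bump p q s = 0" "s \<notin> {p<..<q} \<Longrightarrow> bump' p q s = 0"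
  by (auto simp: bump_def bump'_def flat_def)

lemma bump_pos: "s \<in> {p<..<q} \<Longrightarrow> bump p q s > 0"
  by (simp add: bump_def flat_def)

text \<open>Bumps on disjoint cells of equal length. Disjointness diagonalises both quadratic
  integrals, and the sample points \<open>\<sigma>\<close> later detect each coefficient
  separately.\<close>

lemma bump_family:
  fixes p q :: real and j :: nat
  assumes pq: "p < q"
  obtains \<Psi> \<Psi>' :: "nat \<Rightarrow> real \<Rightarrow> real" and \<sigma> :: "nat \<Rightarrow> real" and C :: real where "C \<ge> 0"
    "\<And>i s. (\<Psi> i has_real_derivative \<Psi>' i s) (at s)" "\<And>i. continuous_on UNIV (\<Psi>' i)"
    "\<And>i s. i < j \<Longrightarrow> s \<notin> {p..q} \<Longrightarrow> \<Psi> i s = 0" "\<And>i s. i < j \<Longrightarrow> s \<notin> {p..q} \<Longrightarrow> \<Psi>' i s = 0"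
    "\<And>i. i < j \<Longrightarrow> \<sigma> i \<in> {p..q}" "\<And>i. i < j \<Longrightarrow> \<Psi> i (\<sigma> i) > 0"
    "\<And>i k. i < j \<Longrightarrow> k < j \<Longrightarrow> i \<noteq> k \<Longrightarrow> \<Psi> k (\<sigma> i) = 0"
    "\<And>c :: nat \<Rightarrow> complex. (\<integral>s. (norm (\<Sum>i<j. c i * of_real (\<Psi>' i s)))\<^sup>2 \<partial>lborel) \<le>
        C * (\<integral>s. (norm (\<Sum>i<j. c i * of_real (\<Psi> i s)))\<^sup>2 \<partial>lborel)"
proof -
  \<comment> \<open>Adding 1 keeps the cell length positive and well defined also for j = 0;
    \<open>j\<close> cells of this length still fit into the interval.\<close>
  define d where "d = (q - p) / (real j + 1)"
  have d: "d > 0" using pq by (simp add: d_def)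
  define lo where "lo i = p + d * real i" for i
  define \<Psi> where "\<Psi> i = bump (lo i) (lo (Suc i))" for i
  define \<Psi>' where "\<Psi>' i = bump' (lo i) (lo (Suc i))" for i
  define \<sigma> where "\<sigma> i = lo i + d / 2" for i
  have lo_mono: "lo i \<le> lo k" if "i \<le> k" for i k using that d by (simp add: lo_def)
  have lo0: "lo 0 = p" by (simp add: lo_def)
  have loj: "lo j \<le> q"
  proof -
    have "d * real j \<le> d * (real j + 1)" using d by simp
    also have "\<dots> = q - p" by (simp add: d_def)
    finally show ?thesis by (simp add: lo_def)
  qed
  have sub: "{lo i<..<lo (Suc i)} \<subseteq> {p..q}" if "i < j" for i
    using lo_mono[of 0 i] lo_mono[of "Suc i" j] that lo0 loj by auto
  have disj: "s \<notin> {lo k<..<lo (Suc k)}" if "s \<in> {lo i<..<lo (Suc i)}" "i \<noteq> k" for i k s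
    using lo_mono[of "Suc i" k] lo_mono[of "Suc k" i] that by (cases "i < k") auto
  have \<sigma>: "\<sigma> i \<in> {lo i<..<lo (Suc i)}" for i using d by (simp add: \<sigma>_def lo_def algebra_simps)
  have ci: "integrable lborel (\<lambda>s. (\<Psi> i s)\<^sup>2)" "integrable lborel (\<lambda>s. (\<Psi>' i s)\<^sup>2)" for i
    unfolding \<Psi>_def \<Psi>'_def
    by (rule integrable_lborel_compact_support[of "{lo i..lo (Suc i)}"];
        auto intro!: continuous_intros continuous_bump continuous_bump' simp: bump_outside)+
  define I1 where "I1 i = (\<integral>s. (\<Psi> i s)\<^sup>2 \<partial>lborel)" for i
  define I2 where "I2 i = (\<integral>s. (\<Psi>' i s)\<^sup>2 \<partial>lborel)" for i
  have I1: "I1 i > 0" for i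
  proof -
    have "I1 i \<noteq> 0"
    proof
      assume "I1 i = 0"
      then have "AE s in lborel. (\<Psi> i s)\<^sup>2 = 0"
        using integral_nonneg_eq_0_iff_AE[OF ci(1)[of i]] by (simp add: I1_def)
      then have "AE s in lborel. s \<notin> {lo i<..<lo (Suc i)}"
        by eventually_elim (use bump_pos in \<open>fastforce simp: \<Psi>_def\<close>)
      then have "{lo i<..<lo (Suc i)} \<in> null_sets lborel"
        by (subst AE_iff_null_sets) simp_all
      then have "emeasure lborel {lo i<..<lo (Suc i)} = 0" by (rule null_setsD1)
      then show False using \<sigma>[of i] by (simp add: emeasure_lborel_Ioo)
    qed
    moreover have "I1 i \<ge> 0" by (simp add: I1_def)
    ultimately show ?thesis by simp
  qed
  have I2: "I2 i \<ge> 0" for i by (simp add: I2_def)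
  \<comment> \<open>The sum dominates every single quotient, and unlike a maximum it makes sense for
    j = 0.\<close>
  define C where "C = (\<Sum>i<j. I2 i / I1 i)"
  have C0: "C \<ge> 0" unfolding C_def using I1 I2 by (intro sum_nonneg divide_nonneg_pos) auto
  have I2_le: "I2 i \<le> C * I1 i" if "i < j" for i
  proof -
    have "I2 i / I1 i \<le> C" unfolding C_def using that I1 I2
      by (intro member_le_sum divide_nonneg_pos) auto
    then show ?thesis using I1[of i] by (simp add: divide_le_eq)
  qed
  \<comment> \<open>Disjoint supports make the integral diagonal in the coefficients; a generic
    \<open>g\<close> serves both the bumps and their derivatives.\<close>
  have sq: "(\<integral>s. (norm (\<Sum>i<j. c i * of_real (g i s)))\<^sup>2 \<partial>lborel) = (\<Sum>i<j. (norm (c i))\<^sup>2 * (\<integral>s. (g i s)\<^sup>2 \<partial>lborel))"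
    if g0: "\<And>i s. s \<notin> {lo i<..<lo (Suc i)} \<Longrightarrow> g i s = 0" and gi: "\<And>i. integrable lborel (\<lambda>s. (g i s)\<^sup>2)"
    for g :: "nat \<Rightarrow> real \<Rightarrow> real" and c :: "nat \<Rightarrow> complex"
  proof -
    have "(norm (\<Sum>i<j. c i * of_real (g i s)))\<^sup>2 = (\<Sum>i<j. (norm (c i))\<^sup>2 * (g i s)\<^sup>2)" for s
    proof -
      have "(norm (\<Sum>i<j. c i * of_real (g i s)))\<^sup>2 = (\<Sum>i<j. (norm (c i * of_real (g i s)))\<^sup>2)"
      proof (rule norm_sum_disjoint_sq)
        fix i k :: nat assume "i \<noteq> k"
        then show "c i * of_real (g i s) = 0 \<or> c k * of_real (g k s) = 0"
          using disj[of s i k] g0[of s i] g0[of s k] by auto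
      qed
      then show ?thesis by (simp add: norm_mult power_mult_distrib)
    qed
    then show ?thesis using gi by simp
  qed
  show ?thesis
  proof (rule that[of C \<Psi> \<Psi>' \<sigma>])
    show "C \<ge> 0" by (rule C0)
    show "(\<Psi> i has_real_derivative \<Psi>' i s) (at s)" for i s unfolding \<Psi>_def \<Psi>'_def by (rule bump_deriv)
    show "continuous_on UNIV (\<Psi>' i)" for i unfolding \<Psi>'_def by (rule continuous_bump')
    show "\<Psi> i s = 0" "\<Psi>' i s = 0" if "i < j" "s \<notin> {p..q}" for i s
    proof -
      have s: "s \<notin> {lo i<..<lo (Suc i)}" using sub[OF that(1)] that(2) by blast
      show "\<Psi> i s = 0" unfolding \<Psi>_def by (rule bump_outside(1)[OF s])
      show "\<Psi>' i s = 0" unfolding \<Psi>'_def by (rule bump_outside(2)[OF s])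
    qed
    show "\<sigma> i \<in> {p..q}" if "i < j" for i using \<sigma>[of i] sub[OF that] by blast
    show "\<Psi> i (\<sigma> i) > 0" for i unfolding \<Psi>_def by (rule bump_pos[OF \<sigma>])
    show "\<Psi> k (\<sigma> i) = 0" if "i \<noteq> k" for i k
      unfolding \<Psi>_def by (rule bump_outside(1)[OF disj[OF \<sigma> that]])
    fix c :: "nat \<Rightarrow> complex"
    have "(\<integral>s. (norm (\<Sum>i<j. c i * of_real (\<Psi>' i s)))\<^sup>2 \<partial>lborel) = (\<Sum>i<j. (norm (c i))\<^sup>2 * I2 i)"
      unfolding I2_def by (rule sq) (use ci in \<open>simp_all add: \<Psi>'_def bump_outside\<close>)
    also have "\<dots> \<le> (\<Sum>i<j. (norm (c i))\<^sup>2 * (C * I1 i))"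
      by (intro sum_mono mult_left_mono I2_le) auto
    also have "\<dots> = C * (\<Sum>i<j. (norm (c i))\<^sup>2 * I1 i)" by (simp add: sum_distrib_left algebra_simps)
    also have "(\<Sum>i<j. (norm (c i))\<^sup>2 * I1 i) = (\<integral>s. (norm (\<Sum>i<j. c i * of_real (\<Psi> i s)))\<^sup>2 \<partial>lborel)"
      unfolding I1_def by (rule sq[symmetric]) (use ci in \<open>simp_all add: \<Psi>_def bump_outside\<close>)
    finally show "(\<integral>s. (norm (\<Sum>i<j. c i * of_real (\<Psi>' i s)))\<^sup>2 \<partial>lborel) \<le>
        C * (\<integral>s. (norm (\<Sum>i<j. c i * of_real (\<Psi> i s)))\<^sup>2 \<partial>lborel)" .
  qed
qed

text \<open>Trial functions live on the strip of double width; by the symmetry \<open>chi \<delta> (2 - t) = chi \<delta> t\<close> they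
  vanish near both of its long edges, hence extend by zero to \<open>C\<^sup>1\<close> functions on the plane, even if
  remote parts of an unbounded curve accumulate at \<open>\<gamma>\<close>.\<close>

locale trial_strip = curved_strip +
  fixes \<delta> :: real
  assumes epsK4: "\<epsilon> * K \<le> 1 / 4" and inj2: "inj_on (L \<epsilon>) (rect I {0<..<2})"
    and \<delta>: "0 < \<delta>" "\<delta> \<le> 1 / 4"
begin

abbreviation "R \<equiv> rect I {0<..<2}"
definition "W = L \<epsilon> ` R"
definition "M = inv_into R (L \<epsilon>)"

lemma open_R: "open R" by (rule open_rect[OF open_I]) simp

lemma R_fst: "x \<in> R \<Longrightarrow> x $ 1 \<in> I" by (simp add: rect_def)

lemma continuous_on_L_R: "continuous_on R (L \<epsilon>)"
  by (rule continuous_on_subset[OF continuous_on_L[of UNIV]]) (use in_closure in \<open>auto simp: rect_def\<close>)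

lemma M_L: "x \<in> R \<Longrightarrow> M (L \<epsilon> x) = x"
  unfolding M_def by (rule inv_into_f_f[OF inj2])

lemma M_in_R: "y \<in> W \<Longrightarrow> M y \<in> R" and L_M: "y \<in> W \<Longrightarrow> L \<epsilon> (M y) = y"
  unfolding W_def M_def by (auto intro: inv_into_into f_inv_into_f)

lemma open_W: "open W"
  unfolding W_def by (rule invariance_of_domain[OF continuous_on_L_R open_R inj2])

text \<open>Doubling the range of t doubles the curvature term, hence the stronger bound
  \<open>epsK4\<close>.\<close>

lemma \<rho>_pos2:
  assumes "s \<in> I" "t \<in> {0<..<2}"
  shows "\<rho> s t > 0"
proof -
  have "\<bar>\<epsilon> * \<kappa> s\<bar> \<le> \<epsilon> * K" using K[OF assms(1)] eps by (simp add: abs_mult)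
  then have "\<bar>\<epsilon> * \<kappa> s\<bar> * \<bar>t\<bar> \<le> 1 / 4 * 2" using assms epsK4 by (intro mult_mono) auto
  then have "\<bar>\<epsilon> * \<kappa> s * t\<bar> \<le> 1 / 2" by (simp add: abs_mult)
  then show ?thesis unfolding \<rho>_def by linarith
qed

text \<open>Inverse of \<open>L' \<epsilon> x\<close>: in the orthonormal frame the two stretching
  factors are simply divided out.\<close>

definition M' :: "real^2 \<Rightarrow> real^2 \<Rightarrow> real^2" where
  "M' x v = vec2 ((\<gamma>' (x $ 1) \<bullet> v) / \<rho> (x $ 1) (x $ 2)) ((nu (x $ 1) \<bullet> v) / \<epsilon>)"

lemma M_has_derivative:
  assumes x: "x \<in> R"
  shows "(M has_derivative M' x) (at (L \<epsilon> x))"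
proof (rule has_derivative_inverse_strong[OF open_R x continuous_on_L_R M_L L_has_derivative[OF R_fst[OF x]]])
  have r: "\<rho> (x $ 1) (x $ 2) > 0" using x \<rho>_pos2 by (simp add: rect_def)
  have u: "(\<gamma>' (x $ 1) $ 1)\<^sup>2 + (\<gamma>' (x $ 1) $ 2)\<^sup>2 = 1" using unit_sq in_closure R_fst[OF x] by blast
  have rr: "1 - \<epsilon> * x $ 2 * \<kappa> (x $ 1) = \<rho> (x $ 1) (x $ 2)" by (simp add: \<rho>_def algebra_simps)
  have "L' \<epsilon> x (M' x v) = v" for v
  proof -
    have "L' \<epsilon> x (M' x v) = (\<gamma>' (x $ 1) \<bullet> v) *\<^sub>R \<gamma>' (x $ 1) + (nu (x $ 1) \<bullet> v) *\<^sub>R nu (x $ 1)"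
      unfolding L'_def M'_def rr using r eps by simp
    also have "\<dots> = v"
    proof -
      let ?a = "\<gamma>' (x $ 1) $ 1" and ?b = "\<gamma>' (x $ 1) $ 2"
      have "(?a * v $ 1 + ?b * v $ 2) * ?a + (- ?b * v $ 1 + ?a * v $ 2) * (- ?b) = (?a\<^sup>2 + ?b\<^sup>2) * v $ 1"
        "(?a * v $ 1 + ?b * v $ 2) * ?b + (- ?b * v $ 1 + ?a * v $ 2) * ?a = (?a\<^sup>2 + ?b\<^sup>2) * v $ 2"
        by (simp_all add: power2_eq_square algebra_simps)
      then show ?thesis unfolding u by (simp add: vec_eq_iff forall_2 inner_vec_def sum_2)
    qed
    finally show ?thesis .
  qed
  then show "L' \<epsilon> x \<circ> M' x = id" by (simp add: fun_eq_iff)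
qed

lemma continuous_on_M: "continuous_on W M"
proof (rule continuous_at_imp_continuous_on, rule ballI)
  fix y assume "y \<in> W"
  then show "isCont M y"
    using has_derivative_continuous[OF M_has_derivative[OF M_in_R]] L_M by metis
qed

definition trial :: "(real \<Rightarrow> complex) \<Rightarrow> real^2 \<Rightarrow> complex" where
  "trial \<psi> y = (if y \<in> W then \<psi> (M y $ 1) * of_real (chi \<delta> (M y $ 2)) else 0)"

lemma trial_L: "x \<in> R \<Longrightarrow> trial \<psi> (L \<epsilon> x) = \<psi> (x $ 1) * of_real (chi \<delta> (x $ 2))"
  by (simp add: trial_def W_def M_L)

lemma trial_sum: "trial (\<lambda>s. \<Sum>i<j. c i * \<psi> i s) = (\<lambda>y. \<Sum>i<j. c i * trial (\<psi> i) y)"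
  by (auto simp: trial_def fun_eq_iff sum_distrib_right mult.assoc)

lemma chi_eq_0: "sin (pi * t / 2) \<le> \<delta> \<Longrightarrow> chi \<delta> t = 0"
  by (simp add: chi_def cutoff_def)

text \<open>One compact set serves all profiles supported in \<open>{p..q}\<close>. It is the image
  of the part of the rectangle where sin (pi t / 2) is at least \<delta>, which stays away from both
  t = 0 and t = 2.\<close>

lemma trial_support:
  assumes "{p..q} \<subseteq> I"
  obtains S where "compact S" "S \<subseteq> W"
    "\<And>\<psi> y. (\<And>s. s \<notin> {p..q} \<Longrightarrow> \<psi> s = 0) \<Longrightarrow> y \<notin> S \<Longrightarrow> trial \<psi> y = 0"
proof -
  define T where "T = {t \<in> {0..2}. \<delta> \<le> sin (pi * t / 2)}"
  have "T = {0..2} \<inter> {t. \<delta> \<le> sin (pi * t / 2)}" by (auto simp: T_def)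
  then have "closed T"
    by (auto intro!: closed_Int closed_Collect_le continuous_intros)
  moreover have Tsub: "T \<subseteq> {0<..<2}"
  proof
    fix t assume t: "t \<in> T"
    then have "t \<noteq> 0" "t \<noteq> 2" using \<delta> by (auto simp: T_def)
    then show "t \<in> {0<..<2}" using t by (auto simp: T_def)
  qed
  moreover have "T \<subseteq> {0..2}" by (auto simp: T_def)
  ultimately have cT: "compact T" by (meson bounded_closed_interval bounded_subset compact_eq_bounded_closed)
  have "rect {p..q} T = (\<lambda>z. vec2 (fst z) (snd z)) ` ({p..q} \<times> T)"
  proof (intro set_eqI iffI)
    fix x assume "x \<in> rect {p..q} T"
    then show "x \<in> (\<lambda>z. vec2 (fst z) (snd z)) ` ({p..q} \<times> T)"
      by (intro image_eqI[of _ _ "(x $ 1, x $ 2)"]) (auto simp: rect_def)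
  qed auto
  then have "compact (rect {p..q} T)"
    using cT by (auto intro!: compact_continuous_image compact_Times continuous_intros)
  moreover have sub: "rect {p..q} T \<subseteq> R" using assms Tsub by (auto simp: rect_def)
  ultimately have "compact (L \<epsilon> ` rect {p..q} T)"
    by (intro compact_continuous_image continuous_on_subset[OF continuous_on_L_R])
  moreover have "L \<epsilon> ` rect {p..q} T \<subseteq> W" unfolding W_def using sub by blast
  moreover have "trial \<psi> y = 0" if \<psi>: "\<And>s. s \<notin> {p..q} \<Longrightarrow> \<psi> s = 0" and y: "y \<notin> L \<epsilon> ` rect {p..q} T" for \<psi> y
  proof (cases "y \<in> W")
    case True
    then have "M y \<notin> rect {p..q} T" using y L_M by force
    moreover have "M y \<in> R" by (rule M_in_R[OF True])
    ultimately have "M y $ 1 \<notin> {p..q} \<or> sin (pi * (M y $ 2) / 2) \<le> \<delta>" by (auto simp: rect_def T_def)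
    then show ?thesis using \<psi> chi_eq_0 by (auto simp: trial_def)
  qed (simp add: trial_def)
  ultimately show ?thesis using that by blast
qed

definition trial' :: "(real \<Rightarrow> complex) \<Rightarrow> (real \<Rightarrow> complex) \<Rightarrow> real^2 \<Rightarrow> real^2 \<Rightarrow> complex" where
  "trial' \<psi> \<psi>' x v = (M' x v $ 1) *\<^sub>R (\<psi>' (x $ 1) * of_real (chi \<delta> (x $ 2))) +
     (M' x v $ 2) *\<^sub>R (\<psi> (x $ 1) * of_real (chi' \<delta> (x $ 2)))"

lemma trial_has_derivative:
  assumes \<psi>: "\<And>s. (\<psi> has_vector_derivative \<psi>' s) (at s)" and x: "x \<in> R"
  shows "(trial \<psi> has_derivative trial' \<psi> \<psi>' x) (at (L \<epsilon> x))"
proof -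
  have 1: "((\<lambda>z. \<psi> (z $ 1)) has_derivative (\<lambda>h. (h $ 1) *\<^sub>R \<psi>' (x $ 1))) (at x)"
    by (rule has_derivative_compose[OF bounded_linear_imp_has_derivative[OF bounded_linear_vec_nth[of 1]]
      \<psi>[unfolded has_vector_derivative_def]])
  have "((\<lambda>z. chi \<delta> (z $ 2)) has_derivative (\<lambda>h. (h $ 2) * chi' \<delta> (x $ 2))) (at x)"
    using DERIV_compose_FDERIV[of "chi \<delta>", OF chi_deriv[OF \<delta>(1)]
       bounded_linear_imp_has_derivative[OF bounded_linear_vec_nth[of 2]], of x] by simp
  then have 2: "((\<lambda>z. of_real (chi \<delta> (z $ 2)) :: complex) has_derivative (\<lambda>h. of_real ((h $ 2) * chi' \<delta> (x $ 2)))) (at x)"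
    by (rule has_derivative_of_real)
  have 3: "((\<lambda>z. \<psi> (z $ 1) * of_real (chi \<delta> (z $ 2))) has_derivative
     (\<lambda>h. (h $ 1) *\<^sub>R (\<psi>' (x $ 1) * of_real (chi \<delta> (x $ 2))) + (h $ 2) *\<^sub>R (\<psi> (x $ 1) * of_real (chi' \<delta> (x $ 2))))) (at x)"
    by (rule has_derivative_eq_rhs[OF has_derivative_mult[OF 1 2]])
       (simp add: fun_eq_iff scaleR_conv_of_real algebra_simps)
  have "((\<lambda>y. \<psi> (M y $ 1) * of_real (chi \<delta> (M y $ 2))) has_derivative trial' \<psi> \<psi>' x) (at (L \<epsilon> x))"
    using has_derivative_compose[OF M_has_derivative[OF x], of "\<lambda>z. \<psi> (z $ 1) * of_real (chi \<delta> (z $ 2))"] 3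
    by (simp add: M_L[OF x] trial'_def[abs_def])
  then show ?thesis
    by (rule has_derivative_transform_within_open[OF _ open_W]) (use x in \<open>auto simp: trial_def W_def\<close>)
qed

lemma partial_deriv_trial:
  assumes \<psi>: "\<And>s. (\<psi> has_vector_derivative \<psi>' s) (at s)" and x: "x \<in> R"
  shows "partial_deriv i (trial \<psi>) (L \<epsilon> x) =
    (\<gamma>' (x $ 1) $ i / \<rho> (x $ 1) (x $ 2)) *\<^sub>R (\<psi>' (x $ 1) * of_real (chi \<delta> (x $ 2))) +
    (nu (x $ 1) $ i / \<epsilon>) *\<^sub>R (\<psi> (x $ 1) * of_real (chi' \<delta> (x $ 2)))"
  unfolding partial_deriv_eq[OF trial_has_derivative[OF \<psi> x]]
  by (simp add: trial'_def M'_def inner_axis)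

text \<open>Tangential and normal parts of the gradient are orthogonal, hence there is no cross term
  between \<psi>' and \<open>chi'\<close>.\<close>

lemma norm_grad_trial:
  assumes \<psi>: "\<And>s. (\<psi> has_vector_derivative \<psi>' s) (at s)" and x: "x \<in> R"
  shows "(norm (grad (trial \<psi>) (L \<epsilon> x)))\<^sup>2 =
    (norm (\<psi>' (x $ 1)))\<^sup>2 * (chi \<delta> (x $ 2))\<^sup>2 / (\<rho> (x $ 1) (x $ 2))\<^sup>2
    + (norm (\<psi> (x $ 1)))\<^sup>2 * (chi' \<delta> (x $ 2))\<^sup>2 / \<epsilon>\<^sup>2"
proof -
  let ?a = "\<gamma>' (x $ 1) $ 1" and ?b = "\<gamma>' (x $ 1) $ 2"
  define A where "A = (1 / \<rho> (x $ 1) (x $ 2)) *\<^sub>R (\<psi>' (x $ 1) * of_real (chi \<delta> (x $ 2)))"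
  define B where "B = (1 / \<epsilon>) *\<^sub>R (\<psi> (x $ 1) * of_real (chi' \<delta> (x $ 2)))"
  have u: "?a\<^sup>2 + ?b\<^sup>2 = 1" using unit_sq in_closure R_fst[OF x] by blast
  have "(norm (grad (trial \<psi>) (L \<epsilon> x)))\<^sup>2 = (norm (?a *\<^sub>R A - ?b *\<^sub>R B))\<^sup>2 + (norm (?b *\<^sub>R A + ?a *\<^sub>R B))\<^sup>2"
    by (simp add: norm_vec_def L2_set_def sum_2 grad_def partial_deriv_trial[OF \<psi> x] A_def B_def)
  also have "\<dots> = (?a\<^sup>2 + ?b\<^sup>2) * ((norm A)\<^sup>2 + (norm B)\<^sup>2)"
    by (simp only: power2_norm_eq_inner) (simp add: inner_diff inner_add inner_commute power2_eq_square algebra_simps)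
  also have "\<dots> = (norm (\<psi>' (x $ 1)))\<^sup>2 * (chi \<delta> (x $ 2))\<^sup>2 / (\<rho> (x $ 1) (x $ 2))\<^sup>2
    + (norm (\<psi> (x $ 1)))\<^sup>2 * (chi' \<delta> (x $ 2))\<^sup>2 / \<epsilon>\<^sup>2"
    unfolding u by (simp add: A_def B_def norm_mult power_mult_distrib power_divide)
  finally show ?thesis .
qed

end

section \<open>Trial functions as members of the form domain\<close>

lemma L2_on_compact_support:
  fixes f :: "'a::euclidean_space \<Rightarrow> 'b::euclidean_space"
  assumes "open S" "compact K" "continuous_on UNIV f" "\<And>x. x \<notin> K \<Longrightarrow> f x = 0"
  shows "L2_on S f"
proof -
  have "integrable lborel (\<lambda>x. (norm (f x))\<^sup>2)"
    by (rule integrable_lborel_compact_support[OF assms(2)]) (intro continuous_intros assms(3), simp add: assms(4))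
  then have "integrable lebesgue (\<lambda>x. (norm (f x))\<^sup>2)" by (simp add: integrable_completion)
  then have "integrable (lebesgue_on UNIV) (\<lambda>x. (norm (f x))\<^sup>2)" by (simp add: lebesgue_on_UNIV_eq)
  then have "integrable (lebesgue_on S) (\<lambda>x. (norm (f x))\<^sup>2)"
    by (rule integrable_lebesgue_on_mono) (use assms(1) in auto)
  moreover have "f \<in> borel_measurable (lebesgue_on S)"
    by (rule continuous_imp_measurable_on_sets_lebesgue[OF continuous_on_subset[OF assms(3)]])
       (use assms(1) in auto)
  ultimately show ?thesis by (simp add: L2_on_def)
qed

text \<open>Serves the constant approximating sequence in the trace, whose error is the zero
  function.\<close>

lemma dirichlet_energy_zero: "open S \<Longrightarrow> dirichlet_energy S (\<lambda>x. 0) = 0"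
  by (subst dirichlet_energy_eq[of _ "\<lambda>x. 0"]) (auto simp: L2_on_def L2_sq_def is_weak_gradient_def)

text \<open>Instantiated for every coefficient vector, with a combination of bumps as profile, so
  that the whole trial space is treated at once.\<close>

locale trial_profile = trial_strip +
  fixes p q :: real and \<psi> \<psi>' :: "real \<Rightarrow> complex"
  assumes pq: "p < q" "{p..q} \<subseteq> I"
    and \<psi>: "\<And>s. (\<psi> has_vector_derivative \<psi>' s) (at s)" and cont_\<psi>': "continuous_on UNIV \<psi>'"
    and \<psi>0: "\<And>s. s \<notin> {p..q} \<Longrightarrow> \<psi> s = 0" "\<And>s. s \<notin> {p..q} \<Longrightarrow> \<psi>' s = 0"
begin

lemma cont_\<psi>: "continuous_on UNIV \<psi>"
  using \<psi> by (auto intro!: continuous_at_imp_continuous_on has_vector_derivative_continuous)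

text \<open>On \<open>W\<close> the explicit partial derivatives are continuous; off a compact
  subset of \<open>W\<close> everything is zero. These two open sets cover the plane, so the
  extension by zero stays C^1.\<close>

lemma trial_C1:
  obtains S where "compact S" "S \<subseteq> W" "\<And>y. y \<notin> S \<Longrightarrow> trial \<psi> y = 0"
    "\<And>y i. y \<notin> S \<Longrightarrow> partial_deriv i (trial \<psi>) y = 0"
    "Ck_on 1 UNIV (trial \<psi>)"
proof -
  obtain S where S: "compact S" "S \<subseteq> W" "\<And>y. y \<notin> S \<Longrightarrow> trial \<psi> y = 0"
    using trial_support[OF pq(2)] \<psi>0(1) by metis
  have off: "(trial \<psi> has_derivative (\<lambda>_. 0)) (at y)" "partial_deriv i (trial \<psi>) y = 0" if "y \<notin> S" for y i
    using partial_deriv_zero_outside[where F = "trial \<psi>" and K = S, OF compact_imp_closed[OF S(1)] _ that] S(3)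
    by blast+
  have "trial \<psi> differentiable (at y)" for y
  proof (cases "y \<in> W")
    case True
    then show ?thesis
      using trial_has_derivative[OF \<psi> M_in_R[OF True]] L_M[OF True] by (auto simp: differentiable_def)
  next
    case False
    then show ?thesis using off(1)[of y] S(2) by (auto simp: differentiable_def)
  qed
  moreover have "continuous_on UNIV (partial_deriv i (trial \<psi>))" for i
  proof (rule continuous_on_UNIV_supported[OF open_W S(1,2) _ off(2)])
    have M: "continuous_on W (\<lambda>y. M y $ k)" for k by (intro continuous_intros continuous_on_M)
    have MI: "M y $ 1 \<in> closure I" "M y $ 1 \<in> I" "M y $ 2 \<in> {0<..<2}" if "y \<in> W" for y
      using M_in_R[OF that] in_closure by (auto simp: rect_def)
    have c\<kappa>: "continuous_on W (\<lambda>y. \<kappa> (M y $ 1))"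
      by (rule continuous_on_compose2[OF continuous_curvature M]) (use MI in auto)
    have c\<gamma>: "continuous_on W (\<lambda>y. \<gamma>' (M y $ 1))"
      by (rule continuous_on_compose2[OF continuous_gamma(2) M]) (use MI in auto)
    have cn: "continuous_on W (\<lambda>y. nu (M y $ 1))"
      by (rule continuous_on_compose2[OF continuous_nu M]) (use MI in auto)
    have c\<psi>: "continuous_on W (\<lambda>y. \<psi> (M y $ 1))" "continuous_on W (\<lambda>y. \<psi>' (M y $ 1))"
      by (rule continuous_on_compose2[OF cont_\<psi> M subset_UNIV], rule continuous_on_compose2[OF cont_\<psi>' M subset_UNIV])
    have cc: "continuous_on W (\<lambda>y. chi \<delta> (M y $ 2))" "continuous_on W (\<lambda>y. chi' \<delta> (M y $ 2))"
      by (rule continuous_on_compose2[OF continuous_chi[OF \<delta>(1)] M subset_UNIV],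
          rule continuous_on_compose2[OF continuous_chi'[OF \<delta>(1)] M subset_UNIV])
    have c\<rho>: "continuous_on W (\<lambda>y. \<rho> (M y $ 1) (M y $ 2))"
      unfolding \<rho>_def by (intro continuous_intros c\<kappa> M)
    have \<rho>0: "\<rho> (M y $ 1) (M y $ 2) \<noteq> 0" if "y \<in> W" for y
      using \<rho>_pos2[OF MI(2,3)[OF that]] by simp
    have "continuous_on W (\<lambda>y.
        (\<gamma>' (M y $ 1) $ i / \<rho> (M y $ 1) (M y $ 2)) *\<^sub>R (\<psi>' (M y $ 1) * of_real (chi \<delta> (M y $ 2))) +
        (nu (M y $ 1) $ i / \<epsilon>) *\<^sub>R (\<psi> (M y $ 1) * of_real (chi' \<delta> (M y $ 2))))"
      by (intro continuous_intros c\<gamma> cn c\<psi> cc c\<rho>) (use \<rho>0 eps in auto)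
    then show "continuous_on W (partial_deriv i (trial \<psi>))"
      by (rule continuous_on_eq) (use partial_deriv_trial[OF \<psi> M_in_R] L_M in metis)
  qed
  ultimately have "Ck_on 1 UNIV (trial \<psi>)" unfolding Ck_on_1 by blast
  with S off(2) show ?thesis using that by blast
qed

text \<open>A point with nonzero value has strip coordinates with 0 < t < 2. It lies in
  \<open>\<Omega>\<close> if t < 1 and in \<open>N\<close> if t = 1. If t > 1, the image of the
  outer half is an open neighbourhood that misses \<open>\<Omega>\<close> by injectivity on the
  double strip, so the point is not in the closure.\<close>

lemma trial_zero_on_boundary:
  assumes "y \<in> frontier \<Omega> - N"
  shows "trial \<psi> y = 0"
proof (rule ccontr)
  assume "trial \<psi> y \<noteq> 0"
  then have yW: "y \<in> W" by (auto simp: trial_def split: if_splits)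
  have x: "M y \<in> R" "y = L \<epsilon> (M y)" using M_in_R L_M yW by auto
  have fr: "y \<in> closure \<Omega>" "y \<notin> \<Omega>" "y \<notin> N" using assms by (auto simp: frontier_def interior_open[OF open_\<Omega>])
  consider "M y $ 2 < 1" | "M y $ 2 = 1" | "M y $ 2 > 1" by linarith
  then show False
  proof cases
    case 1
    then have "M y \<in> rect I {0<..<1}" using x(1) by (auto simp: rect_def)
    then show False using fr(2) x(2) unfolding \<Omega>_eq by blast
  next
    case 2
    then have "M y \<in> rect I {1}" using x(1) by (auto simp: rect_def)
    then show False using fr(3) x(2) unfolding N_def strip_map_image by blast
  next
    case 3
    let ?R1 = "rect I {1<..<2}"
    have sub: "?R1 \<subseteq> R" by (rule rect_mono) auto
    have "open (L \<epsilon> ` ?R1)"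
      by (rule invariance_of_domain[OF continuous_on_subset[OF continuous_on_L_R sub] _ inj_on_subset[OF inj2 sub]])
         (intro open_rect open_I open_greaterThanLessThan)
    moreover have "M y \<in> ?R1" using 3 x(1) by (auto simp: rect_def)
    with x(2) have "y \<in> L \<epsilon> ` ?R1" by (rule image_eqI)
    ultimately obtain z where z: "z \<in> \<Omega>" "z \<in> L \<epsilon> ` ?R1"
      using fr(1) open_Int_closure_eq_empty[of "L \<epsilon> ` ?R1" \<Omega>] by blast
    then obtain x1 x2 where "x1 \<in> rect I {0<..<1}" "x2 \<in> ?R1" "L \<epsilon> x1 = L \<epsilon> x2" unfolding \<Omega>_eq by auto
    then have "x1 = x2" by (intro inj_onD[OF inj2, of x1 x2]) (auto simp: rect_def)
    then show False using \<open>x1 \<in> _\<close> \<open>x2 \<in> _\<close> by (auto simp: rect_def)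
  qed
qed

lemma trial_L2: "L2_on \<Omega> (trial \<psi>)" "L2_on \<Omega> (grad (trial \<psi>))" and trial_Ck: "Ck_on 1 UNIV (trial \<psi>)"
proof -
  obtain S where S: "compact S" "\<And>y. y \<notin> S \<Longrightarrow> trial \<psi> y = 0"
    "\<And>y i. y \<notin> S \<Longrightarrow> partial_deriv i (trial \<psi>) y = 0" and C: "Ck_on 1 UNIV (trial \<psi>)"
    using trial_C1 by metis
  show "L2_on \<Omega> (trial \<psi>)"
    by (rule L2_on_compact_support[OF open_\<Omega> S(1) Ck_on_1_continuous[OF C] S(2)])
  have "continuous_on UNIV (\<lambda>x. \<chi> i. grad (trial \<psi>) x $ i)"
    using C unfolding Ck_on_1 grad_def by (intro continuous_intros) auto
  then have "continuous_on UNIV (grad (trial \<psi>))" by simp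
  then show "L2_on \<Omega> (grad (trial \<psi>))"
    by (rule L2_on_compact_support[OF open_\<Omega> S(1)]) (simp add: grad_def S(3) vec_eq_iff)
  show "Ck_on 1 UNIV (trial \<psi>)" by (rule C)
qed

lemma trial_Ck_\<Omega>: "Ck_on 1 \<Omega> (trial \<psi>)"
  using trial_Ck unfolding Ck_on_1 by (auto intro: continuous_on_subset)

lemma trial_W12: "trial \<psi> \<in> W12 \<Omega>"
  unfolding W12_def using trial_L2 is_weak_gradient_grad[OF open_\<Omega> trial_Ck_\<Omega>] by blast

text \<open>The function is C^1 on the plane and vanishes pointwise on the Dirichlet boundary, so
  the constant sequence witnesses the zero trace along every arc.\<close>

lemma trial_in_domain: "trial \<psi> \<in> DN_form_domain \<Omega> N"
  unfolding DN_form_domain_def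
proof (intro CollectI conjI)
  show "trial \<psi> \<in> W12 \<Omega>" by (rule trial_W12)
  show "trace_zero_on \<Omega> (frontier \<Omega> - N) (trial \<psi>)"
    unfolding trace_zero_on_def has_trace_along_def
  proof (intro allI impI conjI exI[of _ "\<lambda>_. trial \<psi>"])
    fix c :: "real \<Rightarrow> real^2" and a b :: real
    assume c: "unit_speed_arc c a b \<and> c ` {a..b} \<subseteq> frontier \<Omega> - N"
    show "L2_on {a..b} (\<lambda>_. 0 :: complex)" by (simp add: L2_on_def)
    show "trial \<psi> \<in> W12 \<Omega>" "Ck_on 1 \<Omega> (trial \<psi>)" by (rule trial_W12 trial_Ck_\<Omega>)+
    show "continuous_on (closure \<Omega>) (trial \<psi>)"
      by (rule continuous_on_subset[OF Ck_on_1_continuous[OF trial_Ck]]) simp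
    show "(\<lambda>n::nat. L2_sq \<Omega> (\<lambda>x. trial \<psi> x - trial \<psi> x) + dirichlet_energy \<Omega> (\<lambda>x. trial \<psi> x - trial \<psi> x)) \<longlonglongrightarrow> 0"
      by (simp add: dirichlet_energy_zero[OF open_\<Omega>] L2_sq_def)
    have "trial \<psi> (c \<tau>) = 0" if "\<tau> \<in> {a..b}" for \<tau>
      using c that by (intro trial_zero_on_boundary) blast
    then have "L2_sq {a..b} (\<lambda>\<tau>. trial \<psi> (c \<tau>) - 0) = (\<integral>\<tau>. 0 \<partial>lebesgue_on {a..b})"
      unfolding L2_sq_def by (intro Bochner_Integration.integral_cong) auto
    then show "(\<lambda>n::nat. L2_sq {a..b} (\<lambda>\<tau>. trial \<psi> (c \<tau>) - 0)) \<longlonglongrightarrow> 0" by simp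
  qed
qed

text \<open>The normal part of the gradient is governed by the fibre estimate, with
  \<open>\<kappa>\<close> at most \<open>m\<close> on the support. The longitudinal part carries no
  factor 1/\<epsilon>^2 and is controlled by \<open>C\<psi>\<close>.\<close>

lemma trial_rayleigh:
  assumes fibre: "\<And>c. \<bar>c\<bar> \<le> K \<Longrightarrow> integral {0..1} (\<lambda>t. (1 - \<epsilon> * c * t) * (chi' \<delta> t)\<^sup>2)
      \<le> (pi\<^sup>2 / 4 + \<epsilon> * c + C * \<epsilon>\<^sup>2) * integral {0..1} (\<lambda>t. (1 - \<epsilon> * c * t) * (chi \<delta> t)\<^sup>2)"
    and m: "\<And>s. s \<in> {p..q} \<Longrightarrow> \<kappa> s \<le> m"
    and C\<psi>: "C\<psi> \<ge> 0" "(\<integral>s. (norm (\<psi>' s))\<^sup>2 \<partial>lborel) \<le> C\<psi> * (\<integral>s. (norm (\<psi> s))\<^sup>2 \<partial>lborel)"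
  shows "dirichlet_energy \<Omega> (trial \<psi>) \<le> ((pi / (2 * \<epsilon>))\<^sup>2 + m / \<epsilon> + C + 16 * C\<psi>) * L2_sq \<Omega> (trial \<psi>)"
proof -
  let ?B = "{0<..<1::real}"
  define X where "X s = integral {0..1} (\<lambda>t. \<rho> s t * (chi \<delta> t)\<^sup>2)" for s
  \<comment> \<open>\<open>X0\<close> does not depend on s, so it can be pulled out of the integral
    over s; it is comparable to \<open>X s\<close> up to a factor 2.\<close>
  define X0 where "X0 = integral {0..1} (\<lambda>t. (chi \<delta> t)\<^sup>2)"
  define P where "P s = (\<integral>t. indicator I s * (indicator ?B t * (\<epsilon> * \<rho> s t * (norm (trial \<psi> (L \<epsilon> (vec2 s t))))\<^sup>2)) \<partial>lborel)" for s
  define Q where "Q s = (\<integral>t. indicator I s * (indicator ?B t * (\<epsilon> * \<rho> s t * (norm (grad (trial \<psi>) (L \<epsilon> (vec2 s t))))\<^sup>2)) \<partial>lborel)" for s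
  have cU: "continuous_on UNIV (trial \<psi>)" by (rule Ck_on_1_continuous[OF trial_Ck])
  have "continuous_on UNIV (\<lambda>x. \<chi> i. grad (trial \<psi>) x $ i)"
    using trial_Ck unfolding Ck_on_1 grad_def by (intro continuous_intros) auto
  then have cG: "continuous_on UNIV (grad (trial \<psi>))" by simp
  let ?f = "\<lambda>x. (norm (trial \<psi> x))\<^sup>2" and ?g = "\<lambda>x. (norm (grad (trial \<psi>) x))\<^sup>2"
  have cf: "continuous_on \<Omega> ?f" "continuous_on \<Omega> ?g"
    by (intro continuous_intros continuous_on_subset[OF cU] continuous_on_subset[OF cG] subset_UNIV)+
  have int: "integrable (lebesgue_on \<Omega>) ?f" "integrable (lebesgue_on \<Omega>) ?g"
    using trial_L2 by (auto simp: L2_on_def)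
  note SI = strip_integrable[OF open_I order.refl, folded \<Omega>_eq] and SE = strip_integral[OF open_I order.refl, folded \<Omega>_eq]
  have PI: "integrable lborel P" and QI: "integrable lborel Q"
    using lborel_pair.integrable_fst'[OF SI[OF cf(1) int(1)]] lborel_pair.integrable_fst'[OF SI[OF cf(2) int(2)]]
    by (simp_all add: P_def[abs_def] Q_def[abs_def])
  have PE: "L2_sq \<Omega> (trial \<psi>) = integral\<^sup>L lborel P" and "L2_sq \<Omega> (grad (trial \<psi>)) = integral\<^sup>L lborel Q"
    unfolding L2_sq_def P_def[abs_def] Q_def[abs_def] using SE[OF cf(1) int(1)] SE[OF cf(2) int(2)] by simp_all
  then have QE: "dirichlet_energy \<Omega> (trial \<psi>) = integral\<^sup>L lborel Q"
    using dirichlet_energy_eq[OF open_\<Omega> trial_L2(2) is_weak_gradient_grad[OF open_\<Omega> trial_Ck_\<Omega>]] by simp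
  have c\<rho>: "continuous_on T (\<rho> s)" for T s unfolding \<rho>_def by (intro continuous_intros)
  note cchi = continuous_chi[OF \<delta>(1)] continuous_chi'[OF \<delta>(1)]
  have X0: "X0 \<ge> 0" unfolding X0_def
    by (intro integral_nonneg integrable_continuous_real continuous_intros cchi) auto
  have Xb: "X s \<le> 2 * X0" "X0 / 2 \<le> X s" if s: "s \<in> I" for s
  proof -
    have i: "(\<lambda>t. \<rho> s t * (chi \<delta> t)\<^sup>2) integrable_on {0..1}" "(\<lambda>t. (chi \<delta> t)\<^sup>2) integrable_on {0..1}"
      by (intro integrable_continuous_real continuous_intros cchi c\<rho>)+
    have "X s \<le> integral {0..1} (\<lambda>t. 2 * (chi \<delta> t)\<^sup>2)"
      unfolding X_def by (intro integral_le i integrable_on_mult_right mult_right_mono \<rho>_bounds s) auto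
    then show "X s \<le> 2 * X0" by (simp add: X0_def)
    have "integral {0..1} (\<lambda>t. 1 / 2 * (chi \<delta> t)\<^sup>2) \<le> X s"
      unfolding X_def by (intro integral_le i integrable_on_mult_right mult_right_mono \<rho>_bounds s) auto
    then show "X0 / 2 \<le> X s" by (simp add: X0_def)
  qed
  have Peq: "P s = \<epsilon> * (norm (\<psi> s))\<^sup>2 * X s" if s: "s \<in> I" for s
  proof -
    let ?k = "\<lambda>t. \<epsilon> * (norm (\<psi> s))\<^sup>2 * (\<rho> s t * (chi \<delta> t)\<^sup>2)"
    have "P s = (\<integral>t. indicator ?B t * ?k t \<partial>lborel)"
      unfolding P_def using s
      by (intro Bochner_Integration.integral_cong refl)
         (auto simp: indicator_def trial_L rect_def norm_mult power_mult_distrib)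
    also have "\<dots> = integral {0..1} ?k"
      by (rule integral_unique[symmetric, OF has_integral_Icc_of_lborel[OF integrable_Ioo_continuous]])
         (intro continuous_intros cchi c\<rho>)
    also have "\<dots> = \<epsilon> * (norm (\<psi> s))\<^sup>2 * X s" by (simp add: X_def)
    finally show ?thesis .
  qed
  have Qle: "Q s \<le> 8 * \<epsilon> * X0 * (norm (\<psi>' s))\<^sup>2 + ((pi / (2 * \<epsilon>))\<^sup>2 + m / \<epsilon> + C) * P s" for s
  proof (cases "s \<in> {p..q}")
    case False
    then show ?thesis
    proof (cases "s \<in> I")
      case True
      have z: "indicator I s * (indicator ?B t * (\<epsilon> * \<rho> s t * ?g (L \<epsilon> (vec2 s t)))) = 0" for t
      proof (cases "t \<in> ?B")
        case t: True
        then have "vec2 s t \<in> R" using True by simp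
        from norm_grad_trial[OF \<psi> this] False have "?g (L \<epsilon> (vec2 s t)) = 0" by (simp add: \<psi>0)
        then show ?thesis by simp
      qed simp
      have "Q s = 0" unfolding Q_def z by simp
      moreover have "P s = 0" using Peq[OF True] \<psi>0(1)[OF False] by simp
      ultimately show ?thesis using X0 eps by simp
    next
      case nI: False
      then show ?thesis using X0 eps by (simp add: P_def Q_def)
    qed
  next
    case spq: True
    then have s: "s \<in> I" using pq by blast
    let ?k1 = "\<lambda>t. 4 * \<epsilon> * (norm (\<psi>' s))\<^sup>2 * (\<rho> s t * (chi \<delta> t)\<^sup>2)"
    let ?k2 = "\<lambda>t. (norm (\<psi> s))\<^sup>2 / \<epsilon> * (\<rho> s t * (chi' \<delta> t)\<^sup>2)"
    let ?k = "\<lambda>t. ?k1 t + ?k2 t"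
    have ik: "integrable lborel (\<lambda>t. indicator ?B t * ?k t)"
      by (rule integrable_Ioo_continuous) (intro continuous_intros cchi c\<rho>, use eps in simp)
    have "Q s \<le> (\<integral>t. indicator ?B t * ?k t \<partial>lborel)"
      unfolding Q_def
    proof (rule integral_mono')
      show "integrable lborel (\<lambda>t. indicator ?B t * ?k t)" by (rule ik)
      fix t :: real
      show "indicator I s * (indicator ?B t * (\<epsilon> * \<rho> s t * ?g (L \<epsilon> (vec2 s t)))) \<le> indicator ?B t * ?k t"
      proof (cases "t \<in> ?B")
        case t: True
        have r: "1 / 2 \<le> \<rho> s t" using \<rho>_bounds(1)[OF s] t by simp
        \<comment> \<open>The Jacobian \<rho> times \<rho>^(-2) leaves 1/\<rho>, which is traded for
          4 \<rho> to recover \<open>X s\<close>.\<close>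
        have "1 / \<rho> s t \<le> 4 * \<rho> s t"
        proof -
          have "1 / 2 * (1 / 2) \<le> \<rho> s t * \<rho> s t" using r by (intro mult_mono) auto
          then show ?thesis using r by (simp add: field_simps)
        qed
        from mult_left_mono[OF this, of "\<epsilon> * (norm (\<psi>' s))\<^sup>2 * (chi \<delta> t)\<^sup>2"] eps
        have 1: "\<epsilon> * (norm (\<psi>' s))\<^sup>2 * (chi \<delta> t)\<^sup>2 * (1 / \<rho> s t) \<le> ?k1 t" by (simp add: algebra_simps)
        have "\<epsilon> * \<rho> s t * ?g (L \<epsilon> (vec2 s t)) =
          \<epsilon> * (norm (\<psi>' s))\<^sup>2 * (chi \<delta> t)\<^sup>2 * (1 / \<rho> s t) + ?k2 t"
          using r eps s t by (subst norm_grad_trial[OF \<psi>]) (auto simp: rect_def field_simps power2_eq_square)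
        then show ?thesis using 1 s t by simp
      qed simp
      show "0 \<le> indicator ?B t * ?k t"
        using \<rho>_bounds(1)[OF s, of t] eps by (auto simp: indicator_def intro!: add_nonneg_nonneg mult_nonneg_nonneg divide_nonneg_pos)
    qed
    also have "\<dots> = integral {0..1} ?k"
      by (rule integral_unique[symmetric, OF has_integral_Icc_of_lborel[OF ik]])
    also have "\<dots> = integral {0..1} ?k1 + integral {0..1} ?k2"
      by (intro integral_add integrable_continuous_real continuous_intros cchi c\<rho>) (use eps in simp)
    also have "\<dots> = 4 * \<epsilon> * (norm (\<psi>' s))\<^sup>2 * X s + (norm (\<psi> s))\<^sup>2 / \<epsilon> * integral {0..1} (\<lambda>t. \<rho> s t * (chi' \<delta> t)\<^sup>2)"
      by (simp add: X_def)
    also have "4 * \<epsilon> * (norm (\<psi>' s))\<^sup>2 * X s \<le> 4 * \<epsilon> * (norm (\<psi>' s))\<^sup>2 * (2 * X0)"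
      using Xb(1)[OF s] eps by (intro mult_left_mono) auto
    also have "integral {0..1} (\<lambda>t. \<rho> s t * (chi' \<delta> t)\<^sup>2) \<le> (pi\<^sup>2 / 4 + \<epsilon> * m + C * \<epsilon>\<^sup>2) * X s"
    proof -
      have "integral {0..1} (\<lambda>t. \<rho> s t * (chi' \<delta> t)\<^sup>2) \<le> (pi\<^sup>2 / 4 + \<epsilon> * \<kappa> s + C * \<epsilon>\<^sup>2) * X s"
        using fibre[OF K[OF s]] by (simp add: X_def \<rho>_def)
      also have "\<dots> \<le> (pi\<^sup>2 / 4 + \<epsilon> * m + C * \<epsilon>\<^sup>2) * X s"
        using m[OF spq] eps Xb(2)[OF s] X0 by (intro mult_right_mono) auto
      finally show ?thesis .
    qed
    finally have "Q s \<le> 4 * \<epsilon> * (norm (\<psi>' s))\<^sup>2 * (2 * X0) + (norm (\<psi> s))\<^sup>2 / \<epsilon> * ((pi\<^sup>2 / 4 + \<epsilon> * m + C * \<epsilon>\<^sup>2) * X s)"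
      using eps by (simp add: mult_left_mono divide_right_mono)
    also have "(norm (\<psi> s))\<^sup>2 / \<epsilon> * ((pi\<^sup>2 / 4 + \<epsilon> * m + C * \<epsilon>\<^sup>2) * X s) = ((pi / (2 * \<epsilon>))\<^sup>2 + m / \<epsilon> + C) * P s"
      unfolding Peq[OF s] using eps by (simp add: field_simps power2_eq_square)
    finally show ?thesis by (simp add: algebra_simps)
  qed
  have c2: "continuous_on UNIV (\<lambda>s. (norm (\<psi> s))\<^sup>2)" "continuous_on UNIV (\<lambda>s. (norm (\<psi>' s))\<^sup>2)"
    by (intro continuous_intros cont_\<psi> cont_\<psi>')+
  have i\<psi>: "integrable lborel (\<lambda>s. (norm (\<psi> s))\<^sup>2)" "integrable lborel (\<lambda>s. (norm (\<psi>' s))\<^sup>2)"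
    by (rule integrable_lborel_compact_support[of "{p..q}"]; simp add: c2 \<psi>0)+
  have Pge: "\<epsilon> * X0 / 2 * (norm (\<psi> s))\<^sup>2 \<le> P s" for s
  proof (cases "s \<in> I")
    case True
    have "\<epsilon> * (norm (\<psi> s))\<^sup>2 * (X0 / 2) \<le> \<epsilon> * (norm (\<psi> s))\<^sup>2 * X s"
      using Xb(2)[OF True] eps by (intro mult_left_mono) auto
    then show ?thesis unfolding Peq[OF True] by (simp add: algebra_simps)
  next
    case False
    then have "\<psi> s = 0" using \<psi>0(1) pq by blast
    then show ?thesis using False by (simp add: P_def)
  qed
  have "integral\<^sup>L lborel Q \<le> (\<integral>s. 8 * \<epsilon> * X0 * (norm (\<psi>' s))\<^sup>2 + ((pi / (2 * \<epsilon>))\<^sup>2 + m / \<epsilon> + C) * P s \<partial>lborel)"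
    by (rule integral_mono[OF QI _ Qle]) (use i\<psi> PI in simp)
  also have "\<dots> = 8 * \<epsilon> * X0 * (\<integral>s. (norm (\<psi>' s))\<^sup>2 \<partial>lborel) + ((pi / (2 * \<epsilon>))\<^sup>2 + m / \<epsilon> + C) * integral\<^sup>L lborel P"
    using i\<psi> PI by simp
  \<comment> \<open>16 is the ratio of 8 \<epsilon> X0, where 8 combines 1/\<rho> \<le> 4 \<rho>
    with X s \<le> 2 X0, to \<epsilon> X0 / 2 in \<open>Pge\<close>.\<close>
  also have "8 * \<epsilon> * X0 * (\<integral>s. (norm (\<psi>' s))\<^sup>2 \<partial>lborel) \<le> 16 * C\<psi> * integral\<^sup>L lborel P"
  proof -
    have "8 * \<epsilon> * X0 * (\<integral>s. (norm (\<psi>' s))\<^sup>2 \<partial>lborel) \<le> 8 * \<epsilon> * X0 * (C\<psi> * (\<integral>s. (norm (\<psi> s))\<^sup>2 \<partial>lborel))"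
      using C\<psi>(2) X0 eps by (intro mult_left_mono) auto
    also have "\<dots> = 16 * C\<psi> * (\<integral>s. \<epsilon> * X0 / 2 * (norm (\<psi> s))\<^sup>2 \<partial>lborel)" by simp
    also have "\<dots> \<le> 16 * C\<psi> * integral\<^sup>L lborel P"
      using C\<psi>(1) by (intro mult_left_mono integral_mono PI Pge) (use i\<psi> in auto)
    finally show ?thesis .
  qed
  finally show ?thesis unfolding PE QE by (simp add: algebra_simps)
qed

end

section \<open>Asymptotics\<close>

lemma eventually_small: "c > 0 \<Longrightarrow> \<forall>\<^sub>F \<epsilon> in at_right (0::real). 0 < \<epsilon> \<and> \<epsilon> < c"
  by (auto simp: eventually_at_right_field intro!: exI[of _ c])

text \<open>A nonempty open set is not negligible. This turns linear independence modulo null sets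
  into evaluation at points.\<close>

lemma continuous_AE_zero:
  fixes f :: "'a::euclidean_space \<Rightarrow> 'b::real_normed_vector"
  assumes "open S" "continuous_on S f" "AE x in lebesgue_on S. f x = 0" "x \<in> S"
  shows "f x = 0"
proof (rule ccontr)
  assume "f x \<noteq> 0"
  let ?Z = "{x \<in> S. f x \<noteq> 0}"
  have "?Z = S \<inter> f -` (- {0})" by auto
  then have "open ?Z" using assms(1,2) by (simp add: continuous_open_preimage open_Compl)
  moreover have "AE x in lebesgue. x \<notin> ?Z"
    using assms(3) assms(1) by (subst (asm) AE_restrict_space_iff) auto
  then have "negligible ?Z"
    using \<open>open ?Z\<close> by (subst (asm) AE_iff_null_sets[symmetric]) (auto simp: negligible_iff_null_sets)
  ultimately show False using open_not_negligible[of ?Z] \<open>f x \<noteq> 0\<close> assms(4) by blast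
qed

context trial_strip
begin

text \<open>The competitor in the minimax is the span of \<open>j\<close> trial functions. Every
  combination of them is again a trial function, so one Rayleigh bound covers the whole
  span.\<close>

lemma lambda_DN_le:
  assumes pq: "p < q" "{p..q} \<subseteq> I"
    and m: "\<And>s. s \<in> {p..q} \<Longrightarrow> \<kappa> s \<le> m"
    and fibre: "\<And>c. \<bar>c\<bar> \<le> K \<Longrightarrow> integral {0..1} (\<lambda>t. (1 - \<epsilon> * c * t) * (chi' \<delta> t)\<^sup>2)
      \<le> (pi\<^sup>2 / 4 + \<epsilon> * c + C * \<epsilon>\<^sup>2) * integral {0..1} (\<lambda>t. (1 - \<epsilon> * c * t) * (chi \<delta> t)\<^sup>2)"
    and \<Psi>: "\<And>i s. (\<Psi> i has_real_derivative \<Psi>' i s) (at s)" "\<And>i. continuous_on UNIV (\<Psi>' i)"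
      "\<And>i s. i < j \<Longrightarrow> s \<notin> {p..q} \<Longrightarrow> \<Psi> i s = 0" "\<And>i s. i < j \<Longrightarrow> s \<notin> {p..q} \<Longrightarrow> \<Psi>' i s = 0"
    and \<sigma>: "\<And>i. i < j \<Longrightarrow> \<sigma> i \<in> {p..q}" "\<And>i. i < j \<Longrightarrow> \<Psi> i (\<sigma> i) > 0"
      "\<And>i k. i < j \<Longrightarrow> k < j \<Longrightarrow> i \<noteq> k \<Longrightarrow> \<Psi> k (\<sigma> i) = 0"
    and C': "C' \<ge> 0" "\<And>c :: nat \<Rightarrow> complex. (\<integral>s. (norm (\<Sum>i<j. c i * of_real (\<Psi>' i s)))\<^sup>2 \<partial>lborel) \<le>
        C' * (\<integral>s. (norm (\<Sum>i<j. c i * of_real (\<Psi> i s)))\<^sup>2 \<partial>lborel)"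
  shows "lambda_DN \<Omega> N j \<le> ereal ((pi / (2 * \<epsilon>))\<^sup>2 + m / \<epsilon> + C + 16 * C')"
proof -
  define b where "b i = trial (\<lambda>s. of_real (\<Psi> i s))" for i
  define \<psi> where "\<psi> c s = (\<Sum>i<j. c i * complex_of_real (\<Psi> i s))" for c s
  define \<psi>' where "\<psi>' c s = (\<Sum>i<j. c i * complex_of_real (\<Psi>' i s))" for c s
  have prof: "trial_profile I \<gamma> \<gamma>' \<gamma>'' \<epsilon> K \<delta> p q (\<psi> c) (\<psi>' c)" for c
  proof unfold_locales
    show "p < q" "{p..q} \<subseteq> I" by (rule pq)+
    show "(\<psi> c has_vector_derivative \<psi>' c s) (at s)" for s
      unfolding \<psi>_def[abs_def] \<psi>'_def
      by (intro has_vector_derivative_sum has_vector_derivative_mult_right has_vector_derivative_of_real)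
         (use \<Psi>(1) in \<open>simp add: has_real_derivative_iff_has_vector_derivative[symmetric]\<close>)
    show "continuous_on UNIV (\<psi>' c)" unfolding \<psi>'_def[abs_def] by (intro continuous_intros \<Psi>(2))
    show "\<psi> c s = 0" "\<psi>' c s = 0" if "s \<notin> {p..q}" for s
      using \<Psi>(3,4)[OF _ that] by (simp_all add: \<psi>_def \<psi>'_def)
  qed
  have tr: "(\<lambda>x. \<Sum>i<j. c i * b i x) = trial (\<psi> c)" for c
    unfolding \<psi>_def[abs_def] b_def trial_sum ..
  define V where "V = {(\<lambda>x. \<Sum>i<j. c i * b i x) | c. True}"
  have VD: "V \<subseteq> DN_form_domain \<Omega> N"
    unfolding V_def tr using trial_profile.trial_in_domain[OF prof] by blast
  have dim: "subspace_of_dim (lebesgue_on \<Omega>) j V"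
    unfolding subspace_of_dim_def
  proof (intro exI[of _ b] conjI allI impI)
    show "V = {(\<lambda>x. \<Sum>i<j. c i * b i x) | c. True}" by (rule V_def)
    fix c i assume ae: "AE x in lebesgue_on \<Omega>. (\<Sum>i<j. c i * b i x) = 0" and i: "i < j"
    have cont: "continuous_on \<Omega> (trial (\<psi> c))"
      by (rule continuous_on_subset[OF Ck_on_1_continuous[OF trial_profile.trial_Ck[OF prof]]]) simp
    have s: "\<sigma> i \<in> I" using \<sigma>(1)[OF i] pq by blast
    \<comment> \<open>At t = 1/3 the sine is 1/2, above \<delta> \<le> 1/4, so the transversal
      factor does not vanish and the value over \<open>\<sigma> i\<close> isolates
      \<open>c i\<close>.\<close>
    have "L \<epsilon> (vec2 (\<sigma> i) (1 / 3)) \<in> \<Omega>" by (rule L_in_\<Omega>[OF s]) simp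
    then have "trial (\<psi> c) (L \<epsilon> (vec2 (\<sigma> i) (1 / 3))) = 0"
      using continuous_AE_zero[OF open_\<Omega> cont] ae unfolding fun_cong[OF tr] by blast
    then have "\<psi> c (\<sigma> i) * of_real (chi \<delta> (1 / 3)) = 0" using s by (simp add: trial_L)
    moreover have "chi \<delta> (1 / 3) \<noteq> 0"
      using \<delta> sin_30 by (simp add: chi_def cutoff_def)
    ultimately have "\<psi> c (\<sigma> i) = 0" by simp
    moreover have "\<psi> c (\<sigma> i) = c i * of_real (\<Psi> i (\<sigma> i))"
      unfolding \<psi>_def using i \<sigma>(3)[OF i] by (subst sum.remove[of _ i]) auto
    ultimately show "c i = 0" using \<sigma>(2)[OF i] by simp
  qed
  show ?thesis
    unfolding lambda_DN_def
  proof (rule minimax_number_le[OF VD dim])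
    fix u assume u: "u \<in> V" and nz: "\<not> (AE x in lebesgue_on \<Omega>. u x = 0)"
    obtain c where c: "u = trial (\<psi> c)" using u unfolding V_def tr by blast
    interpret pr: trial_profile I \<gamma> \<gamma>' \<gamma>'' \<epsilon> K \<delta> p q "\<psi> c" "\<psi>' c" by (rule prof)
    have "L2_sq \<Omega> u > 0" using L2_sq_pos[OF pr.trial_L2(1)] nz unfolding c by blast
    moreover have "dirichlet_energy \<Omega> u \<le> ((pi / (2 * \<epsilon>))\<^sup>2 + m / \<epsilon> + C + 16 * C') * L2_sq \<Omega> u"
      unfolding c by (rule pr.trial_rayleigh[OF fibre m C'(1)]) (use C'(2)[of c] in \<open>simp_all add: \<psi>_def \<psi>'_def\<close>)
    ultimately show "dirichlet_energy \<Omega> u / (\<integral>x. (norm (u x))\<^sup>2 \<partial>lebesgue_on \<Omega>) \<le> (pi / (2 * \<epsilon>))\<^sup>2 + m / \<epsilon> + C + 16 * C'"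
      by (simp add: divide_le_eq L2_sq_def)
  qed
qed

end

context planar_curve
begin

text \<open>The estimate holds on the whole form domain and hence for each \<open>j\<close> alike.
  The remainder is O(1) here, so the loss of order o(1/\<epsilon>) is confined to the upper
  bound.\<close>

lemma lambda_DN_lower_bound:
  assumes K: "K \<ge> 0" "\<And>s. s \<in> I \<Longrightarrow> \<bar>\<kappa> s\<bar> \<le> K" and m: "\<And>s. s \<in> I \<Longrightarrow> m \<le> \<kappa> s"
    and inj: "\<forall>\<^sub>F \<epsilon> in at_right 0. inj_on (strip_map \<gamma> \<gamma>' \<epsilon>) (closure I \<times> {0..1})"
    and j: "j \<ge> 1"
  obtains C where "\<forall>\<^sub>F \<epsilon> in at_right 0. ereal ((pi / (2 * \<epsilon>))\<^sup>2 + m / \<epsilon> - C) \<le>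
    lambda_DN (strip_map \<gamma> \<gamma>' \<epsilon> ` (I \<times> {0<..<1})) (strip_map \<gamma> \<gamma>' \<epsilon> ` (I \<times> {1})) j"
proof -
  obtain C \<epsilon>0 :: real where C: "C \<ge> 0" "\<epsilon>0 > 0"
    "\<And>\<epsilon> c. \<lbrakk>0 < \<epsilon>; \<epsilon> < \<epsilon>0; \<bar>c\<bar> \<le> K\<rbrakk> \<Longrightarrow>
      fibre_lower_ineq (\<epsilon> * c) (pi\<^sup>2 / 4 + \<epsilon> * c - C * \<epsilon>\<^sup>2) (2 * \<bar>cot (\<epsilon>\<^sup>2)\<bar> + 1)"
    by (rule fibre_lower_bound[OF K(1)]) (rule that)
  \<comment> \<open>The quadratic term dominates. Nonnegativity is needed because the approximation
    argument multiplies an inequality by this constant.\<close>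
  have "\<forall>\<^sub>F \<epsilon> in at_right 0. (pi / (2 * \<epsilon>))\<^sup>2 + m / \<epsilon> - C \<ge> 0" by real_asymp
  moreover note eventually_small[OF C(2)]
  moreover have "\<forall>\<^sub>F \<epsilon> in at_right 0. 0 < \<epsilon> \<and> \<epsilon> < 1 / (2 * (K + 1))"
    by (rule eventually_small) (use K in simp)
  moreover note inj
  ultimately have "\<forall>\<^sub>F \<epsilon> in at_right 0. ereal ((pi / (2 * \<epsilon>))\<^sup>2 + m / \<epsilon> - C) \<le>
    lambda_DN (strip_map \<gamma> \<gamma>' \<epsilon> ` (I \<times> {0<..<1})) (strip_map \<gamma> \<gamma>' \<epsilon> ` (I \<times> {1})) j"
  proof eventually_elim
    fix \<epsilon> :: real
    define \<Lambda> where "\<Lambda> = (pi / (2 * \<epsilon>))\<^sup>2 + m / \<epsilon> - C"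
    assume \<Lambda>: "(pi / (2 * \<epsilon>))\<^sup>2 + m / \<epsilon> - C \<ge> 0" and e: "0 < \<epsilon> \<and> \<epsilon> < \<epsilon>0"
      and eK: "0 < \<epsilon> \<and> \<epsilon> < 1 / (2 * (K + 1))"
      and inj: "inj_on (strip_map \<gamma> \<gamma>' \<epsilon>) (closure I \<times> {0..1})"
    have "\<epsilon> * (2 * (K + 1)) < 1" using eK K by (simp add: field_simps)
    then have "\<epsilon> * K \<le> 1 / 2" using e by (simp add: algebra_simps)
    then interpret curved_strip I \<gamma> \<gamma>' \<gamma>'' \<epsilon> K
      using e inj K by unfold_locales auto
    have "\<Lambda> * L2_sq \<Omega> u \<le> dirichlet_energy \<Omega> u" if u: "u \<in> DN_form_domain \<Omega> N" for u
    proof (rule strip_lower_bound[OF u])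
      fix a b :: real assume ab: "a < b" "{a..b} \<subseteq> I"
      show "\<Lambda> * L2_sq (L \<epsilon> ` rect {a<..<b} {0<..<1}) u \<le> dirichlet_energy \<Omega> u"
      proof (rule strip_lower_bound_local[OF u ab])
        show "\<Lambda> \<ge> 0" using \<Lambda> by (simp add: \<Lambda>_def)
        fix U assume "Ck_on 1 \<Omega> U" "continuous_on (closure \<Omega>) U" "U \<in> W12 \<Omega>"
        from strip_lower_bound_C1[OF this ab C(3) m] e
        show "\<Lambda> * L2_sq (L \<epsilon> ` rect {a<..<b} {0<..<1}) U
          \<le> L2_sq (L \<epsilon> ` rect {a<..<b} {0<..<1}) (grad U) +
            (2 * \<bar>cot (\<epsilon>\<^sup>2)\<bar> + 1) / \<epsilon> * L2_sq {a..b} (\<lambda>s. U (\<gamma> s))"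
          unfolding \<Lambda>_def by blast
      qed
    qed
    note energy = this
    have "ereal \<Lambda> \<le> lambda_DN \<Omega> N j"
      unfolding lambda_DN_def
    proof (rule minimax_number_ge[OF j])
      fix u assume u: "u \<in> DN_form_domain \<Omega> N" and nz: "\<not> (AE x in lebesgue_on \<Omega>. u x = 0)"
      have "L2_sq \<Omega> u > 0" using u nz by (intro L2_sq_pos) (auto simp: DN_form_domain_def W12_def)
      then show "\<Lambda> \<le> dirichlet_energy \<Omega> u / (\<integral>x. (norm (u x))\<^sup>2 \<partial>lebesgue_on \<Omega>)"
        using energy[OF u] by (simp add: le_divide_eq L2_sq_def)
    qed
    then show "ereal ((pi / (2 * \<epsilon>))\<^sup>2 + m / \<epsilon> - C) \<le>
      lambda_DN (strip_map \<gamma> \<gamma>' \<epsilon> ` (I \<times> {0<..<1})) (strip_map \<gamma> \<gamma>' \<epsilon> ` (I \<times> {1})) j"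
      by (simp add: \<Lambda>_def \<Omega>_def N_def)
  qed
  then show ?thesis using that by blast
qed

lemma L_double: "L (2 * \<epsilon>) (vec2 s t) = L \<epsilon> (vec2 s (2 * t))"
  by (simp add: L_def strip_map_def algebra_simps)

text \<open>The interval around \<open>s0\<close> and the bumps are fixed before \<epsilon>, which
  makes the longitudinal cost \<open>C'\<close> independent of \<epsilon>.\<close>

lemma lambda_DN_upper_bound:
  assumes K: "K \<ge> 0" "\<And>s. s \<in> I \<Longrightarrow> \<bar>\<kappa> s\<bar> \<le> K" and s0: "s0 \<in> I" "\<kappa> s0 < m"
    and inj: "\<forall>\<^sub>F \<epsilon> in at_right 0. inj_on (strip_map \<gamma> \<gamma>' \<epsilon>) (closure I \<times> {0..1})"
  obtains C where "\<forall>\<^sub>F \<epsilon> in at_right 0.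
    lambda_DN (strip_map \<gamma> \<gamma>' \<epsilon> ` (I \<times> {0<..<1})) (strip_map \<gamma> \<gamma>' \<epsilon> ` (I \<times> {1})) j
      \<le> ereal ((pi / (2 * \<epsilon>))\<^sup>2 + m / \<epsilon> + C)"
proof -
  have "open {s \<in> I. \<kappa> s < m}"
  proof -
    have "{s \<in> I. \<kappa> s < m} = I \<inter> \<kappa> -` {..<m}" by auto
    then show ?thesis using continuous_open_preimage[OF continuous_curvature open_I, of "{..<m}"] by simp
  qed
  then obtain e where e: "e > 0" "cball s0 e \<subseteq> {s \<in> I. \<kappa> s < m}"
    using s0 open_contains_cball by blast
  define p q where "p = s0 - e" and "q = s0 + e"
  have pq: "p < q" "{p..q} \<subseteq> I" "\<And>s. s \<in> {p..q} \<Longrightarrow> \<kappa> s \<le> m"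
  proof -
    have sub: "{p..q} \<subseteq> {s \<in> I. \<kappa> s < m}"
      using e(2) by (simp add: p_def q_def cball_eq_atLeastAtMost)
    show "p < q" using e(1) by (simp add: p_def q_def)
    show "{p..q} \<subseteq> I" using sub by blast
    show "\<kappa> s \<le> m" if "s \<in> {p..q}" for s using subsetD[OF sub that] by simp
  qed
  obtain \<Psi> \<Psi>' :: "nat \<Rightarrow> real \<Rightarrow> real" and \<sigma> :: "nat \<Rightarrow> real" and C' :: real where C': "C' \<ge> 0"
    and \<Psi>: "\<And>i s. (\<Psi> i has_real_derivative \<Psi>' i s) (at s)" "\<And>i. continuous_on UNIV (\<Psi>' i)"
    "\<And>i s. i < j \<Longrightarrow> s \<notin> {p..q} \<Longrightarrow> \<Psi> i s = 0" "\<And>i s. i < j \<Longrightarrow> s \<notin> {p..q} \<Longrightarrow> \<Psi>' i s = 0"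
    and \<sigma>: "\<And>i. i < j \<Longrightarrow> \<sigma> i \<in> {p..q}" "\<And>i. i < j \<Longrightarrow> \<Psi> i (\<sigma> i) > 0"
    "\<And>i k. i < j \<Longrightarrow> k < j \<Longrightarrow> i \<noteq> k \<Longrightarrow> \<Psi> k (\<sigma> i) = 0"
    and C'2: "\<And>c :: nat \<Rightarrow> complex. (\<integral>s. (norm (\<Sum>i<j. c i * of_real (\<Psi>' i s)))\<^sup>2 \<partial>lborel) \<le>
        C' * (\<integral>s. (norm (\<Sum>i<j. c i * of_real (\<Psi> i s)))\<^sup>2 \<partial>lborel)"
    by (rule bump_family[OF pq(1)]) (rule that)
  obtain C \<epsilon>0 :: real where C: "C \<ge> 0" "\<epsilon>0 > 0"
    "\<And>\<epsilon> c. \<lbrakk>0 < \<epsilon>; \<epsilon> < \<epsilon>0; \<bar>c\<bar> \<le> K\<rbrakk> \<Longrightarrow>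
      integral {0..1} (\<lambda>t. (1 - \<epsilon> * c * t) * (chi' (\<epsilon>\<^sup>2) t)\<^sup>2)
      \<le> (pi\<^sup>2 / 4 + \<epsilon> * c + C * \<epsilon>\<^sup>2) * integral {0..1} (\<lambda>t. (1 - \<epsilon> * c * t) * (chi (\<epsilon>\<^sup>2) t)\<^sup>2)"
    by (rule fibre_upper_bound[OF K(1)]) (rule that)
  \<comment> \<open>Injectivity assumed at width 2 \<epsilon> is injectivity at width \<epsilon>
    with t ranging up to 2.\<close>
  have "filterlim (\<lambda>\<epsilon>::real. 2 * \<epsilon>) (at_right 0) (at_right 0)" by real_asymp
  from eventually_compose_filterlim[OF inj this]
  have "\<forall>\<^sub>F \<epsilon> in at_right 0. inj_on (strip_map \<gamma> \<gamma>' (2 * \<epsilon>)) (closure I \<times> {0..1})" .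
  moreover note eventually_small[OF C(2)]
  moreover have "\<forall>\<^sub>F \<epsilon> in at_right 0. 0 < \<epsilon> \<and> \<epsilon> < 1 / (4 * (K + 1))"
    by (rule eventually_small) (use K in simp)
  moreover note inj
  ultimately have "\<forall>\<^sub>F \<epsilon> in at_right 0.
    lambda_DN (strip_map \<gamma> \<gamma>' \<epsilon> ` (I \<times> {0<..<1})) (strip_map \<gamma> \<gamma>' \<epsilon> ` (I \<times> {1})) j
      \<le> ereal ((pi / (2 * \<epsilon>))\<^sup>2 + m / \<epsilon> + (C + 16 * C'))"
  proof eventually_elim
    fix \<epsilon> :: real
    assume inj2: "inj_on (strip_map \<gamma> \<gamma>' (2 * \<epsilon>)) (closure I \<times> {0..1})" and e: "0 < \<epsilon> \<and> \<epsilon> < \<epsilon>0"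
      and eK: "0 < \<epsilon> \<and> \<epsilon> < 1 / (4 * (K + 1))"
      and inj: "inj_on (strip_map \<gamma> \<gamma>' \<epsilon>) (closure I \<times> {0..1})"
    have "\<epsilon> * (4 * (K + 1)) < 1" using eK K by (simp add: field_simps)
    moreover have "0 \<le> \<epsilon> * K" using e K by simp
    ultimately have eK4: "\<epsilon> * K \<le> 1 / 4" and e2: "\<epsilon> \<le> 1 / 2" using e by (auto simp: algebra_simps)
    then have e4: "\<epsilon>\<^sup>2 \<le> 1 / 4" using power_mono[OF e2, of 2] e by (simp add: power2_eq_square)
    have i2: "inj_on (L \<epsilon>) (rect I {0<..<2})"
    proof (rule inj_onI)
      fix x y assume xy: "x \<in> rect I {0<..<2}" "y \<in> rect I {0<..<2}" "L \<epsilon> x = L \<epsilon> y"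
      have "L (2 * \<epsilon>) (vec2 (x $ 1) (x $ 2 / 2)) = L (2 * \<epsilon>) (vec2 (y $ 1) (y $ 2 / 2))"
        using xy(3) by (simp add: L_double)
      then have "vec2 (x $ 1) (x $ 2 / 2) = vec2 (y $ 1) (y $ 2 / 2)"
        using xy(1,2) in_closure by - (rule inj_onD[OF L_inj_on[OF inj2]], auto simp: rect_def)
      then have "x $ 1 = y $ 1" "x $ 2 / 2 = y $ 2 / 2" by (metis vec2_nth)+
      then show "x = y" by (simp add: vec_eq_iff forall_2)
    qed
    interpret trial_strip I \<gamma> \<gamma>' \<gamma>'' \<epsilon> K "\<epsilon>\<^sup>2"
      using e inj K eK4 e4 i2 by unfold_locales auto
    have "lambda_DN \<Omega> N j \<le> ereal ((pi / (2 * \<epsilon>))\<^sup>2 + m / \<epsilon> + C + 16 * C')"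
      by (rule lambda_DN_le[OF pq C(3) \<Psi> \<sigma> C' C'2]) (use e in auto)
    then show "lambda_DN (strip_map \<gamma> \<gamma>' \<epsilon> ` (I \<times> {0<..<1})) (strip_map \<gamma> \<gamma>' \<epsilon> ` (I \<times> {1})) j
      \<le> ereal ((pi / (2 * \<epsilon>))\<^sup>2 + m / \<epsilon> + (C + 16 * C'))"
      by (simp add: \<Omega>_def N_def add.assoc)
  qed
  then show ?thesis using that by blast
qed

end

theorem theorem1p1:
  fixes I :: "real set" and \<gamma> \<gamma>' \<gamma>'' :: "real \<Rightarrow> real^2" and j :: nat
  assumes "open I" and "is_interval I" and "I \<noteq> {}"
    and "C2_curve_on (closure I) \<gamma> \<gamma>' \<gamma>''"
    and "\<forall>s\<in>closure I. norm (\<gamma>' s) = 1"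
    and "bounded (curvature \<gamma>' \<gamma>'' ` I)"
    and "uniformly_continuous_on I (curvature \<gamma>' \<gamma>'')"
    and "\<forall>\<^sub>F \<epsilon> in at_right 0. inj_on (strip_map \<gamma> \<gamma>' \<epsilon>) (closure I \<times> {0..1})"
    and "j \<ge> 1"
  shows "\<exists>r :: real \<Rightarrow> real. r \<in> o[at_right 0](\<lambda>\<epsilon>. 1 / \<epsilon>) \<and>
    (\<forall>\<^sub>F \<epsilon> in at_right 0.
       lambda_DN (strip_map \<gamma> \<gamma>' \<epsilon> ` (I \<times> {0<..<1})) (strip_map \<gamma> \<gamma>' \<epsilon> ` (I \<times> {1})) j =
       ereal ((pi / (2 * \<epsilon>))\<^sup>2 + (INF s\<in>I. curvature \<gamma>' \<gamma>'' s) / \<epsilon> + r \<epsilon>))"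
proof -
  interpret planar_curve I \<gamma> \<gamma>' \<gamma>''
    using assms(1-5) by unfold_locales auto
  obtain K where "K > 0" "\<forall>x\<in>\<kappa> ` I. norm x \<le> K"
    using assms(6) unfolding bounded_pos by blast
  then have K: "K \<ge> 0" "\<And>s. s \<in> I \<Longrightarrow> \<bar>\<kappa> s\<bar> \<le> K" by auto
  define m where "m = (INF s\<in>I. \<kappa> s)"
  have bdd: "bdd_below (\<kappa> ` I)"
    using K(2) by (intro bdd_belowI2[of _ "- K"]) (auto simp: abs_le_iff minus_le_iff)
  have m: "m \<le> \<kappa> s" if "s \<in> I" for s unfolding m_def by (rule cINF_lower[OF bdd that])
  define lam where "lam \<epsilon> = lambda_DN (strip_map \<gamma> \<gamma>' \<epsilon> ` (I \<times> {0<..<1})) (strip_map \<gamma> \<gamma>' \<epsilon> ` (I \<times> {1})) j" for \<epsilon>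
  \<comment> \<open>\<open>real_of_ereal\<close> loses nothing for small \<epsilon>, because the two
    bounds make the minimax number finite; this is \<open>fin\<close>.\<close>
  define r where "r \<epsilon> = real_of_ereal (lam \<epsilon>) - (pi / (2 * \<epsilon>))\<^sup>2 - m / \<epsilon>" for \<epsilon>
  obtain C1 where lo: "\<forall>\<^sub>F \<epsilon> in at_right 0. ereal ((pi / (2 * \<epsilon>))\<^sup>2 + m / \<epsilon> - C1) \<le> lam \<epsilon>"
    using lambda_DN_lower_bound[OF K m assms(8,9)] unfolding lam_def by blast
  \<comment> \<open>\<open>\<eta>\<close> bridges the gap to an infimum that may not be attained.
    The constant may depend on \<open>\<eta>\<close>, so \<open>\<eta>\<close> is fixed before
    \<epsilon> tends to 0.\<close>
  have up: "\<exists>C. \<forall>\<^sub>F \<epsilon> in at_right 0. lam \<epsilon> \<le> ereal ((pi / (2 * \<epsilon>))\<^sup>2 + (m + \<eta>) / \<epsilon> + C)" if \<eta>: "\<eta> > 0" for \<eta>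
  proof -
    obtain s0 where s0: "s0 \<in> I" "\<kappa> s0 < m + \<eta>"
      using cINF_less_iff[OF assms(3) bdd, of "m + \<eta>"] \<eta> unfolding m_def by auto
    from lambda_DN_upper_bound[OF K s0 assms(8), of j] show ?thesis unfolding lam_def by blast
  qed
  have fin: "\<forall>\<^sub>F \<epsilon> in at_right 0. lam \<epsilon> = ereal ((pi / (2 * \<epsilon>))\<^sup>2 + m / \<epsilon> + r \<epsilon>)"
  proof -
    obtain C2 where "\<forall>\<^sub>F \<epsilon> in at_right 0. lam \<epsilon> \<le> ereal ((pi / (2 * \<epsilon>))\<^sup>2 + (m + 1) / \<epsilon> + C2)"
      using up[of 1] by auto
    with lo show ?thesis
    proof eventually_elim
      fix \<epsilon> :: real
      assume "ereal ((pi / (2 * \<epsilon>))\<^sup>2 + m / \<epsilon> - C1) \<le> lam \<epsilon>" "lam \<epsilon> \<le> ereal ((pi / (2 * \<epsilon>))\<^sup>2 + (m + 1) / \<epsilon> + C2)"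
      then show "lam \<epsilon> = ereal ((pi / (2 * \<epsilon>))\<^sup>2 + m / \<epsilon> + r \<epsilon>)"
        by (cases "lam \<epsilon>") (auto simp: r_def)
    qed
  qed
  have "r \<in> o[at_right 0](\<lambda>\<epsilon>. 1 / \<epsilon>)"
  proof (rule landau_o.smallI)
    fix \<eta> :: real assume \<eta>: "\<eta> > 0"
    \<comment> \<open>Half of \<open>\<eta>\<close> goes to the infimum, the other half absorbs
      \<open>C2\<close>.\<close>
    obtain C2 where "\<forall>\<^sub>F \<epsilon> in at_right 0. lam \<epsilon> \<le> ereal ((pi / (2 * \<epsilon>))\<^sup>2 + (m + \<eta> / 2) / \<epsilon> + C2)"
      using up[of "\<eta> / 2"] \<eta> by auto
    moreover have "\<forall>\<^sub>F \<epsilon> in at_right 0. C1 \<le> \<eta> / \<epsilon>" "\<forall>\<^sub>F \<epsilon> in at_right 0. C2 \<le> \<eta> / 2 / \<epsilon>"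
      using \<eta> by real_asymp+
    moreover have "\<forall>\<^sub>F \<epsilon> in at_right 0. 0 < \<epsilon> \<and> \<epsilon> < (1::real)" by (rule eventually_small) simp
    moreover note lo fin
    ultimately show "\<forall>\<^sub>F \<epsilon> in at_right 0. norm (r \<epsilon>) \<le> \<eta> * norm (1 / \<epsilon>)"
    proof eventually_elim
      fix \<epsilon> :: real
      assume 1: "lam \<epsilon> \<le> ereal ((pi / (2 * \<epsilon>))\<^sup>2 + (m + \<eta> / 2) / \<epsilon> + C2)" "C1 \<le> \<eta> / \<epsilon>" "C2 \<le> \<eta> / 2 / \<epsilon>"
        "0 < \<epsilon> \<and> \<epsilon> < 1" "ereal ((pi / (2 * \<epsilon>))\<^sup>2 + m / \<epsilon> - C1) \<le> lam \<epsilon>"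
        "lam \<epsilon> = ereal ((pi / (2 * \<epsilon>))\<^sup>2 + m / \<epsilon> + r \<epsilon>)"
      have "(m + \<eta> / 2) / \<epsilon> = m / \<epsilon> + \<eta> / 2 / \<epsilon>" by (simp add: add_divide_distrib)
      then have "r \<epsilon> \<le> \<eta> / 2 / \<epsilon> + C2" "- C1 \<le> r \<epsilon>" using 1(1,5) unfolding 1(6) by auto
      moreover have "\<eta> / 2 / \<epsilon> + \<eta> / 2 / \<epsilon> = \<eta> / \<epsilon>" by simp
      ultimately have "\<bar>r \<epsilon>\<bar> \<le> \<eta> / \<epsilon>" using 1(2,3) by linarith
      then show "norm (r \<epsilon>) \<le> \<eta> * norm (1 / \<epsilon>)" using 1(4) by simp
    qed
  qed
  with fin show ?thesis unfolding lam_def m_def by blast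
qed

end
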